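(* Let $A\subseteq B$ be an extension of integral domains, let $b\in B$ be separably algebraic over $\operatorname{Frac}(A)$, let $R$ be an $A$-algebra, and let $\{\cdot,\cdot\}$ be a biderivation on $R$ with values in $R\otimes_A B$. Then there is a nonzero $f\in A[b]$ such that $\{\cdot,\cdot\}$ extends uniquely to a biderivation on $R\otimes_A A[b]_f$ with values in $R\otimes_A B_f$. Moreover, this is a lifting extension.
   Context: All rings are commutative and unital. $A[b]_f$ and $B_f$ denote the localisations at (the powers of) $f$. The $R$-module structure on $R\otimes_A B$ and the $(R\otimes_A A[b]_f)$-module structure on $R\otimes_A B_f$ are the natural ones, and extensions are with respect to the natural maps $R\to R\otimes_A A[b]_f$ and $R\otimes_A B\to R\otimes_A B_f$. The biderivation is not assumed to be $A$-bilinear. For a ring $R$ and an $R$-module $M$, an $M$-valued biderivation on $R$ (a biderivation on $R$ with values in $M$) is a function $\{\cdot,\cdot\}:R\times R\to M$ such that for each $r\in R$ both $\{r,\cdot\}$ and $\{\cdot,r\}$ are $M$-valued derivations on $R$ (additive maps $d:R\to M$ with $d(xy)=x\,d(y)+y\,d(x)$). Given a ring homomorphism $\phi:R\to R'$, an $R'$-module $M'$ and an additive map $\psi:M\to M'$ with $\psi(rx)=\phi(r)\psi(x)$, an $M'$-valued biderivation on $R'$ extends an $M$-valued biderivation on $R$ if $\psi(\{r,s\})=\{\phi(r),\phi(s)\}$ for all $r,s\in R$. A bidifferential ideal pair of an $M$-valued biderivation on $R$ is a pair of ideals $I,J\subseteq R$ such that $\{I,R\}\subseteq IM$ and $\{R,J\}\subseteq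 JM$. An extension of an $M$-valued biderivation $\{\cdot,\cdot\}$ on $R$ to an $M'$-valued biderivation $\{\cdot,\cdot\}$ on $R'$, with respect to a ring homomorphism $\phi:R\to R'$ and an additive map $\psi:M\to M'$ with $\psi(rx)=\phi(r)\psi(x)$ for all $r\in R$ and $x\in M$, is lifting if whenever $(I,J)$ is a bidifferential ideal pair for $(R,M,\{\cdot,\cdot\})$, then $(IR',JR')$ is a bidifferential ideal pair for $(R',M',\{\cdot,\cdot\})$, where $IR'$ denotes the ideal of $R'$ generated by $\phi(I)$ and similarly for $JR'$. *)

theory Defs
  imports "HOL-Algebra.Algebra"
begin

text \<open>An \<open>A\<close>-algebra is a record satisfying the locale \<^locale>\<open>algebra\<close>, and a
  module is a record satisfying \<^locale>\<open>module\<close>. The ring \<open>S\<close>, viewed as an algebra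
  (or just a module) along a ring homomorphism \<open>h\<close> into \<open>S\<close>:\<close>

definition along :: "('a \<Rightarrow> 's) \<Rightarrow> ('s, 'm) ring_scheme \<Rightarrow> ('a, 's) module"
  where "along h S =
    \<lparr>carrier = carrier S, monoid.mult = monoid.mult S, one = one S, ring.zero = ring.zero S, ring.add = ring.add S,
     smult = (\<lambda>a x. h a \<otimes>\<^bsub>S\<^esub> x)\<rparr>"


section \<open>Tensor products of algebras\<close>

text \<open>The monoid ring \<open>\<int>[G]\<close>: finitely supported integer-valued functions on \<open>G\<close>
  with the convolution product.\<close>

definition int_monoid_ring :: "('g, 'm) monoid_scheme \<Rightarrow> ('g \<Rightarrow>\<^sub>0 int) ring"
  where "int_monoid_ring G =
    \<lparr>carrier = {c. Poly_Mapping.keys c \<subseteq> carrier G},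
     monoid.mult = (\<lambda>c d. frag_extend (\<lambda>x. frag_extend (\<lambda>y. frag_of (x \<otimes>\<^bsub>G\<^esub> y)) d) c),
     one = frag_of \<one>\<^bsub>G\<^esub>, ring.zero = 0, ring.add = (+)\<rparr>"

text \<open>The defining relations of \<open>R \<otimes>\<^sub>A S\<close> in the free abelian group on \<open>R \<times> S\<close>.
  The set is stable under multiplication by basis elements, so the subgroup it generates
  coincides with the ideal it generates in the monoid ring \<open>\<int>[R \<times> S]\<close>, and the quotient below
  is the usual tensor product of modules with \<open>(r \<otimes> s)(r' \<otimes> s') = rr' \<otimes> ss'\<close>.\<close>

definition tensor_rels ::
    "('a, 'k) ring_scheme \<Rightarrow> ('a, 'r, 'm) module_scheme \<Rightarrow> ('a, 's, 'n) module_scheme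
      \<Rightarrow> (('r \<times> 's) \<Rightarrow>\<^sub>0 int) set"
  where "tensor_rels A R S =
    {frag_of (r \<oplus>\<^bsub>R\<^esub> r', s) - frag_of (r, s) - frag_of (r', s) | r r' s.
       r \<in> carrier R \<and> r' \<in> carrier R \<and> s \<in> carrier S} \<union>
    {frag_of (r, s \<oplus>\<^bsub>S\<^esub> s') - frag_of (r, s) - frag_of (r, s') | r s s'.
       r \<in> carrier R \<and> s \<in> carrier S \<and> s' \<in> carrier S} \<union>
    {frag_of (a \<odot>\<^bsub>R\<^esub> r, s) - frag_of (r, a \<odot>\<^bsub>S\<^esub> s) | a r s.
       a \<in> carrier A \<and> r \<in> carrier R \<and> s \<in> carrier S}"

definition tensor_ideal ::
    "('a, 'k) ring_scheme \<Rightarrow> ('a, 'r, 'm) module_scheme \<Rightarrow> ('a, 's, 'n) module_scheme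
      \<Rightarrow> (('r \<times> 's) \<Rightarrow>\<^sub>0 int) set"
  where "tensor_ideal A R S = Idl\<^bsub>int_monoid_ring (R \<times>\<times> S)\<^esub> (tensor_rels A R S)"

definition tensor ::
    "('a, 'k) ring_scheme \<Rightarrow> ('a, 'r, 'm) module_scheme \<Rightarrow> ('a, 's, 'n) module_scheme
      \<Rightarrow> (('r \<times> 's) \<Rightarrow>\<^sub>0 int) set ring"
  where "tensor A R S = int_monoid_ring (R \<times>\<times> S) Quot tensor_ideal A R S"

definition pure_tensor ::
    "('a, 'k) ring_scheme \<Rightarrow> ('a, 'r, 'm) module_scheme \<Rightarrow> ('a, 's, 'n) module_scheme
      \<Rightarrow> 'r \<Rightarrow> 's \<Rightarrow> (('r \<times> 's) \<Rightarrow>\<^sub>0 int) set"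
  where "pure_tensor A R S r s =
    tensor_ideal A R S +>\<^bsub>int_monoid_ring (R \<times>\<times> S)\<^esub> frag_of (r, s)"

definition tensor_left ::
    "('a, 'k) ring_scheme \<Rightarrow> ('a, 'r, 'm) module_scheme \<Rightarrow> ('a, 's, 'n) module_scheme
      \<Rightarrow> 'r \<Rightarrow> (('r \<times> 's) \<Rightarrow>\<^sub>0 int) set"
  where "tensor_left A R S r = pure_tensor A R S r \<one>\<^bsub>S\<^esub>"

text \<open>The map \<open>R \<otimes>\<^sub>A S \<rightarrow> R \<otimes>\<^sub>A T\<close>, \<open>r \<otimes> s \<mapsto> r \<otimes> h s\<close>, induced by a homomorphism
  \<open>h : S \<rightarrow> T\<close> of \<open>A\<close>-algebras. The source \<open>S\<close> does not occur: all representatives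
  of a coset have images in one coset, which is the union.\<close>

definition tensor_map ::
    "('a, 'k) ring_scheme \<Rightarrow> ('a, 'r, 'm) module_scheme \<Rightarrow> ('a, 't, 'n) module_scheme
      \<Rightarrow> ('s \<Rightarrow> 't) \<Rightarrow> (('r \<times> 's) \<Rightarrow>\<^sub>0 int) set \<Rightarrow> (('r \<times> 't) \<Rightarrow>\<^sub>0 int) set"
  where "tensor_map A R T h Z =
    (\<Union>c\<in>Z. tensor_ideal A R T +>\<^bsub>int_monoid_ring (R \<times>\<times> T)\<^esub>
       frag_extend (\<lambda>(r, s). frag_of (r, h s)) c)"


section \<open>Localisation\<close>

definition loc_rel :: "('a, 'm) ring_scheme \<Rightarrow> 'a set \<Rightarrow> (('a \<times> 'a) \<times> ('a \<times> 'a)) set"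
  where "loc_rel R S =
    {((r, s), (r', s')) | r s r' s'.
       r \<in> carrier R \<and> s \<in> S \<and> r' \<in> carrier R \<and> s' \<in> S \<and>
       (\<exists>t\<in>S. t \<otimes>\<^bsub>R\<^esub> (r \<otimes>\<^bsub>R\<^esub> s') = t \<otimes>\<^bsub>R\<^esub> (r' \<otimes>\<^bsub>R\<^esub> s))}"

text \<open>The fraction \<open>r/s\<close>.\<close>

definition frac :: "('a, 'm) ring_scheme \<Rightarrow> 'a set \<Rightarrow> 'a \<Rightarrow> 'a \<Rightarrow> ('a \<times> 'a) set"
  where "frac R S r s = loc_rel R S `` {(r, s)}"

definition localisation :: "('a, 'm) ring_scheme \<Rightarrow> 'a set \<Rightarrow> ('a \<times> 'a) set ring"
  where "localisation R S =
    \<lparr>carrier = (carrier R \<times> S) // loc_rel R S,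
     monoid.mult = (\<lambda>Y Z. \<Union>(r, s)\<in>Y. \<Union>(r', s')\<in>Z. frac R S (r \<otimes>\<^bsub>R\<^esub> r') (s \<otimes>\<^bsub>R\<^esub> s')),
     one = frac R S \<one>\<^bsub>R\<^esub> \<one>\<^bsub>R\<^esub>,
     ring.zero = frac R S \<zero>\<^bsub>R\<^esub> \<one>\<^bsub>R\<^esub>,
     ring.add = (\<lambda>Y Z. \<Union>(r, s)\<in>Y. \<Union>(r', s')\<in>Z.
              frac R S (r \<otimes>\<^bsub>R\<^esub> s' \<oplus>\<^bsub>R\<^esub> r' \<otimes>\<^bsub>R\<^esub> s) (s \<otimes>\<^bsub>R\<^esub> s'))\<rparr>"

definition to_loc :: "('a, 'm) ring_scheme \<Rightarrow> 'a set \<Rightarrow> 'a \<Rightarrow> ('a \<times> 'a) set"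
  where "to_loc R S r = frac R S r \<one>\<^bsub>R\<^esub>"

definition powers :: "('a, 'm) ring_scheme \<Rightarrow> 'a \<Rightarrow> 'a set"
  where "powers R f = range (\<lambda>n::nat. f [^]\<^bsub>R\<^esub> n)"

abbreviation loc_at :: "('a, 'm) ring_scheme \<Rightarrow> 'a \<Rightarrow> ('a \<times> 'a) set ring"
  where "loc_at R f \<equiv> localisation R (powers R f)"

text \<open>The map \<open>r/s \<mapsto> r/s\<close> from the localisation of a subring of \<open>R\<close> (at a subset of \<open>S\<close>)
  to that of \<open>R\<close> at \<open>S\<close>. Again the union is over fractions that all agree.\<close>

definition loc_incl :: "('a, 'm) ring_scheme \<Rightarrow> 'a set \<Rightarrow> ('a \<times> 'a) set \<Rightarrow> ('a \<times> 'a) set"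
  where "loc_incl R S Z = (\<Union>(r, s)\<in>Z. frac R S r s)"

abbreviation frac_field :: "('a, 'm) ring_scheme \<Rightarrow> ('a \<times> 'a) set ring"
  where "frac_field R \<equiv> localisation R (carrier R - {\<zero>\<^bsub>R\<^esub>})"

text \<open>For a subring \<open>A\<close> of a domain \<open>B\<close>, the copy of \<open>Frac A\<close> inside \<open>Frac B\<close>.\<close>

definition frac_subfield :: "('a, 'm) ring_scheme \<Rightarrow> 'a set \<Rightarrow> ('a \<times> 'a) set set"
  where "frac_subfield B A =
    {frac B (carrier B - {\<zero>\<^bsub>B\<^esub>}) a s | a s. a \<in> A \<and> s \<in> A - {\<zero>\<^bsub>B\<^esub>}}"


section \<open>Separable elements\<close>

text \<open>The formal derivative. Polynomials of \<^const>\<open>univ_poly\<close> are lists of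
  coefficients, leading coefficient first, without leading zeros.\<close>

definition pderivative :: "('a, 'm) ring_scheme \<Rightarrow> 'a list \<Rightarrow> 'a list"
  where "pderivative L p =
    ring.normalize L (map (\<lambda>i. [i] \<cdot>\<^bsub>L\<^esub> ring.coeff L p i) (rev [1..<length p]))"

text \<open>A polynomial over a field is separable if it is coprime to its derivative.\<close>

definition separable_poly :: "('a, 'm) ring_scheme \<Rightarrow> 'a set \<Rightarrow> 'a list \<Rightarrow> bool"
  where "separable_poly L K p \<longleftrightarrow>
    (\<forall>d \<in> carrier (K[X]\<^bsub>L\<^esub>).
       d divides\<^bsub>K[X]\<^bsub>L\<^esub>\<^esub> p \<and> d divides\<^bsub>K[X]\<^bsub>L\<^esub>\<^esub> pderivative L p \<longrightarrow> d \<in> Units (K[X]\<^bsub>L\<^esub>))"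

text \<open>\<open>K\<close> is a subfield of the field \<open>L\<close>, and \<^const>\<open>ring.Irr\<close> is the minimal polynomial.\<close>

definition separably_algebraic :: "('a, 'm) ring_scheme \<Rightarrow> 'a set \<Rightarrow> 'a \<Rightarrow> bool"
  where "separably_algebraic L K x \<longleftrightarrow>
    (ring.algebraic L over K) x \<and> separable_poly L K (ring.Irr L K x)"


section \<open>Biderivations\<close>

definition derivation ::
    "('r, 'm) ring_scheme \<Rightarrow> ('r, 'v, 'n) module_scheme \<Rightarrow> ('r \<Rightarrow> 'v) \<Rightarrow> bool"
  where "derivation R M d \<longleftrightarrow>
    d \<in> carrier R \<rightarrow> carrier M \<and>
    (\<forall>x \<in> carrier R. \<forall>y \<in> carrier R. d (x \<oplus>\<^bsub>R\<^esub> y) = d x \<oplus>\<^bsub>M\<^esub> d y) \<and>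
    (\<forall>x \<in> carrier R. \<forall>y \<in> carrier R.
       d (x \<otimes>\<^bsub>R\<^esub> y) = (x \<odot>\<^bsub>M\<^esub> d y) \<oplus>\<^bsub>M\<^esub> (y \<odot>\<^bsub>M\<^esub> d x))"

definition biderivation ::
    "('r, 'm) ring_scheme \<Rightarrow> ('r, 'v, 'n) module_scheme \<Rightarrow> ('r \<Rightarrow> 'r \<Rightarrow> 'v) \<Rightarrow> bool"
  where "biderivation R M D \<longleftrightarrow>
    (\<forall>r \<in> carrier R. derivation R M (D r) \<and> derivation R M (\<lambda>s. D s r))"

definition semilinear ::
    "('r, 'm) ring_scheme \<Rightarrow> ('r, 'v, 'n) module_scheme \<Rightarrow> ('r', 'v', 'o) module_scheme
      \<Rightarrow> ('r \<Rightarrow> 'r') \<Rightarrow> ('v \<Rightarrow> 'v') \<Rightarrow> bool"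
  where "semilinear R M M' \<phi> \<psi> \<longleftrightarrow>
    \<psi> \<in> carrier M \<rightarrow> carrier M' \<and>
    (\<forall>x \<in> carrier M. \<forall>y \<in> carrier M. \<psi> (x \<oplus>\<^bsub>M\<^esub> y) = \<psi> x \<oplus>\<^bsub>M'\<^esub> \<psi> y) \<and>
    (\<forall>r \<in> carrier R. \<forall>x \<in> carrier M. \<psi> (r \<odot>\<^bsub>M\<^esub> x) = \<phi> r \<odot>\<^bsub>M'\<^esub> \<psi> x)"

definition extends_biderivation ::
    "('r, 'm) ring_scheme \<Rightarrow> ('r, 'v, 'n) module_scheme \<Rightarrow> ('r \<Rightarrow> 'r \<Rightarrow> 'v)
      \<Rightarrow> ('r', 'm') ring_scheme \<Rightarrow> ('r', 'v', 'n') module_scheme \<Rightarrow> ('r' \<Rightarrow> 'r' \<Rightarrow> 'v')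
      \<Rightarrow> ('r \<Rightarrow> 'r') \<Rightarrow> ('v \<Rightarrow> 'v') \<Rightarrow> bool"
  where "extends_biderivation R M D R' M' D' \<phi> \<psi> \<longleftrightarrow>
    \<phi> \<in> ring_hom R R' \<and> semilinear R M M' \<phi> \<psi> \<and>
    (\<forall>r \<in> carrier R. \<forall>s \<in> carrier R. \<psi> (D r s) = D' (\<phi> r) (\<phi> s))"

text \<open>The submodule \<open>I M\<close>: finite sums of elements \<open>i x\<close>.\<close>

definition ideal_smult :: "('r, 'v, 'n) module_scheme \<Rightarrow> 'r set \<Rightarrow> 'v set"
  where "ideal_smult M I = generate (add_monoid M) {i \<odot>\<^bsub>M\<^esub> x | i x. i \<in> I \<and> x \<in> carrier M}"

definition bidifferential_ideal_pair ::
    "('r, 'm) ring_scheme \<Rightarrow> ('r, 'v, 'n) module_scheme \<Rightarrow> ('r \<Rightarrow> 'r \<Rightarrow> 'v)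
      \<Rightarrow> 'r set \<Rightarrow> 'r set \<Rightarrow> bool"
  where "bidifferential_ideal_pair R M D I J \<longleftrightarrow>
    ideal I R \<and> ideal J R \<and>
    (\<forall>i \<in> I. \<forall>r \<in> carrier R. D i r \<in> ideal_smult M I) \<and>
    (\<forall>r \<in> carrier R. \<forall>j \<in> J. D r j \<in> ideal_smult M J)"

definition lifting_extension ::
    "('r, 'm) ring_scheme \<Rightarrow> ('r, 'v, 'n) module_scheme \<Rightarrow> ('r \<Rightarrow> 'r \<Rightarrow> 'v)
      \<Rightarrow> ('r', 'm') ring_scheme \<Rightarrow> ('r', 'v', 'n') module_scheme \<Rightarrow> ('r' \<Rightarrow> 'r' \<Rightarrow> 'v')
      \<Rightarrow> ('r \<Rightarrow> 'r') \<Rightarrow> ('v \<Rightarrow> 'v') \<Rightarrow> bool"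
  where "lifting_extension R M D R' M' D' \<phi> \<psi> \<longleftrightarrow>
    extends_biderivation R M D R' M' D' \<phi> \<psi> \<and>
    (\<forall>I J. bidifferential_ideal_pair R M D I J \<longrightarrow>
       bidifferential_ideal_pair R' M' D' (Idl\<^bsub>R'\<^esub> (\<phi> ` I)) (Idl\<^bsub>R'\<^esub> (\<phi> ` J)))"


section \<open>The rings and modules of the theorem\<close>

text \<open>\<open>A\<close> and \<open>C\<close> are subrings of \<open>B\<close> with \<open>A \<subseteq> C\<close>, and \<open>R\<close> is an \<open>A\<close>-algebra;
  \<open>loc_alg\<close> is a \<open>C\<close>-algebra, used as an \<open>A\<close>-algebra by restricting scalars.\<close>

abbreviation subring_of :: "('b, 'm) ring_scheme \<Rightarrow> 'b set \<Rightarrow> ('b, 'm) ring_scheme"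
  where "subring_of B A \<equiv> B\<lparr>carrier := A\<rparr>"

abbreviation loc_alg :: "('b, 'm) ring_scheme \<Rightarrow> 'b \<Rightarrow> ('b, ('b \<times> 'b) set) module"
  where "loc_alg C f \<equiv> along (to_loc C (powers C f)) (loc_at C f)"

text \<open>\<open>R \<otimes>\<^sub>A B\<close> as an \<open>R\<close>-module.\<close>

definition base_module ::
    "('b, 'm) ring_scheme \<Rightarrow> 'b set \<Rightarrow> ('b, 'r, 'n) module_scheme
      \<Rightarrow> ('r, (('r \<times> 'b) \<Rightarrow>\<^sub>0 int) set) module"
  where "base_module B A R =
    along (tensor_left (subring_of B A) R (along (\<lambda>x. x) B))
          (tensor (subring_of B A) R (along (\<lambda>x. x) B))"

text \<open>\<open>R \<otimes>\<^sub>A C\<^sub>f\<close> and the natural map \<open>R \<rightarrow> R \<otimes>\<^sub>A C\<^sub>f\<close>.\<close>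

definition ext_ring ::
    "('b, 'm) ring_scheme \<Rightarrow> 'b set \<Rightarrow> ('b, 'r, 'n) module_scheme \<Rightarrow> 'b set \<Rightarrow> 'b
      \<Rightarrow> (('r \<times> ('b \<times> 'b) set) \<Rightarrow>\<^sub>0 int) set ring"
  where "ext_ring B A R C f = tensor (subring_of B A) R (loc_alg (subring_of B C) f)"

definition ext_ring_map ::
    "('b, 'm) ring_scheme \<Rightarrow> 'b set \<Rightarrow> ('b, 'r, 'n) module_scheme \<Rightarrow> 'b set \<Rightarrow> 'b
      \<Rightarrow> 'r \<Rightarrow> (('r \<times> ('b \<times> 'b) set) \<Rightarrow>\<^sub>0 int) set"
  where "ext_ring_map B A R C f = tensor_left (subring_of B A) R (loc_alg (subring_of B C) f)"

text \<open>\<open>R \<otimes>\<^sub>A B\<^sub>f\<close> as an \<open>R \<otimes>\<^sub>A C\<^sub>f\<close>-module, and the natural map \<open>R \<otimes>\<^sub>A B \<rightarrow> R \<otimes>\<^sub>A B\<^sub>f\<close>.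
  The module does not mention \<open>C\<close>, as \<^const>\<open>loc_incl\<close> does not depend on its source.\<close>

definition ext_module ::
    "('b, 'm) ring_scheme \<Rightarrow> 'b set \<Rightarrow> ('b, 'r, 'n) module_scheme \<Rightarrow> 'b
      \<Rightarrow> ((('r \<times> ('b \<times> 'b) set) \<Rightarrow>\<^sub>0 int) set, (('r \<times> ('b \<times> 'b) set) \<Rightarrow>\<^sub>0 int) set) module"
  where "ext_module B A R f =
    along (tensor_map (subring_of B A) R (loc_alg B f) (loc_incl B (powers B f)))
          (tensor (subring_of B A) R (loc_alg B f))"

definition ext_module_map ::
    "('b, 'm) ring_scheme \<Rightarrow> 'b set \<Rightarrow> ('b, 'r, 'n) module_scheme \<Rightarrow> 'b
      \<Rightarrow> (('r \<times> 'b) \<Rightarrow>\<^sub>0 int) set \<Rightarrow> (('r \<times> ('b \<times> 'b) set) \<Rightarrow>\<^sub>0 int) set"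
  where "ext_module_map B A R f =
    tensor_map (subring_of B A) R (loc_alg B f) (to_loc B (powers B f))"

end

theory Submission
  imports Defs
begin

text \<open>Let \<open>p\<close> be the minimal polynomial of \<open>b\<close> with denominators cleared. Inverting its leading
  coefficient and \<open>p'(b)\<close>, that is, inverting their product \<open>f\<close>, makes \<open>A[b]\<^sub>f\<close> standard etale over \<open>A\<close>, hence
  \<open>R \<otimes>\<^sub>A A[b]\<^sub>f\<close> etale over \<open>R\<close>, and derivations extend uniquely along etale maps. A derivation along a
  homomorphism \<open>h\<close> into \<open>Q = R \<otimes>\<^sub>A B\<^sub>f\<close> is a lift of \<open>h\<close> to the dual numbers \<open>Q[\<epsilon>]\<close>; such a lift is
  extended to \<open>A[b]\<close> by one Newton step, which turns \<open>b\<close> into a root of the lifted polynomial.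
  Conversely, a derivation that maps \<open>R\<close> into a submodule \<open>N\<close> maps the whole extension into \<open>N\<close>.
  The case \<open>N = 0\<close> gives uniqueness, by which a biderivation can be extended in one variable after the
  other, and the case \<open>N = I M\<close> gives the lifting property.\<close>

section \<open>Localisation\<close>

text \<open>\<open>A\<close> need not be normal, so the minimal polynomial over the fraction field
  has no reason to have coefficients in \<open>A\<close>, and \<open>A[b]\<close> need not be
  \<open>A[X]\<close> modulo the cleared polynomial. What survives is pseudo-division: every
  polynomial relation of \<open>b\<close> over \<open>A\<close>, multiplied by a power of the
  leading coefficient of the cleared polynomial, is a multiple of that polynomial. A homomorphism on
  \<open>A\<close> that makes this coefficient invertible therefore extends to \<open>A[b]\<close>
  by each root of the transported polynomial. Tensoring with \<open>R\<close> gives no injectivity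
  to rely on, so everything passes through universal properties of \<open>A[b]\<close>,
  localisations and tensor products. The derivations need not be \<open>A\<close>-linear. The lifted
  polynomial then has coefficients with nonzero infinitesimal part, and the plain lift of
  \<open>b\<close> with infinitesimal part zero is in general not a root; this is what the Newton
  step repairs. All values lie in the ring \<open>Q\<close>, seen as a module along a homomorphism,
  so \<open>Q[\<epsilon>]\<close> is the only square-zero extension that occurs.\<close>

locale localised_cring = cring R for R (structure) +
  fixes S
  assumes S_submonoid: "submonoid S R"
begin

abbreviation "L \<equiv> localisation R S"

lemma S_closed [simp, intro]: "s \<in> S \<Longrightarrow> s \<in> carrier R"
  using submonoid.mem_carrier[OF S_submonoid] .

lemma S_mult [intro]: "s \<in> S \<Longrightarrow> t \<in> S \<Longrightarrow> s \<otimes> t \<in> S"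
  using submonoid.m_closed[OF S_submonoid] .

lemma S_one [simp, intro]: "\<one> \<in> S"
  using submonoid.one_closed[OF S_submonoid] .

lemma equiv_loc_rel: "equiv (carrier R \<times> S) (loc_rel R S)"
proof (rule equivI)
  show "loc_rel R S \<subseteq> (carrier R \<times> S) \<times> (carrier R \<times> S)"
    by (auto simp: loc_rel_def)
  show "refl_on (carrier R \<times> S) (loc_rel R S)"
    by (auto simp: refl_on_def loc_rel_def)
  show "sym (loc_rel R S)"
    by (rule symI) (clarsimp simp: loc_rel_def, metis)
  show "trans (loc_rel R S)"
  proof (rule transI, clarsimp simp: loc_rel_def)
    fix r s r' s' r'' s'' t u
    assume c: "r \<in> carrier R" "r' \<in> carrier R" "r'' \<in> carrier R" "s \<in> S" "s' \<in> S" "s'' \<in> S"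
      "t \<in> S" "u \<in> S"
      and t: "t \<otimes> (r \<otimes> s') = t \<otimes> (r' \<otimes> s)" and u: "u \<otimes> (r' \<otimes> s'') = u \<otimes> (r'' \<otimes> s')"
    \<comment> \<open>The middle denominator \<open>s'\<close> has to enter the multiplier, since
      nothing can be cancelled in a general ring: \<open>t\<close> trades \<open>r/s\<close> for
      \<open>r'/s'\<close>, and \<open>u\<close> trades \<open>r'/s'\<close> for
      \<open>r''/s''\<close>.\<close>
    have "(t \<otimes> u \<otimes> s') \<otimes> (r \<otimes> s'') = (u \<otimes> s'') \<otimes> (t \<otimes> (r \<otimes> s'))"
      using c by (simp add: m_ac)
    also have "\<dots> = (t \<otimes> s) \<otimes> (u \<otimes> (r' \<otimes> s''))"
      unfolding t using c by (simp add: m_ac)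
    also have "\<dots> = (t \<otimes> u \<otimes> s') \<otimes> (r'' \<otimes> s)"
      unfolding u using c by (simp add: m_ac)
    finally show "\<exists>v\<in>S. v \<otimes> (r \<otimes> s'') = v \<otimes> (r'' \<otimes> s)"
      using c by (intro bexI[of _ "t \<otimes> u \<otimes> s'"]) (simp_all add: S_mult)
  qed
qed

lemma frac_eq_iff:
  assumes "r \<in> carrier R" "s \<in> S" "r' \<in> carrier R" "s' \<in> S"
  shows "frac R S r s = frac R S r' s' \<longleftrightarrow> (\<exists>t\<in>S. t \<otimes> (r \<otimes> s') = t \<otimes> (r' \<otimes> s))"
  unfolding frac_def using assms
  by (subst eq_equiv_class_iff[OF equiv_loc_rel]) (auto simp: loc_rel_def)

lemma frac_eqI:
  assumes "r \<in> carrier R" "s \<in> S" "r' \<in> carrier R" "s' \<in> S" "r \<otimes> s' = r' \<otimes> s"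
  shows "frac R S r s = frac R S r' s'"
  using assms by (subst frac_eq_iff) auto

lemma mem_frac_iff:
  assumes "r \<in> carrier R" "s \<in> S"
  shows "(r', s') \<in> frac R S r s \<longleftrightarrow> r' \<in> carrier R \<and> s' \<in> S \<and> frac R S r' s' = frac R S r s"
proof
  assume *: "r' \<in> carrier R \<and> s' \<in> S \<and> frac R S r' s' = frac R S r s"
  then show "(r', s') \<in> frac R S r s"
    using equiv_class_self[OF equiv_loc_rel, of "(r', s')"] unfolding frac_def by auto
next
  assume "(r', s') \<in> frac R S r s"
  then have "((r, s), (r', s')) \<in> loc_rel R S"
    by (simp add: frac_def)
  then show "r' \<in> carrier R \<and> s' \<in> S \<and> frac R S r' s' = frac R S r s"
    unfolding frac_def using equiv_class_eq[OF equiv_loc_rel, of "(r, s)" "(r', s')"]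
    by (auto simp: loc_rel_def)
qed

text \<open>Products, sums and comparison maps of fractions are defined as unions over all
  representatives. Once the terms agree, the union over the nonempty class is any one of them, so
  that only well-definedness remains to be checked.\<close>

lemma UN_frac:
  assumes "r \<in> carrier R" "s \<in> S"
    and "\<And>r' s'. r' \<in> carrier R \<Longrightarrow> s' \<in> S \<Longrightarrow> frac R S r' s' = frac R S r s \<Longrightarrow> g r' s' = g r s"
  shows "(\<Union>(r', s') \<in> frac R S r s. g r' s') = g r s"
proof -
  have "frac R S r s \<noteq> {}"
    using assms(1,2) mem_frac_iff[of r s r s] by auto
  moreover have "(case p of (r', s') \<Rightarrow> g r' s') = g r s" if "p \<in> frac R S r s" for p
  proof (cases p)
    case (Pair r' s')
    with that have "r' \<in> carrier R" "s' \<in> S" "frac R S r' s' = frac R S r s"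
      using mem_frac_iff[OF assms(1,2)] by blast+
    from assms(3)[OF this] Pair show ?thesis by (simp only: split)
  qed
  ultimately show ?thesis by (rule SUP_eq_const)
qed

lemma carrier_loc: "carrier L = {frac R S r s | r s. r \<in> carrier R \<and> s \<in> S}"
  unfolding localisation_def frac_def quotient_def by auto

lemma frac_closed: "r \<in> carrier R \<Longrightarrow> s \<in> S \<Longrightarrow> frac R S r s \<in> carrier L"
  unfolding carrier_loc by auto

lemma locE:
  assumes "x \<in> carrier L"
  obtains r s where "r \<in> carrier R" "s \<in> S" "x = frac R S r s"
  using assms unfolding carrier_loc by auto

lemma frac_mult:
  assumes "r \<in> carrier R" "s \<in> S" "r' \<in> carrier R" "s' \<in> S"
  shows "frac R S r s \<otimes>\<^bsub>L\<^esub> frac R S r' s' = frac R S (r \<otimes> r') (s \<otimes> s')"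
proof -
  \<comment> \<open>Independence of both representatives at once, with the product of the two
    multipliers as witness. The nested unions then collapse from the inside out.\<close>
  have *: "frac R S (p \<otimes> p') (q \<otimes> q') = frac R S (r \<otimes> r') (s \<otimes> s')"
    if p: "p \<in> carrier R" "q \<in> S" "frac R S p q = frac R S r s"
      and p': "p' \<in> carrier R" "q' \<in> S" "frac R S p' q' = frac R S r' s'" for p q p' q'
  proof -
    obtain t where t: "t \<in> S" "t \<otimes> (p \<otimes> s) = t \<otimes> (r \<otimes> q)"
      using p(3) frac_eq_iff[OF p(1,2) assms(1,2)] by blast
    obtain t' where t': "t' \<in> S" "t' \<otimes> (p' \<otimes> s') = t' \<otimes> (r' \<otimes> q')"
      using p'(3) frac_eq_iff[OF p'(1,2) assms(3,4)] by blast
    have "(t \<otimes> t') \<otimes> ((p \<otimes> p') \<otimes> (s \<otimes> s')) = (t \<otimes> (p \<otimes> s)) \<otimes> (t' \<otimes> (p' \<otimes> s'))"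
      using p p' assms t(1) t'(1) by (simp add: m_ac)
    also have "\<dots> = (t \<otimes> t') \<otimes> ((r \<otimes> r') \<otimes> (q \<otimes> q'))"
      unfolding t(2) t'(2) using p p' assms t(1) t'(1) by (simp add: m_ac)
    finally show ?thesis
      by (subst frac_eq_iff) (use p p' assms t(1) t'(1) in \<open>auto intro!: bexI[of _ "t \<otimes> t'"]\<close>)
  qed
  have inner: "(\<Union>(p', q') \<in> frac R S r' s'. frac R S (p \<otimes> p') (q \<otimes> q')) = frac R S (p \<otimes> r') (q \<otimes> s')"
    if "p \<in> carrier R" "q \<in> S" "frac R S p q = frac R S r s" for p q
  proof (rule UN_frac[OF assms(3,4)])
    fix p' q' assume p': "p' \<in> carrier R" "q' \<in> S" "frac R S p' q' = frac R S r' s'"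
    show "frac R S (p \<otimes> p') (q \<otimes> q') = frac R S (p \<otimes> r') (q \<otimes> s')"
      unfolding *[OF that p'] using *[OF that assms(3,4) refl] by simp
  qed
  have "(\<Union>(p, q) \<in> frac R S r s. \<Union>(p', q') \<in> frac R S r' s'. frac R S (p \<otimes> p') (q \<otimes> q')) =
      (\<Union>(p', q') \<in> frac R S r' s'. frac R S (r \<otimes> p') (s \<otimes> q'))"
  proof (rule UN_frac[OF assms(1,2)])
    fix p q assume p: "p \<in> carrier R" "q \<in> S" "frac R S p q = frac R S r s"
    show "(\<Union>(p', q') \<in> frac R S r' s'. frac R S (p \<otimes> p') (q \<otimes> q')) = (\<Union>(p', q') \<in> frac R S r' s'. frac R S (r \<otimes> p') (s \<otimes> q'))"
      unfolding inner[OF p] inner[OF assms(1,2) refl] using *[OF p assms(3,4) refl] .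
  qed
  then show ?thesis
    unfolding localisation_def monoid.simps inner[OF assms(1,2) refl] .
qed

lemma frac_add:
  assumes "r \<in> carrier R" "s \<in> S" "r' \<in> carrier R" "s' \<in> S"
  shows "frac R S r s \<oplus>\<^bsub>L\<^esub> frac R S r' s' = frac R S (r \<otimes> s' \<oplus> r' \<otimes> s) (s \<otimes> s')"
proof -
  have *: "frac R S (p \<otimes> q' \<oplus> p' \<otimes> q) (q \<otimes> q') = frac R S (r \<otimes> s' \<oplus> r' \<otimes> s) (s \<otimes> s')"
    if p: "p \<in> carrier R" "q \<in> S" "frac R S p q = frac R S r s"
      and p': "p' \<in> carrier R" "q' \<in> S" "frac R S p' q' = frac R S r' s'" for p q p' q'
  proof -
    obtain t where t: "t \<in> S" "t \<otimes> (p \<otimes> s) = t \<otimes> (r \<otimes> q)"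
      using p(3) frac_eq_iff[OF p(1,2) assms(1,2)] by blast
    obtain t' where t': "t' \<in> S" "t' \<otimes> (p' \<otimes> s') = t' \<otimes> (r' \<otimes> q')"
      using p'(3) frac_eq_iff[OF p'(1,2) assms(3,4)] by blast
    have "(t \<otimes> t') \<otimes> ((p \<otimes> q' \<oplus> p' \<otimes> q) \<otimes> (s \<otimes> s'))
      = (t \<otimes> (p \<otimes> s)) \<otimes> (t' \<otimes> s' \<otimes> q') \<oplus> (t' \<otimes> (p' \<otimes> s')) \<otimes> (t \<otimes> s \<otimes> q)"
      using p p' assms t(1) t'(1) by (simp add: m_ac l_distr r_distr)
    also have "\<dots> = (t \<otimes> t') \<otimes> ((r \<otimes> s' \<oplus> r' \<otimes> s) \<otimes> (q \<otimes> q'))"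
      unfolding t(2) t'(2) using p p' assms t(1) t'(1) by (simp add: m_ac l_distr r_distr)
    finally show ?thesis
      by (subst frac_eq_iff) (use p p' assms t(1) t'(1) in \<open>auto intro!: bexI[of _ "t \<otimes> t'"]\<close>)
  qed
  have inner: "(\<Union>(p', q') \<in> frac R S r' s'. frac R S (p \<otimes> q' \<oplus> p' \<otimes> q) (q \<otimes> q'))
      = frac R S (p \<otimes> s' \<oplus> r' \<otimes> q) (q \<otimes> s')"
    if "p \<in> carrier R" "q \<in> S" "frac R S p q = frac R S r s" for p q
  proof (rule UN_frac[OF assms(3,4)])
    fix p' q' assume p': "p' \<in> carrier R" "q' \<in> S" "frac R S p' q' = frac R S r' s'"
    show "frac R S (p \<otimes> q' \<oplus> p' \<otimes> q) (q \<otimes> q') = frac R S (p \<otimes> s' \<oplus> r' \<otimes> q) (q \<otimes> s')"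
      unfolding *[OF that p'] using *[OF that assms(3,4) refl] by simp
  qed
  have "(\<Union>(p, q) \<in> frac R S r s. \<Union>(p', q') \<in> frac R S r' s'. frac R S (p \<otimes> q' \<oplus> p' \<otimes> q) (q \<otimes> q')) =
      (\<Union>(p', q') \<in> frac R S r' s'. frac R S (r \<otimes> q' \<oplus> p' \<otimes> s) (s \<otimes> q'))"
  proof (rule UN_frac[OF assms(1,2)])
    fix p q assume p: "p \<in> carrier R" "q \<in> S" "frac R S p q = frac R S r s"
    show "(\<Union>(p', q') \<in> frac R S r' s'. frac R S (p \<otimes> q' \<oplus> p' \<otimes> q) (q \<otimes> q')) = (\<Union>(p', q') \<in> frac R S r' s'. frac R S (r \<otimes> q' \<oplus> p' \<otimes> s) (s \<otimes> q'))"
      unfolding inner[OF p] inner[OF assms(1,2) refl] using *[OF p assms(3,4) refl] .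
  qed
  then show ?thesis
    unfolding localisation_def ring.simps inner[OF assms(1,2) refl] .
qed

lemma loc_one: "\<one>\<^bsub>L\<^esub> = frac R S \<one> \<one>" and loc_zero: "\<zero>\<^bsub>L\<^esub> = frac R S \<zero> \<one>"
  by (simp_all add: localisation_def)

lemma loc_add_closed: "x \<in> carrier L \<Longrightarrow> y \<in> carrier L \<Longrightarrow> x \<oplus>\<^bsub>L\<^esub> y \<in> carrier L"
  by (elim locE) (simp add: S_mult frac_add frac_closed)

lemma loc_mult_closed: "x \<in> carrier L \<Longrightarrow> y \<in> carrier L \<Longrightarrow> x \<otimes>\<^bsub>L\<^esub> y \<in> carrier L"
  by (elim locE) (simp add: S_mult frac_mult frac_closed)

lemma abelian_group_loc: "abelian_group L"
proof (rule abelian_groupI)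
  fix x y z assume xyz: "x \<in> carrier L" "y \<in> carrier L" "z \<in> carrier L"
  then obtain r s r' s' r'' s'' where *: "r \<in> carrier R" "s \<in> S" "x = frac R S r s"
      "r' \<in> carrier R" "s' \<in> S" "y = frac R S r' s'"
      "r'' \<in> carrier R" "s'' \<in> S" "z = frac R S r'' s''"
    by (elim locE) blast
  show "x \<oplus>\<^bsub>L\<^esub> y \<in> carrier L"
    using xyz(1,2) by (rule loc_add_closed)
  show "x \<oplus>\<^bsub>L\<^esub> y = y \<oplus>\<^bsub>L\<^esub> x"
    using * by (simp add: S_mult frac_add m_comm a_comm)
  show "\<zero>\<^bsub>L\<^esub> \<oplus>\<^bsub>L\<^esub> x = x"
    using * by (simp add: S_mult frac_add loc_zero)
  have "(r \<otimes> s' \<oplus> r' \<otimes> s) \<otimes> s'' \<oplus> r'' \<otimes> (s \<otimes> s') = r \<otimes> (s' \<otimes> s'') \<oplus> (r' \<otimes> s'' \<oplus> r'' \<otimes> s') \<otimes> s"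
    using * by (simp add: l_distr r_distr m_ac a_ac)
  then show "x \<oplus>\<^bsub>L\<^esub> y \<oplus>\<^bsub>L\<^esub> z = x \<oplus>\<^bsub>L\<^esub> (y \<oplus>\<^bsub>L\<^esub> z)"
    using * by (simp add: S_mult frac_add m_assoc)
  have "frac R S (\<ominus> r) s \<oplus>\<^bsub>L\<^esub> x = \<zero>\<^bsub>L\<^esub>"
    unfolding *(3) loc_zero using *(1,2)
    by (subst frac_add) (simp_all add: l_minus l_neg, rule frac_eqI, simp_all add: S_mult)
  then show "\<exists>y\<in>carrier L. y \<oplus>\<^bsub>L\<^esub> x = \<zero>\<^bsub>L\<^esub>"
    by (rule bexI) (use * in \<open>simp add: frac_closed\<close>)
qed (simp add: loc_zero frac_closed)

lemma comm_monoid_loc: "comm_monoid L"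
proof (rule comm_monoidI)
  fix x y z assume xyz: "x \<in> carrier L" "y \<in> carrier L" "z \<in> carrier L"
  then obtain r s r' s' r'' s'' where *: "r \<in> carrier R" "s \<in> S" "x = frac R S r s"
      "r' \<in> carrier R" "s' \<in> S" "y = frac R S r' s'"
      "r'' \<in> carrier R" "s'' \<in> S" "z = frac R S r'' s''"
    by (elim locE) blast
  show "x \<otimes>\<^bsub>L\<^esub> y \<in> carrier L"
    using xyz(1,2) by (rule loc_mult_closed)
  show "x \<otimes>\<^bsub>L\<^esub> y \<otimes>\<^bsub>L\<^esub> z = x \<otimes>\<^bsub>L\<^esub> (y \<otimes>\<^bsub>L\<^esub> z)" "x \<otimes>\<^bsub>L\<^esub> y = y \<otimes>\<^bsub>L\<^esub> x" "\<one>\<^bsub>L\<^esub> \<otimes>\<^bsub>L\<^esub> x = x"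
    using * by (simp_all add: S_mult frac_mult loc_one m_ac)
qed (simp add: loc_one frac_closed)

lemma cring_loc: "cring L"
proof (rule cringI[OF abelian_group_loc comm_monoid_loc])
  fix x y z assume xyz: "x \<in> carrier L" "y \<in> carrier L" "z \<in> carrier L"
  then obtain r s r' s' r'' s'' where *: "r \<in> carrier R" "s \<in> S" "x = frac R S r s"
      "r' \<in> carrier R" "s' \<in> S" "y = frac R S r' s'"
      "r'' \<in> carrier R" "s'' \<in> S" "z = frac R S r'' s''"
    by (elim locE) blast
  then have eq: "(x \<oplus>\<^bsub>L\<^esub> y) \<otimes>\<^bsub>L\<^esub> z = frac R S ((r \<otimes> s' \<oplus> r' \<otimes> s) \<otimes> r'') (s \<otimes> s' \<otimes> s'')"
    "x \<otimes>\<^bsub>L\<^esub> z \<oplus>\<^bsub>L\<^esub> y \<otimes>\<^bsub>L\<^esub> z = frac R S (r \<otimes> r'' \<otimes> (s' \<otimes> s'') \<oplus> r' \<otimes> r'' \<otimes> (s \<otimes> s'')) (s \<otimes> s'' \<otimes> (s' \<otimes> s''))"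
    by (simp_all add: S_mult frac_mult frac_add)
  show "(x \<oplus>\<^bsub>L\<^esub> y) \<otimes>\<^bsub>L\<^esub> z = x \<otimes>\<^bsub>L\<^esub> z \<oplus>\<^bsub>L\<^esub> y \<otimes>\<^bsub>L\<^esub> z"
  proof -
    \<comment> \<open>The right-hand side is the left-hand one expanded by \<open>s''\<close>: its
      numerator is \<open>n\<close> times \<open>r'' s''\<close>, and its denominator has one more
      factor \<open>s''\<close>.\<close>
    define n where "n = r \<otimes> s' \<oplus> r' \<otimes> s"
    have n: "n \<in> carrier R" using * by (simp add: n_def)
    have "r \<otimes> r'' \<otimes> (s' \<otimes> s'') \<oplus> r' \<otimes> r'' \<otimes> (s \<otimes> s'') = n \<otimes> (r'' \<otimes> s'')"
      unfolding n_def using * by (simp add: l_distr r_distr m_ac)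
    then have num: "r \<otimes> r'' \<otimes> (s' \<otimes> s'') \<oplus> r' \<otimes> r'' \<otimes> (s \<otimes> s'') = n \<otimes> (r'' \<otimes> s'')" .
    have "n \<otimes> r'' \<otimes> (s \<otimes> s'' \<otimes> (s' \<otimes> s'')) = n \<otimes> (r'' \<otimes> s'') \<otimes> (s \<otimes> s' \<otimes> s'')"
      using n *(7) *(2,5,8)[THEN S_closed] by (simp add: m_ac del: S_closed)
    then show ?thesis
      unfolding eq n_def[symmetric] num
      using n * by (intro frac_eqI m_closed S_mult) (assumption | rule S_closed)+
  qed
qed

lemma to_loc_hom: "to_loc R S \<in> ring_hom R L"
  unfolding to_loc_def by (rule ring_hom_memI) (simp_all add: S_mult frac_closed frac_mult frac_add loc_one)

lemma inverse_frac:
  assumes "s \<in> S"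
  shows "frac R S \<one> s \<otimes>\<^bsub>L\<^esub> to_loc R S s = \<one>\<^bsub>L\<^esub>"
proof -
  have "frac R S \<one> s \<otimes>\<^bsub>L\<^esub> to_loc R S s = frac R S s s"
    unfolding to_loc_def using assms by (simp add: S_mult frac_mult)
  also have "\<dots> = \<one>\<^bsub>L\<^esub>"
    unfolding loc_one by (rule frac_eqI) (use assms in simp_all)
  finally show ?thesis .
qed

lemma to_loc_Units:
  assumes "s \<in> S"
  shows "to_loc R S s \<in> Units L"
proof -
  have c: "frac R S \<one> s \<in> carrier L" "to_loc R S s \<in> carrier L"
    using assms by (simp_all add: to_loc_def frac_closed)
  have "to_loc R S s \<otimes>\<^bsub>L\<^esub> frac R S \<one> s = \<one>\<^bsub>L\<^esub>"
    unfolding comm_monoid.m_comm[OF comm_monoid_loc c(2,1)] by (rule inverse_frac[OF assms])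
  with c inverse_frac[OF assms] show ?thesis
    unfolding Units_def by blast
qed

text \<open>The value at \<open>r/s\<close> is the only \<open>x\<close> with
  \<open>x h(s) = h(r)\<close>. Hence every law can be checked after multiplication by the images of
  the denominators, which \<open>cancel\<close> removes again.\<close>

lemma localisation_universal:
  assumes "cring T" and h: "h \<in> ring_hom R T" and u: "\<And>s. s \<in> S \<Longrightarrow> h s \<in> Units T"
  obtains g where "g \<in> ring_hom L T" "\<And>r. r \<in> carrier R \<Longrightarrow> g (to_loc R S r) = h r"
proof -
  interpret T: cring T by fact
  have hc: "h x \<in> carrier T" if "x \<in> carrier R" for x
    using ring_hom_closed[OF h that] .
  have hS: "h s \<in> carrier T" if "s \<in> S" for s
    using hc that by blast
  have cancel: "x = y" if "x \<otimes>\<^bsub>T\<^esub> h s = y \<otimes>\<^bsub>T\<^esub> h s" "s \<in> S" "x \<in> carrier T" "y \<in> carrier T" for x y s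
  proof -
    have "h s \<otimes>\<^bsub>T\<^esub> x = h s \<otimes>\<^bsub>T\<^esub> y"
      using that(1) unfolding T.m_comm[OF hS[OF that(2)] that(3)] T.m_comm[OF hS[OF that(2)] that(4)] .
    then show ?thesis
      using T.Units_l_cancel[OF u[OF that(2)] that(3,4)] by blast
  qed
  define val where "val r s = h r \<otimes>\<^bsub>T\<^esub> inv\<^bsub>T\<^esub> h s" for r s
  have val: "val r s \<in> carrier T" "val r s \<otimes>\<^bsub>T\<^esub> h s = h r" if "r \<in> carrier R" "s \<in> S" for r s
  proof -
    note i = T.Units_inv_closed[OF u[OF that(2)]] T.Units_l_inv[OF u[OF that(2)]]
    show "val r s \<in> carrier T" "val r s \<otimes>\<^bsub>T\<^esub> h s = h r"
      unfolding val_def using hc[OF that(1)] hS[OF that(2)] i by (simp_all add: T.m_assoc)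
  qed
  have val_eq: "val r s = val r' s'"
    if rs: "r \<in> carrier R" "s \<in> S" "r' \<in> carrier R" "s' \<in> S" and eq: "frac R S r s = frac R S r' s'"
    for r s r' s'
  proof -
    obtain t where t: "t \<in> S" "t \<otimes> (r \<otimes> s') = t \<otimes> (r' \<otimes> s)"
      using eq frac_eq_iff[OF rs] by blast
    note c = hc[OF rs(1)] hc[OF rs(3)] hS[OF rs(2)] hS[OF rs(4)] hS[OF t(1)]
    have hm: "h (a \<otimes> (c \<otimes> d)) = h a \<otimes>\<^bsub>T\<^esub> (h c \<otimes>\<^bsub>T\<^esub> h d)"
      if "a \<in> carrier R" "c \<in> carrier R" "d \<in> carrier R" for a c d
      using ring_hom_mult[OF h] that by simp
    have "h t \<otimes>\<^bsub>T\<^esub> (h r \<otimes>\<^bsub>T\<^esub> h s') = h t \<otimes>\<^bsub>T\<^esub> (h r' \<otimes>\<^bsub>T\<^esub> h s)"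
      using arg_cong[OF t(2), of h] hm rs t(1) by simp
    then have *: "h r \<otimes>\<^bsub>T\<^esub> h s' = h r' \<otimes>\<^bsub>T\<^esub> h s"
      using c by (simp add: T.Units_l_cancel[OF u[OF t(1)]])
    note v = val(1)[OF rs(1,2)] val(1)[OF rs(3,4)]
    have "val r s \<otimes>\<^bsub>T\<^esub> h s' \<otimes>\<^bsub>T\<^esub> h s = (val r s \<otimes>\<^bsub>T\<^esub> h s) \<otimes>\<^bsub>T\<^esub> h s'"
      using c v by (simp only: T.m_ac)
    also have "\<dots> = (val r' s' \<otimes>\<^bsub>T\<^esub> h s') \<otimes>\<^bsub>T\<^esub> h s"
      unfolding val(2)[OF rs(1,2)] val(2)[OF rs(3,4)] by (rule *)
    finally have "val r s \<otimes>\<^bsub>T\<^esub> h s' = val r' s' \<otimes>\<^bsub>T\<^esub> h s'"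
      by (rule cancel) (use c v rs in simp_all)
    then show ?thesis
      by (rule cancel) (use v rs in simp_all)
  qed
  \<comment> \<open>Fractions are sets, so the value is read off from some representative;
    \<open>val_eq\<close> makes the choice harmless.\<close>
  define g where "g Z = (SOME y. \<exists>r\<in>carrier R. \<exists>s\<in>S. Z = frac R S r s \<and> y = val r s)" for Z
  have g: "g (frac R S r s) = val r s" if rs: "r \<in> carrier R" "s \<in> S" for r s
  proof -
    have "\<exists>r'\<in>carrier R. \<exists>s'\<in>S. frac R S r s = frac R S r' s' \<and> g (frac R S r s) = val r' s'"
      unfolding g_def by (rule someI_ex) (use rs in blast)
    then obtain r' s' where rs': "r' \<in> carrier R" "s' \<in> S"
      and "frac R S r s = frac R S r' s'" "g (frac R S r s) = val r' s'" by blast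
    then show ?thesis
      using val_eq[OF rs rs'] by simp
  qed
  have "g \<in> ring_hom L T"
  proof (rule ring_hom_memI)
    fix x y assume "x \<in> carrier L" "y \<in> carrier L"
    then obtain r s r' s' where rs: "r \<in> carrier R" "s \<in> S" and x: "x = frac R S r s"
      and rs': "r' \<in> carrier R" "s' \<in> S" and y: "y = frac R S r' s'"
      by (elim locE) blast
    note v = val(1)[OF rs] val(1)[OF rs']
    note c = hc[OF rs(1)] hc[OF rs'(1)] hS[OF rs(2)] hS[OF rs'(2)]
    note S = S_closed[OF rs(2)] S_closed[OF rs'(2)]
    have ss: "s \<otimes> s' \<in> S" "h (s \<otimes> s') = h s \<otimes>\<^bsub>T\<^esub> h s'"
      using rs(2) rs'(2) ring_hom_mult[OF h S] by (simp_all add: S_mult)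
    show "g x \<in> carrier T"
      unfolding x g[OF rs] by (rule v)
    have r: "r \<otimes> r' \<in> carrier R" "r \<otimes> s' \<oplus> r' \<otimes> s \<in> carrier R"
      using rs(1) rs'(1) S by simp_all
    have "val (r \<otimes> r') (s \<otimes> s') \<otimes>\<^bsub>T\<^esub> h (s \<otimes> s') = (val r s \<otimes>\<^bsub>T\<^esub> h s) \<otimes>\<^bsub>T\<^esub> (val r' s' \<otimes>\<^bsub>T\<^esub> h s')"
      unfolding val(2)[OF rs] val(2)[OF rs'] val(2)[OF r(1) ss(1)] using ring_hom_mult[OF h rs(1) rs'(1)] .
    also have "\<dots> = val r s \<otimes>\<^bsub>T\<^esub> val r' s' \<otimes>\<^bsub>T\<^esub> h (s \<otimes> s')"
      unfolding ss(2) using v c by (simp add: T.m_ac)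
    finally show "g (x \<otimes>\<^bsub>L\<^esub> y) = g x \<otimes>\<^bsub>T\<^esub> g y"
      unfolding x y g[OF rs] g[OF rs'] frac_mult[OF rs rs'] g[OF r(1) ss(1)]
      by (rule cancel[OF _ ss(1) val(1)[OF r(1) ss(1)]]) (use v in simp)
    have "val (r \<otimes> s' \<oplus> r' \<otimes> s) (s \<otimes> s') \<otimes>\<^bsub>T\<^esub> h (s \<otimes> s')
      = (val r s \<otimes>\<^bsub>T\<^esub> h s) \<otimes>\<^bsub>T\<^esub> h s' \<oplus>\<^bsub>T\<^esub> (val r' s' \<otimes>\<^bsub>T\<^esub> h s') \<otimes>\<^bsub>T\<^esub> h s"
      unfolding val(2)[OF rs] val(2)[OF rs'] val(2)[OF r(2) ss(1)]
      using ring_hom_mult[OF h] ring_hom_add[OF h] rs(1) rs'(1) S by simp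
    also have "\<dots> = (val r s \<oplus>\<^bsub>T\<^esub> val r' s') \<otimes>\<^bsub>T\<^esub> h (s \<otimes> s')"
      unfolding ss(2) using v c by (simp add: T.m_ac T.l_distr T.r_distr)
    finally show "g (x \<oplus>\<^bsub>L\<^esub> y) = g x \<oplus>\<^bsub>T\<^esub> g y"
      unfolding x y g[OF rs] g[OF rs'] frac_add[OF rs rs'] g[OF r(2) ss(1)]
      by (rule cancel[OF _ ss(1) val(1)[OF r(2) ss(1)]]) (use v in simp)
  next
    have "val \<one> \<one> \<otimes>\<^bsub>T\<^esub> h \<one> = h \<one>"
      by (rule val(2)) simp_all
    then show "g \<one>\<^bsub>L\<^esub> = \<one>\<^bsub>T\<^esub>"
      unfolding loc_one g[OF one_closed S_one] using val(1)[OF one_closed S_one] ring_hom_one[OF h] by simp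
  qed
  moreover have "g (to_loc R S r) = h r" if r: "r \<in> carrier R" for r
    unfolding to_loc_def g[OF r S_one] using val[OF r S_one] ring_hom_one[OF h] by simp
  ultimately show thesis by (rule that)
qed

text \<open>A fraction is \<open>r/1\<close> times \<open>1/s\<close>, and \<open>1/s\<close> is
  inverse to \<open>s/1\<close>. The last hypothesis speaks of any \<open>y\<close> with
  \<open>y x = 1\<close>, the form in which the Leibniz rule and homomorphisms can be applied
  directly.\<close>

lemma loc_generated:
  assumes "x \<in> carrier L" and "\<And>r. r \<in> carrier R \<Longrightarrow> P (to_loc R S r)"
    and "\<And>x y. x \<in> carrier L \<Longrightarrow> y \<in> carrier L \<Longrightarrow> P x \<Longrightarrow> P y \<Longrightarrow> P (x \<otimes>\<^bsub>L\<^esub> y)"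
    and "\<And>x y. x \<in> carrier L \<Longrightarrow> y \<in> carrier L \<Longrightarrow> y \<otimes>\<^bsub>L\<^esub> x = \<one>\<^bsub>L\<^esub> \<Longrightarrow> P x \<Longrightarrow> P y"
  shows "P x"
proof -
  obtain r s where rs: "r \<in> carrier R" "s \<in> S" "x = frac R S r s"
    using assms(1) by (rule locE)
  have cl: "to_loc R S a \<in> carrier L" if "a \<in> carrier R" for a
    using that by (simp add: to_loc_def frac_closed)
  have "P (frac R S \<one> s)"
    using rs by (intro assms(4)[OF _ _ inverse_frac assms(2)] cl) (simp_all add: frac_closed)
  then have "P (to_loc R S r \<otimes>\<^bsub>L\<^esub> frac R S \<one> s)"
    using rs by (intro assms(3)[OF _ _ assms(2)] cl) (simp_all add: frac_closed)
  then show ?thesis using rs by (simp add: to_loc_def frac_mult)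
qed

end

section \<open>Tensor products\<close>

lemma along_simps [simp]:
  "carrier (along h S) = carrier S" "x \<otimes>\<^bsub>along h S\<^esub> y = x \<otimes>\<^bsub>S\<^esub> y" "\<one>\<^bsub>along h S\<^esub> = \<one>\<^bsub>S\<^esub>"
  "\<zero>\<^bsub>along h S\<^esub> = \<zero>\<^bsub>S\<^esub>" "x \<oplus>\<^bsub>along h S\<^esub> y = x \<oplus>\<^bsub>S\<^esub> y" "a \<odot>\<^bsub>along h S\<^esub> x = h a \<otimes>\<^bsub>S\<^esub> x"
  by (simp_all add: along_def)

lemma ring_hom_along [simp]: "ring_hom (along h S) T = ring_hom S T" "ring_hom T (along h S) = ring_hom T S"
  by (simp_all add: ring_hom_def)

lemma cring_along:
  assumes "cring S" shows "cring (along h S)"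
proof -
  interpret cring S by fact
  show ?thesis
  proof (rule cringI)
    show "abelian_group (along h S)"
    proof (rule abelian_groupI)
      fix x assume "x \<in> carrier (along h S)"
      then show "\<exists>y\<in>carrier (along h S). y \<oplus>\<^bsub>along h S\<^esub> x = \<zero>\<^bsub>along h S\<^esub>"
        by (intro bexI[of _ "\<ominus>\<^bsub>S\<^esub> x"]) (simp_all add: l_neg)
    qed (simp_all add: a_ac)
    show "comm_monoid (along h S)"
      by (rule comm_monoidI) (simp_all add: m_ac)
  qed (simp add: l_distr)
qed

lemma algebra_along:
  assumes "cring A" "cring S" "h \<in> ring_hom A S"
  shows "algebra A (along h S)"
proof -
  interpret S: cring S by fact
  show ?thesis
    by (rule algebraI[OF assms(1) cring_along[OF assms(2)]])
      (simp_all add: ring_hom_closed[OF assms(3)] ring_hom_add[OF assms(3)] ring_hom_mult[OF assms(3)]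
         ring_hom_one[OF assms(3)] S.l_distr S.r_distr S.m_assoc)
qed

section \<open>Integral monoid rings and their quotients\<close>

lemma frag_extend_diff_fun: "frag_extend (\<lambda>x. f x - g x) c = frag_extend f c - frag_extend g c"
  by (induction c rule: frag_induction[OF subset_UNIV]) (simp_all add: frag_extend_diff)

lemma frag_extend_zero_fun: "frag_extend (\<lambda>x. 0) c = 0"
  by (simp add: frag_extend_eq_0)

lemma int_monoid_ring_simps [simp]:
  "c \<in> carrier (int_monoid_ring G) \<longleftrightarrow> Poly_Mapping.keys c \<subseteq> carrier G"
  "\<one>\<^bsub>int_monoid_ring G\<^esub> = frag_of \<one>\<^bsub>G\<^esub>" "\<zero>\<^bsub>int_monoid_ring G\<^esub> = 0"
  "c \<oplus>\<^bsub>int_monoid_ring G\<^esub> d = c + d"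
  by (simp_all add: int_monoid_ring_def)

lemma int_monoid_ring_mult:
  "c \<otimes>\<^bsub>int_monoid_ring G\<^esub> d = frag_extend (\<lambda>x. frag_extend (\<lambda>y. frag_of (x \<otimes>\<^bsub>G\<^esub> y)) d) c"
  by (simp add: int_monoid_ring_def)

lemma int_monoid_ring_mult_of [simp]:
  "frag_of x \<otimes>\<^bsub>int_monoid_ring G\<^esub> frag_of y = frag_of (x \<otimes>\<^bsub>G\<^esub> y)"
  by (simp add: int_monoid_ring_mult)

lemma int_monoid_ring_bilinear:
  "(c + c') \<otimes>\<^bsub>int_monoid_ring G\<^esub> d = c \<otimes>\<^bsub>int_monoid_ring G\<^esub> d + c' \<otimes>\<^bsub>int_monoid_ring G\<^esub> d"
  "(c - c') \<otimes>\<^bsub>int_monoid_ring G\<^esub> d = c \<otimes>\<^bsub>int_monoid_ring G\<^esub> d - c' \<otimes>\<^bsub>int_monoid_ring G\<^esub> d"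
  "d \<otimes>\<^bsub>int_monoid_ring G\<^esub> (c - c') = d \<otimes>\<^bsub>int_monoid_ring G\<^esub> c - d \<otimes>\<^bsub>int_monoid_ring G\<^esub> c'"
  "0 \<otimes>\<^bsub>int_monoid_ring G\<^esub> d = 0" "d \<otimes>\<^bsub>int_monoid_ring G\<^esub> 0 = 0"
  by (simp_all add: int_monoid_ring_mult frag_extend_add frag_extend_diff frag_extend_diff_fun frag_extend_zero_fun)

lemma keys_diff_subset: "Poly_Mapping.keys c \<subseteq> S \<Longrightarrow> Poly_Mapping.keys d \<subseteq> S \<Longrightarrow> Poly_Mapping.keys (c - d) \<subseteq> S"
  using keys_diff[of c d] by blast

text \<open>The difference step keeps the supports of both arguments, so \<open>P\<close> may speak
  of maps that are additive only on the carrier.\<close>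

lemma frag_keys_induct [consumes 1, case_names zero diff one]:
  assumes "Poly_Mapping.keys x \<subseteq> S" and "P 0"
    and "\<And>x y. Poly_Mapping.keys x \<subseteq> S \<Longrightarrow> Poly_Mapping.keys y \<subseteq> S \<Longrightarrow> P x \<Longrightarrow> P y \<Longrightarrow> P (x - y)"
    and "\<And>a. a \<in> S \<Longrightarrow> P (frag_of a)"
  shows "P x"
  using assms by (rule free_Abelian_group_induct)

text \<open>Convolution is biadditive, so each law follows from its instance on basis elements,
  where it is the corresponding law of the monoid. One induction per variable performs this
  reduction.\<close>

lemma (in comm_monoid) cring_int_monoid_ring: "cring (int_monoid_ring G)"
proof -
  let ?Z = "int_monoid_ring G"
  have comm: "c \<otimes>\<^bsub>?Z\<^esub> d = d \<otimes>\<^bsub>?Z\<^esub> c"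
    if c: "Poly_Mapping.keys c \<subseteq> carrier G" and d: "Poly_Mapping.keys d \<subseteq> carrier G" for c d
    using c
  proof (induction c rule: frag_induction)
    case (one x)
    show ?case using d
      by (induction d rule: frag_induction) (simp_all add: int_monoid_ring_bilinear one m_comm)
  qed (simp_all add: int_monoid_ring_bilinear)
  have closed: "Poly_Mapping.keys (c \<otimes>\<^bsub>?Z\<^esub> d) \<subseteq> carrier G"
    if c: "Poly_Mapping.keys c \<subseteq> carrier G" and d: "Poly_Mapping.keys d \<subseteq> carrier G" for c d
    using c
  proof (induction c rule: frag_induction)
    case (one x)
    show ?case using d
      by (induction d rule: frag_induction) (simp_all add: int_monoid_ring_bilinear one keys_diff_subset)
  qed (simp_all add: int_monoid_ring_bilinear keys_diff_subset)
  have assoc: "c \<otimes>\<^bsub>?Z\<^esub> d \<otimes>\<^bsub>?Z\<^esub> e = c \<otimes>\<^bsub>?Z\<^esub> (d \<otimes>\<^bsub>?Z\<^esub> e)"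
    if c: "Poly_Mapping.keys c \<subseteq> carrier G" and d: "Poly_Mapping.keys d \<subseteq> carrier G"
      and e: "Poly_Mapping.keys e \<subseteq> carrier G" for c d e
    using c
  proof (induction c rule: frag_induction)
    case (one x)
    show ?case using d
    proof (induction d rule: frag_induction)
      case (one y)
      show ?case using e
        by (induction e rule: frag_induction) (simp_all add: int_monoid_ring_bilinear one \<open>x \<in> carrier G\<close> m_assoc)
    qed (simp_all add: int_monoid_ring_bilinear)
  qed (simp_all add: int_monoid_ring_bilinear)
  have one: "frag_of \<one> \<otimes>\<^bsub>?Z\<^esub> c = c" if c: "Poly_Mapping.keys c \<subseteq> carrier G" for c
    using c by (induction c rule: frag_induction) (simp_all add: int_monoid_ring_bilinear)
  show ?thesis
  proof (rule cringI)
    show "abelian_group ?Z"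
    proof (rule abelian_groupI)
      fix c assume "c \<in> carrier ?Z"
      then show "\<exists>d\<in>carrier ?Z. d \<oplus>\<^bsub>?Z\<^esub> c = \<zero>\<^bsub>?Z\<^esub>"
        by (intro bexI[of _ "- c"]) simp_all
    next
      fix c d assume "c \<in> carrier ?Z" "d \<in> carrier ?Z"
      then show "c \<oplus>\<^bsub>?Z\<^esub> d \<in> carrier ?Z"
        using keys_add[of c d] by auto
    qed (simp_all add: ac_simps)
    show "comm_monoid ?Z"
    proof (rule comm_monoidI)
      fix c d e assume "c \<in> carrier ?Z" "d \<in> carrier ?Z" "e \<in> carrier ?Z"
      then have *: "Poly_Mapping.keys c \<subseteq> carrier G" "Poly_Mapping.keys d \<subseteq> carrier G"
        "Poly_Mapping.keys e \<subseteq> carrier G" by simp_all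
      show "c \<otimes>\<^bsub>?Z\<^esub> d \<in> carrier ?Z" using closed[OF *(1,2)] by simp
      show "c \<otimes>\<^bsub>?Z\<^esub> d \<otimes>\<^bsub>?Z\<^esub> e = c \<otimes>\<^bsub>?Z\<^esub> (d \<otimes>\<^bsub>?Z\<^esub> e)" by (rule assoc[OF *])
      show "c \<otimes>\<^bsub>?Z\<^esub> d = d \<otimes>\<^bsub>?Z\<^esub> c" by (rule comm[OF *(1,2)])
      show "\<one>\<^bsub>?Z\<^esub> \<otimes>\<^bsub>?Z\<^esub> c = c" using one[OF *(1)] by simp
    qed simp
  qed (simp add: int_monoid_ring_bilinear)
qed

lemma quotient_universal:
  assumes I: "ideal I R" and h: "ring_hom_ring R S h" and ker: "\<And>i. i \<in> I \<Longrightarrow> h i = \<zero>\<^bsub>S\<^esub>"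
  obtains g where "g \<in> ring_hom (R Quot I) S" "\<And>x. x \<in> carrier R \<Longrightarrow> g (I +>\<^bsub>R\<^esub> x) = h x"
proof -
  interpret I: ideal I R by fact
  interpret h: ring_hom_ring R S h by fact
  have eq: "h x = h y" if x: "x \<in> carrier R" and y: "y \<in> carrier R" and xy: "I +>\<^bsub>R\<^esub> x = I +>\<^bsub>R\<^esub> y" for x y
  proof -
    have "x \<in> I +>\<^bsub>R\<^esub> y" using I.a_rcos_self[OF x] xy by simp
    then obtain i where i: "i \<in> I" "x = i \<oplus>\<^bsub>R\<^esub> y"
      by (auto simp: a_r_coset_def r_coset_def)
    show ?thesis
      unfolding i(2) using i(1) y by (simp add: I.Icarr ker)
  qed
  define g where "g W = (SOME y. \<exists>x\<in>carrier R. W = I +>\<^bsub>R\<^esub> x \<and> y = h x)" for W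
  have g: "g (I +>\<^bsub>R\<^esub> x) = h x" if x: "x \<in> carrier R" for x
  proof -
    have "\<exists>x'\<in>carrier R. I +>\<^bsub>R\<^esub> x = I +>\<^bsub>R\<^esub> x' \<and> g (I +>\<^bsub>R\<^esub> x) = h x'"
      unfolding g_def by (rule someI_ex) (use x in blast)
    then obtain x' where x': "x' \<in> carrier R" "I +>\<^bsub>R\<^esub> x = I +>\<^bsub>R\<^esub> x'" "g (I +>\<^bsub>R\<^esub> x) = h x'"
      by blast
    show ?thesis unfolding x'(3) using eq[OF x x'(1,2)] by (rule sym)
  qed
  have car: "carrier (R Quot I) = (\<lambda>x. I +>\<^bsub>R\<^esub> x) ` carrier R"
    by (auto simp: FactRing_def A_RCOSETS_def')
  note hom = I.rcos_ring_hom
  have "g \<in> ring_hom (R Quot I) S"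
  proof (rule ring_hom_memI)
    fix V W assume "V \<in> carrier (R Quot I)" "W \<in> carrier (R Quot I)"
    then obtain x y where x: "x \<in> carrier R" and V: "V = I +>\<^bsub>R\<^esub> x" and y: "y \<in> carrier R" and W: "W = I +>\<^bsub>R\<^esub> y"
      unfolding car by blast
    show "g V \<in> carrier S" unfolding V g[OF x] using x by simp
    show "g (V \<otimes>\<^bsub>R Quot I\<^esub> W) = g V \<otimes>\<^bsub>S\<^esub> g W"
      unfolding V W ring_hom_mult[OF hom x y, symmetric] using x y by (simp add: g)
    show "g (V \<oplus>\<^bsub>R Quot I\<^esub> W) = g V \<oplus>\<^bsub>S\<^esub> g W"
      unfolding V W ring_hom_add[OF hom x y, symmetric] using x y by (simp add: g)
  next
    show "g \<one>\<^bsub>R Quot I\<^esub> = \<one>\<^bsub>S\<^esub>"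
      unfolding ring_hom_one[OF hom, symmetric] by (simp add: g)
  qed
  with g show thesis using that by blast
qed

section \<open>The tensor product of two algebras\<close>

locale tensor_product = R: algebra A R + S: algebra A S
  for A :: "('a, 'k) ring_scheme" and R :: "('a, 'r, 'm) module_scheme" and S :: "('a, 's, 'n) module_scheme"
begin

abbreviation "Z \<equiv> int_monoid_ring (R \<times>\<times> S)"
abbreviation "I \<equiv> tensor_ideal A R S"
abbreviation "T \<equiv> tensor A R S"
abbreviation "pt \<equiv> pure_tensor A R S"

lemma comm_monoid_RS: "comm_monoid (R \<times>\<times> S)"
  by (rule comm_monoidI) (auto simp: R.m_ac S.m_ac)

sublocale Z: cring Z
  by (rule comm_monoid.cring_int_monoid_ring[OF comm_monoid_RS])

lemma tensor_rels_closed: "tensor_rels A R S \<subseteq> carrier Z"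
proof
  fix x assume "x \<in> tensor_rels A R S"
  then show "x \<in> carrier Z"
    unfolding tensor_rels_def
    by (elim UnE CollectE exE conjE) (simp_all add: keys_diff_subset)
qed

sublocale I: ideal I Z
  unfolding tensor_ideal_def by (rule Z.genideal_ideal[OF tensor_rels_closed])

lemma rel_mem: "x \<in> tensor_rels A R S \<Longrightarrow> x \<in> I"
  unfolding tensor_ideal_def using Z.genideal_self[OF tensor_rels_closed] by blast

sublocale T: cring T
  unfolding tensor_def by (rule I.quotient_is_cring[OF Z.is_cring])

lemma proj_hom: "(+>\<^bsub>Z\<^esub>) I \<in> ring_hom Z T"
  unfolding tensor_def by (rule I.rcos_ring_hom)

sublocale proj: ring_hom_cring Z T "(+>\<^bsub>Z\<^esub>) I"
  by (rule UnivPoly.ring_hom_cringI[OF Z.is_cring T.is_cring proj_hom])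

lemma proj_rel: "x \<in> tensor_rels A R S \<Longrightarrow> I +>\<^bsub>Z\<^esub> x = \<zero>\<^bsub>T\<^esub>"
  using I.a_rcos_const[OF rel_mem] by (simp add: tensor_def FactRing_def)

lemma pure_closed [simp, intro]: "r \<in> carrier R \<Longrightarrow> s \<in> carrier S \<Longrightarrow> pt r s \<in> carrier T"
  unfolding pure_tensor_def by (rule proj.hom_closed) simp

lemma pure_mult:
  assumes "r \<in> carrier R" "s \<in> carrier S" "r' \<in> carrier R" "s' \<in> carrier S"
  shows "pt r s \<otimes>\<^bsub>T\<^esub> pt r' s' = pt (r \<otimes>\<^bsub>R\<^esub> r') (s \<otimes>\<^bsub>S\<^esub> s')"
  unfolding pure_tensor_def using assms proj.hom_mult[of "frag_of (r, s)" "frag_of (r', s')"] by simp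

lemma pure_one: "pt \<one>\<^bsub>R\<^esub> \<one>\<^bsub>S\<^esub> = \<one>\<^bsub>T\<^esub>"
  unfolding pure_tensor_def using proj.hom_one by simp

text \<open>The defining relations all have the shape \<open>x - y - z\<close>: the two additivity
  relations literally, the balancing relation with \<open>z = 0\<close>. One computation in the
  quotient serves all three.\<close>

lemma proj_eq_add:
  assumes "x - y - z \<in> tensor_rels A R S" "y \<in> carrier Z" "z \<in> carrier Z"
  shows "I +>\<^bsub>Z\<^esub> x = (I +>\<^bsub>Z\<^esub> y) \<oplus>\<^bsub>T\<^esub> (I +>\<^bsub>Z\<^esub> z)"
proof -
  have rel: "x - y - z \<in> carrier Z" using assms(1) tensor_rels_closed by blast
  have "x = (x - y - z) \<oplus>\<^bsub>Z\<^esub> (y \<oplus>\<^bsub>Z\<^esub> z)" by simp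
  then have "I +>\<^bsub>Z\<^esub> x = (I +>\<^bsub>Z\<^esub> (x - y - z)) \<oplus>\<^bsub>T\<^esub> ((I +>\<^bsub>Z\<^esub> y) \<oplus>\<^bsub>T\<^esub> (I +>\<^bsub>Z\<^esub> z))"
    using proj.hom_add[OF rel Z.a_closed[OF assms(2,3)]] proj.hom_add[OF assms(2,3)] by (simp only:)
  then show ?thesis
    unfolding proj_rel[OF assms(1)] using proj.hom_closed[OF assms(2)] proj.hom_closed[OF assms(3)]
    by (simp only: T.l_zero T.a_closed)
qed

lemma pure_add_left:
  assumes "r \<in> carrier R" "r' \<in> carrier R" "s \<in> carrier S"
  shows "pt (r \<oplus>\<^bsub>R\<^esub> r') s = pt r s \<oplus>\<^bsub>T\<^esub> pt r' s"
  unfolding pure_tensor_def by (rule proj_eq_add) (use assms in \<open>auto simp: tensor_rels_def\<close>)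

lemma pure_add_right:
  assumes "r \<in> carrier R" "s \<in> carrier S" "s' \<in> carrier S"
  shows "pt r (s \<oplus>\<^bsub>S\<^esub> s') = pt r s \<oplus>\<^bsub>T\<^esub> pt r s'"
  unfolding pure_tensor_def by (rule proj_eq_add) (use assms in \<open>auto simp: tensor_rels_def\<close>)

lemma pure_smult:
  assumes "a \<in> carrier A" "r \<in> carrier R" "s \<in> carrier S"
  shows "pt (a \<odot>\<^bsub>R\<^esub> r) s = pt r (a \<odot>\<^bsub>S\<^esub> s)"
proof -
  have "pt (a \<odot>\<^bsub>R\<^esub> r) s = pt r (a \<odot>\<^bsub>S\<^esub> s) \<oplus>\<^bsub>T\<^esub> (I +>\<^bsub>Z\<^esub> 0)"
    unfolding pure_tensor_def by (rule proj_eq_add) (use assms in \<open>auto simp: tensor_rels_def\<close>)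
  also have "I +>\<^bsub>Z\<^esub> 0 = \<zero>\<^bsub>T\<^esub>" using proj.hom_zero by simp
  finally show ?thesis using assms by simp
qed

lemma tensor_left_hom: "tensor_left A R S \<in> ring_hom R T"
  unfolding tensor_left_def by (rule ring_hom_memI) (auto simp: pure_mult pure_add_left pure_one)

lemma pure_right_hom: "pt \<one>\<^bsub>R\<^esub> \<in> ring_hom S T"
  by (rule ring_hom_memI) (auto simp: pure_mult pure_add_right pure_one)

lemma pure_eq_mult: "r \<in> carrier R \<Longrightarrow> s \<in> carrier S \<Longrightarrow> pt r s = tensor_left A R S r \<otimes>\<^bsub>T\<^esub> pt \<one>\<^bsub>R\<^esub> s"
  by (simp add: tensor_left_def pure_mult)

lemma tensorE:
  assumes "x \<in> carrier T"
  obtains c where "c \<in> carrier Z" "x = I +>\<^bsub>Z\<^esub> c"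
  using assms unfolding tensor_def by (auto simp: FactRing_def A_RCOSETS_def')

text \<open>Pure tensors generate the additive group. A single closure condition under differences
  replaces those for zero, sums and negatives, the zero case being the difference of a pure tensor
  with itself.\<close>

lemma tensor_induct:
  assumes x: "x \<in> carrier T"
    and pure: "\<And>r s. r \<in> carrier R \<Longrightarrow> s \<in> carrier S \<Longrightarrow> P (pt r s)"
    and sub: "\<And>x y. x \<in> carrier T \<Longrightarrow> y \<in> carrier T \<Longrightarrow> P x \<Longrightarrow> P y \<Longrightarrow> P (x \<ominus>\<^bsub>T\<^esub> y)"
  shows "P x"
proof -
  have P0: "P \<zero>\<^bsub>T\<^esub>"
    using sub[OF _ _ pure pure, of "\<one>\<^bsub>R\<^esub>" "\<one>\<^bsub>S\<^esub>" "\<one>\<^bsub>R\<^esub>" "\<one>\<^bsub>S\<^esub>"] by (simp add: T.r_neg a_minus_def)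
  obtain c where c: "Poly_Mapping.keys c \<subseteq> carrier R \<times> carrier S" and xc: "x = I +>\<^bsub>Z\<^esub> c"
    using x by (elim tensorE) simp
  have "P (I +>\<^bsub>Z\<^esub> c)"
    using c
  proof (induction c rule: frag_keys_induct)
    case zero
    then show ?case using P0 proj.hom_zero by simp
  next
    case (diff c d)
    then have cd: "c \<in> carrier Z" "d \<in> carrier Z" by simp_all
    then have *: "- d \<in> carrier Z" by simp
    have "(I +>\<^bsub>Z\<^esub> d) \<oplus>\<^bsub>T\<^esub> (I +>\<^bsub>Z\<^esub> (- d)) = \<zero>\<^bsub>T\<^esub>"
      using proj.hom_add[OF cd(2) *] proj.hom_zero by simp
    then have "I +>\<^bsub>Z\<^esub> (- d) = \<ominus>\<^bsub>T\<^esub> (I +>\<^bsub>Z\<^esub> d)"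
      using T.minus_equality T.a_comm proj.hom_closed cd * by metis
    then have "I +>\<^bsub>Z\<^esub> (c - d) = (I +>\<^bsub>Z\<^esub> c) \<ominus>\<^bsub>T\<^esub> (I +>\<^bsub>Z\<^esub> d)"
      using proj.hom_add[OF cd(1) *] by (simp add: a_minus_def)
    then show ?case
      using diff sub[OF proj.hom_closed[OF cd(1)] proj.hom_closed[OF cd(2)]] by simp
  next
    case (one p)
    then show ?case using pure by (cases p) (auto simp: pure_tensor_def)
  qed
  then show ?thesis by (simp only: xc)
qed

text \<open>The tensor product is the coproduct of commutative \<open>A\<close>-algebras. The map
  exists on the free abelian group of pairs, is multiplicative because it is so on basis elements,
  and factors through the quotient because it kills the relations. It is determined by its values on
  pure tensors, so only existence is recorded.\<close>

lemma tensor_universal: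
  assumes "cring U" and h1: "h1 \<in> ring_hom R U" and h2: "h2 \<in> ring_hom S U"
    and agree: "\<And>a. a \<in> carrier A \<Longrightarrow> h1 (a \<odot>\<^bsub>R\<^esub> \<one>\<^bsub>R\<^esub>) = h2 (a \<odot>\<^bsub>S\<^esub> \<one>\<^bsub>S\<^esub>)"
  obtains g where "g \<in> ring_hom T U"
    "\<And>r s. r \<in> carrier R \<Longrightarrow> s \<in> carrier S \<Longrightarrow> g (pt r s) = h1 r \<otimes>\<^bsub>U\<^esub> h2 s"
proof -
  interpret U: cring U by fact
  note c1 = ring_hom_closed[OF h1] and c2 = ring_hom_closed[OF h2]
  define f where "f p = h1 (fst p) \<otimes>\<^bsub>U\<^esub> h2 (snd p)" for p
  have "f ` (carrier R \<times> carrier S) \<subseteq> carrier (add_monoid U)"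
    using c1 c2 by (auto simp: f_def)
  then obtain k where k: "k \<in> hom (free_Abelian_group (carrier R \<times> carrier S)) (add_monoid U)"
    and kf: "\<And>p. p \<in> carrier R \<times> carrier S \<Longrightarrow> k (frag_of p) = f p"
    using comm_group.free_Abelian_group_universal[OF U.a_comm_group] by metis
  have kc: "k c \<in> carrier U" if "c \<in> carrier Z" for c
    using hom_in_carrier[OF k, of c] that by simp
  have kadd: "k (c + d) = k c \<oplus>\<^bsub>U\<^esub> k d" if "c \<in> carrier Z" "d \<in> carrier Z" for c d
    using hom_mult[OF k, of c d] that by simp
  have kzero: "k 0 = \<zero>\<^bsub>U\<^esub>"
    using kadd[of 0 0] kc[of 0] U.add.l_cancel_one'[of "k 0" "k 0"] by simp
  have kdiff: "k (c - d) = k c \<ominus>\<^bsub>U\<^esub> k d" if "c \<in> carrier Z" "d \<in> carrier Z" for c d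
  proof -
    have cd: "c - d \<in> carrier Z" using that keys_diff_subset by simp
    have "k c = k (c - d) \<oplus>\<^bsub>U\<^esub> k d" using kadd[OF cd that(2)] by simp
    then show ?thesis using kc[OF cd] kc[OF that(2)] by (simp add: a_minus_def U.a_assoc U.r_neg)
  qed
  have kmult: "k (c \<otimes>\<^bsub>Z\<^esub> d) = k c \<otimes>\<^bsub>U\<^esub> k d" if c: "c \<in> carrier Z" and d: "d \<in> carrier Z" for c d
  proof -
    have "Poly_Mapping.keys c \<subseteq> carrier R \<times> carrier S" using c by simp
    then show ?thesis
    proof (induction c rule: frag_keys_induct)
      case zero
      show ?case using kc[OF d] by (simp add: int_monoid_ring_bilinear kzero)
    next
      case (diff a b)
      then have ab: "a \<in> carrier Z" "b \<in> carrier Z" by simp_all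
      then show ?case
        using diff kdiff[OF ab] kdiff[OF Z.m_closed[OF ab(1) d] Z.m_closed[OF ab(2) d]] kc[OF ab(1)] kc[OF ab(2)] kc[OF d]
        by (simp add: int_monoid_ring_bilinear a_minus_def U.l_distr U.l_minus)
    next
      case (one p)
      have p: "frag_of p \<in> carrier Z" using one by simp
      have "Poly_Mapping.keys d \<subseteq> carrier R \<times> carrier S" using d by simp
      then show ?case
      proof (induction d rule: frag_keys_induct)
        case zero
        show ?case using kc[OF p] by (simp add: int_monoid_ring_bilinear kzero)
      next
        case (diff a b)
        then have ab: "a \<in> carrier Z" "b \<in> carrier Z" by simp_all
        then show ?case
          using diff kdiff[OF ab] kdiff[OF Z.m_closed[OF p ab(1)] Z.m_closed[OF p ab(2)]] kc[OF ab(1)] kc[OF ab(2)] kc[OF p]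
          by (simp add: int_monoid_ring_bilinear a_minus_def U.r_distr U.r_minus)
      next
        case (one q)
        obtain r s r' s' where pq: "p = (r, s)" "q = (r', s')" by (cases p, cases q) blast
        have rs: "r \<in> carrier R" "s \<in> carrier S" "r' \<in> carrier R" "s' \<in> carrier S"
          using \<open>p \<in> _\<close> one unfolding pq by simp_all
        show ?case
          unfolding pq using rs c1 c2
          by (simp add: kf f_def ring_hom_mult[OF h1] ring_hom_mult[OF h2] U.m_ac)
      qed
    qed
  qed
  have kone: "k \<one>\<^bsub>Z\<^esub> = \<one>\<^bsub>U\<^esub>"
    using ring_hom_one[OF h1] ring_hom_one[OF h2] by (simp add: kf f_def)
  have khom: "k \<in> ring_hom Z U"
    by (rule ring_hom_memI) (use kc kmult kadd kone in auto)
  interpret k: ring_hom_cring Z U k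
    by (rule UnivPoly.ring_hom_cringI[OF Z.is_cring U.is_cring khom])
  \<comment> \<open>A scalar \<open>a\<close> acts as multiplication by \<open>a 1\<close>, so
    agreement of \<open>h1\<close> and \<open>h2\<close> on the multiples of the units already gives
    compatibility with the balancing relation.\<close>
  have bal1: "h1 (a \<odot>\<^bsub>R\<^esub> r) = h1 (a \<odot>\<^bsub>R\<^esub> \<one>\<^bsub>R\<^esub>) \<otimes>\<^bsub>U\<^esub> h1 r" if "a \<in> carrier A" "r \<in> carrier R" for a r
    using that ring_hom_mult[OF h1, of "a \<odot>\<^bsub>R\<^esub> \<one>\<^bsub>R\<^esub>" r] R.smult_assoc2[of a "\<one>\<^bsub>R\<^esub>" r] by simp
  have bal2: "h2 (a \<odot>\<^bsub>S\<^esub> s) = h1 (a \<odot>\<^bsub>R\<^esub> \<one>\<^bsub>R\<^esub>) \<otimes>\<^bsub>U\<^esub> h2 s" if "a \<in> carrier A" "s \<in> carrier S" for a s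
    using that ring_hom_mult[OF h2, of "a \<odot>\<^bsub>S\<^esub> \<one>\<^bsub>S\<^esub>" s] S.smult_assoc2[of a "\<one>\<^bsub>S\<^esub>" s] by (simp add: agree)
  have rel: "k x = \<zero>\<^bsub>U\<^esub>" if "x \<in> tensor_rels A R S" for x
    using that unfolding tensor_rels_def
  proof (elim UnE CollectE exE conjE)
    fix r r' s assume *: "x = frag_of (r \<oplus>\<^bsub>R\<^esub> r', s) - frag_of (r, s) - frag_of (r', s)"
      "r \<in> carrier R" "r' \<in> carrier R" "s \<in> carrier S"
    then have "k x = f (r \<oplus>\<^bsub>R\<^esub> r', s) \<ominus>\<^bsub>U\<^esub> f (r, s) \<ominus>\<^bsub>U\<^esub> f (r', s)"
      by (simp add: kdiff keys_diff_subset kf)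
    also have "\<dots> = \<zero>\<^bsub>U\<^esub>"
      using *(2-4) c1 c2 by (simp add: f_def ring_hom_add[OF h1] U.l_distr) (simp add: a_minus_def U.a_ac U.r_neg U.r_neg1 U.r_neg2)
    finally show ?thesis .
  next
    fix r s s' assume *: "x = frag_of (r, s \<oplus>\<^bsub>S\<^esub> s') - frag_of (r, s) - frag_of (r, s')"
      "r \<in> carrier R" "s \<in> carrier S" "s' \<in> carrier S"
    then have "k x = f (r, s \<oplus>\<^bsub>S\<^esub> s') \<ominus>\<^bsub>U\<^esub> f (r, s) \<ominus>\<^bsub>U\<^esub> f (r, s')"
      by (simp add: kdiff keys_diff_subset kf)
    also have "\<dots> = \<zero>\<^bsub>U\<^esub>"
      using *(2-4) c1 c2 by (simp add: f_def ring_hom_add[OF h2] U.r_distr) (simp add: a_minus_def U.a_ac U.r_neg U.r_neg1 U.r_neg2)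
    finally show ?thesis .
  next
    fix a r s assume *: "x = frag_of (a \<odot>\<^bsub>R\<^esub> r, s) - frag_of (r, a \<odot>\<^bsub>S\<^esub> s)"
      "a \<in> carrier A" "r \<in> carrier R" "s \<in> carrier S"
    then have "k x = f (a \<odot>\<^bsub>R\<^esub> r, s) \<ominus>\<^bsub>U\<^esub> f (r, a \<odot>\<^bsub>S\<^esub> s)"
      by (simp add: kdiff kf)
    also have "f (r, a \<odot>\<^bsub>S\<^esub> s) = f (a \<odot>\<^bsub>R\<^esub> r, s)"
      using *(2-4) c1 c2 c1[of "a \<odot>\<^bsub>R\<^esub> \<one>\<^bsub>R\<^esub>"] by (simp add: f_def bal1[OF *(2,3)] bal2[OF *(2,4)] U.m_ac)
    finally show ?thesis using *(2-4) c1 c2 by (simp add: f_def a_minus_def U.r_neg)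
  qed
  \<comment> \<open>The kernel of a ring homomorphism is an ideal, so killing the generating
    relations is enough.\<close>
  have "I \<subseteq> a_kernel Z U k"
    unfolding tensor_ideal_def
  proof (rule Z.genideal_minimal[OF k.ring.kernel_is_ideal], rule subsetI)
    fix x assume x: "x \<in> tensor_rels A R S"
    have "x \<in> carrier Z" using x tensor_rels_closed by blast
    then show "x \<in> a_kernel Z U k"
      unfolding a_kernel_def' using rel[OF x] by blast
  qed
  then have ker: "k i = \<zero>\<^bsub>U\<^esub>" if "i \<in> I" for i
    using that unfolding a_kernel_def' by blast
  obtain g where g: "g \<in> ring_hom T U" "\<And>c. c \<in> carrier Z \<Longrightarrow> g (I +>\<^bsub>Z\<^esub> c) = k c"
    unfolding tensor_def using quotient_universal[OF I.is_ideal k.ring.ring_hom_ring_axioms ker] by blast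
  show thesis
    by (rule that[OF g(1)]) (simp add: pure_tensor_def g(2) kf f_def)
qed

end

text \<open>\<open>tensor_map\<close> is a union over all representatives and carries no source
  algebra, so nothing about it is visible from its definition alone. The homomorphism
  \<open>g\<close> given by the universal property sends the class of \<open>c\<close> to the class
  of \<open>?e c\<close>; thus all terms of the union coincide with \<open>g x\<close>, and
  \<open>tensor_map\<close> inherits the properties of \<open>g\<close>.\<close>

lemma tensor_map_hom:
  assumes RS: "tensor_product A R S" and RS': "tensor_product A R S'"
    and h: "h \<in> ring_hom S S'" and lin: "\<And>a. a \<in> carrier A \<Longrightarrow> h (a \<odot>\<^bsub>S\<^esub> \<one>\<^bsub>S\<^esub>) = a \<odot>\<^bsub>S'\<^esub> \<one>\<^bsub>S'\<^esub>"
  shows "tensor_map A R S' h \<in> ring_hom (tensor A R S) (tensor A R S')" (is ?hom)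
    and "\<And>r s. r \<in> carrier R \<Longrightarrow> s \<in> carrier S \<Longrightarrow>
      tensor_map A R S' h (pure_tensor A R S r s) = pure_tensor A R S' r (h s)"
proof -
  interpret T: tensor_product A R S by fact
  interpret T': tensor_product A R S' by fact
  have hc: "h s \<in> carrier S'" if "s \<in> carrier S" for s using ring_hom_closed[OF h that] .
  have h2: "(\<lambda>s. T'.pt \<one>\<^bsub>R\<^esub> (h s)) \<in> ring_hom S T'.T"
    using ring_hom_trans[OF h T'.pure_right_hom] by (simp add: comp_def)
  have agree: "tensor_left A R S' (a \<odot>\<^bsub>R\<^esub> \<one>\<^bsub>R\<^esub>) = T'.pt \<one>\<^bsub>R\<^esub> (h (a \<odot>\<^bsub>S\<^esub> \<one>\<^bsub>S\<^esub>))" if "a \<in> carrier A" for a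
    using that by (simp add: tensor_left_def T'.pure_smult lin)
  obtain g where g: "g \<in> ring_hom T.T T'.T"
    and gp: "\<And>r s. r \<in> carrier R \<Longrightarrow> s \<in> carrier S \<Longrightarrow> g (T.pt r s) = tensor_left A R S' r \<otimes>\<^bsub>T'.T\<^esub> T'.pt \<one>\<^bsub>R\<^esub> (h s)"
    using T.tensor_universal[OF T'.T.is_cring T'.tensor_left_hom h2 agree] by blast
  interpret g: ring_hom_cring T.T T'.T g
    by (rule UnivPoly.ring_hom_cringI[OF T.T.is_cring T'.T.is_cring g])
  let ?e = "frag_extend (\<lambda>(r, s). frag_of (r, h s))"
  have e: "?e c \<in> carrier T'.Z \<and> T'.I +>\<^bsub>T'.Z\<^esub> ?e c = g (T.I +>\<^bsub>T.Z\<^esub> c)" if "c \<in> carrier T.Z" for c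
  proof -
    have "Poly_Mapping.keys c \<subseteq> carrier R \<times> carrier S" using that by simp
    then show ?thesis
    proof (induction c rule: frag_keys_induct)
      case zero
      show ?case using T.proj.hom_zero T'.proj.hom_zero by simp
    next
      case (diff c d)
      then have cd: "c \<in> carrier T.Z" "d \<in> carrier T.Z" "c - d \<in> carrier T.Z"
        and ecd: "?e c \<in> carrier T'.Z" "?e d \<in> carrier T'.Z" by (simp_all add: keys_diff_subset)
      have ediff: "?e (c - d) \<in> carrier T'.Z"
        using ecd by (simp add: frag_extend_diff keys_diff_subset)
      have "T'.I +>\<^bsub>T'.Z\<^esub> ?e c = (T'.I +>\<^bsub>T'.Z\<^esub> ?e (c - d)) \<oplus>\<^bsub>T'.T\<^esub> (T'.I +>\<^bsub>T'.Z\<^esub> ?e d)"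
        using T'.proj.hom_add[OF ediff ecd(2)] by (simp add: frag_extend_diff)
      moreover have "g (T.I +>\<^bsub>T.Z\<^esub> c) = g (T.I +>\<^bsub>T.Z\<^esub> (c - d)) \<oplus>\<^bsub>T'.T\<^esub> g (T.I +>\<^bsub>T.Z\<^esub> d)"
        using T.proj.hom_add[OF cd(3,2)] g.hom_add[OF T.proj.hom_closed[OF cd(3)] T.proj.hom_closed[OF cd(2)]]
        by simp
      ultimately have "(T'.I +>\<^bsub>T'.Z\<^esub> ?e (c - d)) \<oplus>\<^bsub>T'.T\<^esub> (T'.I +>\<^bsub>T'.Z\<^esub> ?e d) = g (T.I +>\<^bsub>T.Z\<^esub> (c - d)) \<oplus>\<^bsub>T'.T\<^esub> (T'.I +>\<^bsub>T'.Z\<^esub> ?e d)"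
        using diff by simp
      then have "T'.I +>\<^bsub>T'.Z\<^esub> ?e (c - d) = g (T.I +>\<^bsub>T.Z\<^esub> (c - d))"
        by (rule T'.T.add.r_cancel[simplified])
          (use T'.proj.hom_closed[OF ediff] T'.proj.hom_closed[OF ecd(2)] g.hom_closed[OF T.proj.hom_closed[OF cd(3)]] in simp_all)
      then show ?case using ediff by simp
    next
      case (one p)
      obtain r s where p: "p = (r, s)" by (cases p)
      have rs: "r \<in> carrier R" "s \<in> carrier S" using one p by simp_all
      then show ?case
        using gp[OF rs] T'.pure_eq_mult[OF rs(1) hc[OF rs(2)]] hc by (simp add: p pure_tensor_def)
    qed
  qed
  have map: "tensor_map A R S' h x = g x" if x: "x \<in> carrier T.T" for x
  proof -
    obtain c where c: "c \<in> carrier T.Z" "x = T.I +>\<^bsub>T.Z\<^esub> c" using x by (rule T.tensorE)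
    have d: "d \<in> carrier T.Z \<and> T.I +>\<^bsub>T.Z\<^esub> d = x" if "d \<in> x" for d
    proof -
      have "d \<in> T.I +>\<^bsub>T.Z\<^esub> c" using that c by simp
      moreover from this have "d \<in> carrier T.Z"
        using T.Z.a_r_coset_subset_G[OF T.I.a_subset c(1)] by blast
      ultimately show ?thesis
        using T.Z.a_repr_independence[OF _ c(1) T.I.a_subgroup, of d] c(2) by simp
    qed
    have "x \<noteq> {}" using T.I.a_rcos_self[OF c(1)] c(2) by blast
    moreover have "T'.I +>\<^bsub>T'.Z\<^esub> ?e d = g x" if "d \<in> x" for d
      using e d[OF that] by blast
    ultimately show ?thesis
      unfolding tensor_map_def by (rule SUP_eq_const)
  qed
  show ?hom
    by (rule ring_hom_memI) (simp_all add: map)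
  show "tensor_map A R S' h (T.pt r s) = T'.pt r (h s)" if "r \<in> carrier R" "s \<in> carrier S" for r s
    using gp[OF that] T'.pure_eq_mult[OF that(1) hc[OF that(2)]] map[OF T.pure_closed[OF that]] by simp
qed

section \<open>Simple extensions by a separable element\<close>

text \<open>\<open>psum R c x n\<close> has \<open>n\<close> terms, whereas \<open>pderiv_sum R c x n\<close> belongs to the polynomial
  \<open>psum R c x (Suc n)\<close> of formal degree \<open>n\<close>.\<close>

primrec psum :: "('a, 'm) ring_scheme \<Rightarrow> (nat \<Rightarrow> 'a) \<Rightarrow> 'a \<Rightarrow> nat \<Rightarrow> 'a" where
  "psum R c x 0 = \<zero>\<^bsub>R\<^esub>"
| "psum R c x (Suc n) = psum R c x n \<oplus>\<^bsub>R\<^esub> c n \<otimes>\<^bsub>R\<^esub> x [^]\<^bsub>R\<^esub> n"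

definition pderiv_sum :: "('a, 'm) ring_scheme \<Rightarrow> (nat \<Rightarrow> 'a) \<Rightarrow> 'a \<Rightarrow> nat \<Rightarrow> 'a" where
  "pderiv_sum R c x n = psum R (\<lambda>i. add_pow R (Suc i) (c (Suc i))) x n"

section \<open>Polynomials given by coefficient functions\<close>

context cring
begin

lemma psum_closed [simp]: "(\<And>i. c i \<in> carrier R) \<Longrightarrow> x \<in> carrier R \<Longrightarrow> psum R c x n \<in> carrier R"
  by (induction n) simp_all

lemma pderiv_sum_closed [simp]: "(\<And>i. c i \<in> carrier R) \<Longrightarrow> x \<in> carrier R \<Longrightarrow> pderiv_sum R c x n \<in> carrier R"
  unfolding pderiv_sum_def by (rule psum_closed) simp_all

lemma psum_lincomb:
  assumes "\<And>i. c i \<in> carrier R" "\<And>i. d i \<in> carrier R" "x \<in> carrier R" "u \<in> carrier R" "v \<in> carrier R"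
  shows "psum R (\<lambda>i. u \<otimes> c i \<oplus> v \<otimes> d i) x n = u \<otimes> psum R c x n \<oplus> v \<otimes> psum R d x n"
  by (induction n) (use assms in \<open>simp_all add: l_distr r_distr m_assoc a_ac\<close>)

lemma psum_smult:
  assumes "\<And>i. c i \<in> carrier R" "x \<in> carrier R" "u \<in> carrier R"
  shows "psum R (\<lambda>i. u \<otimes> c i) x n = u \<otimes> psum R c x n"
  by (induction n) (use assms in \<open>simp_all add: r_distr m_assoc\<close>)

lemma pderiv_sum_smult:
  assumes "\<And>i. c i \<in> carrier R" "x \<in> carrier R" "u \<in> carrier R"
  shows "pderiv_sum R (\<lambda>i. u \<otimes> c i) x n = u \<otimes> pderiv_sum R c x n"
  unfolding pderiv_sum_def using assms
  by (subst psum_smult[symmetric]) (simp_all only: add_pow_rdistr add.nat_pow_closed)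

text \<open>This is multiplication by a power of the variable, which aligns leading terms in
  pseudo-division.\<close>

lemma psum_shift:
  assumes "\<And>i. c i \<in> carrier R" "x \<in> carrier R"
  shows "psum R (\<lambda>i. if i < k then \<zero> else c (i - k)) x (k + n) = x [^] k \<otimes> psum R c x n"
proof (induction n)
  case 0
  have "psum R (\<lambda>i. if i < k then \<zero> else c (i - k)) x j = \<zero>" if "j \<le> k" for j
    using that by (induction j) (use assms in simp_all)
  then show ?case using assms by simp
next
  case (Suc n)
  have "c n \<otimes> x [^] (k + n) = x [^] k \<otimes> (c n \<otimes> x [^] n)"
    using assms by (simp add: nat_pow_mult[symmetric] m_lcomm)
  then show ?case using Suc assms by (simp add: r_distr)
qed

text \<open>Gives two polynomials a common formal length, after which they can be combined
  coefficient by coefficient.\<close>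

lemma psum_pad:
  assumes "\<And>i. c i \<in> carrier R" "x \<in> carrier R"
  shows "psum R (\<lambda>i. if i < n then c i else \<zero>) x (n + k) = psum R c x n"
proof (induction k)
  case 0
  have "psum R (\<lambda>i. if i < n then c i else \<zero>) x j = psum R c x j" if "j \<le> n" for j
    using that by (induction j) simp_all
  then show ?case by simp
qed (use assms in simp)

text \<open>One Horner step, in the shape of the inductive rule \<open>lin\<close> that generates
  \<open>simple_extension\<close>.\<close>

lemma psum_Cons:
  assumes "\<And>i. c i \<in> carrier R" "x \<in> carrier R" "a \<in> carrier R"
  shows "psum R (\<lambda>i. if i = 0 then a else c (i - 1)) x (Suc n) = psum R c x n \<otimes> x \<oplus> a"
proof (induction n)
  case (Suc n)
  have "psum R (\<lambda>i. if i = 0 then a else c (i - 1)) x (Suc (Suc n))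
      = psum R c x n \<otimes> x \<oplus> a \<oplus> c n \<otimes> (x [^] n \<otimes> x)"
    using Suc by simp
  then show ?case using assms by (simp add: l_distr m_assoc a_ac)
qed (use assms in simp)

text \<open>The bridge from coefficient lists, leading coefficient first, to coefficient functions.
  Functions are preferred because a homomorphism may kill coefficients: a list would have to be
  normalised again, a function stays as it is.\<close>

lemma eval_map_rev_upt:
  assumes "\<And>i. c i \<in> carrier R" "x \<in> carrier R"
  shows "eval (map c (rev [0..<n])) x = psum R c x n"
  by (induction n) (use assms in \<open>simp_all add: a_comm\<close>)

end

lemma (in ring_hom_cring) psum_hom:
  assumes "\<And>i. c i \<in> carrier R" "x \<in> carrier R"
  shows "h (psum R c x n) = psum S (\<lambda>i. h (c i)) (h x) n"
  by (induction n) (use assms in simp_all)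

lemma (in ring_hom_cring) add_pow_hom:
  assumes "x \<in> carrier R"
  shows "h (add_pow R (n::nat) x) = add_pow S n (h x)"
  by (induction n) (use assms in simp_all)

lemma (in ring_hom_cring) pderiv_sum_hom:
  assumes "\<And>i. c i \<in> carrier R" "x \<in> carrier R"
  shows "h (pderiv_sum R c x n) = pderiv_sum S (\<lambda>i. h (c i)) (h x) n"
  unfolding pderiv_sum_def using assms by (subst psum_hom) (simp_all add: add_pow_hom)

section \<open>Fraction fields and minimal polynomials with cleared denominators\<close>

context domain
begin

lemma fractions: "localised_cring R (carrier R - {\<zero>})"
  by unfold_locales (auto simp: integral_iff)

interpretation F: localised_cring R "carrier R - {\<zero>}"
  by (rule fractions)

lemma frac_eq_zero_iff:
  assumes "r \<in> carrier R" "s \<in> carrier R - {\<zero>}"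
  shows "frac R (carrier R - {\<zero>}) r s = \<zero>\<^bsub>frac_field R\<^esub> \<longleftrightarrow> r = \<zero>"
proof -
  have "frac R (carrier R - {\<zero>}) r s = \<zero>\<^bsub>frac_field R\<^esub> \<longleftrightarrow> (\<exists>t\<in>carrier R - {\<zero>}. t \<otimes> (r \<otimes> \<one>) = t \<otimes> (\<zero> \<otimes> s))"
    unfolding F.loc_zero by (rule F.frac_eq_iff) (use assms in auto)
  also have "\<dots> \<longleftrightarrow> r = \<zero>"
    using assms by (auto simp: integral_iff intro!: bexI[of _ \<one>])
  finally show ?thesis .
qed

lemma frac_mult_swap:
  assumes "r \<in> carrier R - {\<zero>}" "s \<in> carrier R - {\<zero>}"
  shows "frac R (carrier R - {\<zero>}) r s \<otimes>\<^bsub>frac_field R\<^esub> frac R (carrier R - {\<zero>}) s r = \<one>\<^bsub>frac_field R\<^esub>"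
proof -
  have "frac R (carrier R - {\<zero>}) (r \<otimes> s) (s \<otimes> r) = \<one>\<^bsub>frac_field R\<^esub>"
    unfolding F.loc_one by (rule F.frac_eqI) (use assms in \<open>auto simp: integral_iff m_comm\<close>)
  then show ?thesis using assms by (simp add: F.frac_mult)
qed

lemma frac_field_field: "field (frac_field R)"
proof (rule cring.cring_fieldI2[OF F.cring_loc])
  show "\<zero>\<^bsub>frac_field R\<^esub> \<noteq> \<one>\<^bsub>frac_field R\<^esub>"
    using frac_eq_zero_iff[of \<one> \<one>] by (auto simp: F.loc_one)
  fix x assume "x \<in> carrier (frac_field R)" "x \<noteq> \<zero>\<^bsub>frac_field R\<^esub>"
  then obtain r s where rs: "r \<in> carrier R - {\<zero>}" "s \<in> carrier R - {\<zero>}" "x = frac R (carrier R - {\<zero>}) r s"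
    using frac_eq_zero_iff by (elim F.locE) blast
  then show "\<exists>y\<in>carrier (frac_field R). x \<otimes>\<^bsub>frac_field R\<^esub> y = \<one>\<^bsub>frac_field R\<^esub>"
    using frac_mult_swap[OF rs(1,2)] by (intro bexI[of _ "frac R (carrier R - {\<zero>}) s r"]) (auto intro: F.frac_closed)
qed

lemma frac_subfield_subfield:
  assumes "subring A R"
  shows "subfield (frac_subfield R A) (frac_field R)"
proof -
  interpret L: field "frac_field R" by (rule frac_field_field)
  let ?f = "frac R (carrier R - {\<zero>})"
  have AR: "A \<subseteq> carrier R" using subringE(1)[OF assms] .
  have memI: "?f a s \<in> frac_subfield R A" if "a \<in> A" "s \<in> A - {\<zero>}" for a s
    using that unfolding frac_subfield_def by blast
  show ?thesis
  proof (rule L.subfieldI'[OF L.subringI])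
    show "frac_subfield R A \<subseteq> carrier (frac_field R)"
      using AR unfolding frac_subfield_def by (auto intro!: F.frac_closed)
    show "\<one>\<^bsub>frac_field R\<^esub> \<in> frac_subfield R A"
      unfolding F.loc_one by (rule memI) (use subringE(3)[OF assms] in auto)
  next
    fix x y assume "x \<in> frac_subfield R A" "y \<in> frac_subfield R A"
    then obtain a s a' s' where *: "a \<in> A" "s \<in> A - {\<zero>}" "x = ?f a s" "a' \<in> A" "s' \<in> A - {\<zero>}" "y = ?f a' s'"
      unfolding frac_subfield_def by blast
    then have c: "a \<in> carrier R" "s \<in> carrier R - {\<zero>}" "a' \<in> carrier R" "s' \<in> carrier R - {\<zero>}"
      using AR by auto
    have ss: "s \<otimes> s' \<in> A - {\<zero>}"
      using *(2,5) c subringE(6)[OF assms] by (auto simp: integral_iff)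
    show "x \<otimes>\<^bsub>frac_field R\<^esub> y \<in> frac_subfield R A"
      unfolding *(3,6) F.frac_mult[OF c] by (rule memI[OF _ ss]) (use * subringE(6)[OF assms] in blast)
    show "x \<oplus>\<^bsub>frac_field R\<^esub> y \<in> frac_subfield R A"
      unfolding *(3,6) F.frac_add[OF c]
      by (rule memI[OF _ ss]) (use * subringE(6,7)[OF assms] in blast)
  next
    fix x assume "x \<in> frac_subfield R A"
    then obtain a s where *: "a \<in> A" "s \<in> A - {\<zero>}" "x = ?f a s"
      unfolding frac_subfield_def by blast
    then have c: "a \<in> carrier R" "s \<in> carrier R - {\<zero>}"
      using AR by auto
    have "?f (\<ominus> a) s \<oplus>\<^bsub>frac_field R\<^esub> ?f a s = ?f \<zero> (s \<otimes> s)"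
      using c by (subst F.frac_add) (simp_all add: l_minus l_neg)
    also have "\<dots> = \<zero>\<^bsub>frac_field R\<^esub>"
      using c by (subst frac_eq_zero_iff) (auto simp: integral_iff)
    finally have "\<ominus>\<^bsub>frac_field R\<^esub> x = ?f (\<ominus> a) s"
      unfolding *(3) using c by (intro L.minus_equality F.frac_closed) simp_all
    then show "\<ominus>\<^bsub>frac_field R\<^esub> x \<in> frac_subfield R A"
      using memI[of "\<ominus> a" s] * subringE(5)[OF assms] by simp
  next
    fix x assume x: "x \<in> frac_subfield R A - {\<zero>\<^bsub>frac_field R\<^esub>}"
    then obtain a s where *: "a \<in> A" "s \<in> A - {\<zero>}" "x = ?f a s"
      unfolding frac_subfield_def by blast
    then have c: "a \<in> carrier R" "s \<in> carrier R - {\<zero>}"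
      using AR by auto
    then have a: "a \<in> A - {\<zero>}" "a \<in> carrier R - {\<zero>}"
      using x *(1,3) frac_eq_zero_iff[OF c] by auto
    have "inv\<^bsub>frac_field R\<^esub> x = ?f s a"
      unfolding *(3) by (rule L.comm_inv_char[OF _ _ frac_mult_swap[OF a(2) c(2)]])
        (use a c in \<open>auto intro: F.frac_closed\<close>)
    then show "inv\<^bsub>frac_field R\<^esub> x \<in> frac_subfield R A"
      using memI[of s a] a(1) *(2) by simp
  qed
qed

text \<open>The denominators are cleared one at a time: if \<open>s\<close> serves the earlier terms
  and \<open>t\<close> the new one, then \<open>t s\<close> serves all of them, and it is nonzero in
  a domain.\<close>

lemma common_denominator:
  assumes A: "subring A R" and c: "\<And>i. c i \<in> frac_subfield R A"
  shows "\<exists>s\<in>A - {\<zero>}. \<forall>i<n::nat. \<exists>a\<in>A.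
    to_loc R (carrier R - {\<zero>}) s \<otimes>\<^bsub>frac_field R\<^esub> c i = to_loc R (carrier R - {\<zero>}) a"
proof (induction n)
  case 0
  show ?case using subringE(3)[OF A] by auto
next
  case (Suc n)
  interpret L: field "frac_field R" by (rule frac_field_field)
  let ?i = "to_loc R (carrier R - {\<zero>})"
  have AR: "A \<subseteq> carrier R" using subringE(1)[OF A] .
  have ic: "?i r \<in> carrier (frac_field R)" if "r \<in> A" for r
    using ring_hom_closed[OF F.to_loc_hom] that AR by blast
  have im: "?i (r \<otimes> t) = ?i r \<otimes>\<^bsub>frac_field R\<^esub> ?i t" if "r \<in> A" "t \<in> A" for r t
    using ring_hom_mult[OF F.to_loc_hom] that AR by blast
  have cc: "c i \<in> carrier (frac_field R)" for i
    using c subfieldE(3)[OF frac_subfield_subfield[OF A]] by blast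
  from Suc obtain s where s: "s \<in> A - {\<zero>}"
    and IH: "\<And>i. i < n \<Longrightarrow> \<exists>a\<in>A. ?i s \<otimes>\<^bsub>frac_field R\<^esub> c i = ?i a" by blast
  obtain a t where at: "a \<in> A" "t \<in> A - {\<zero>}" "c n = frac R (carrier R - {\<zero>}) a t"
    using c[of n] unfolding frac_subfield_def by blast
  have *: "s \<in> A" "t \<in> A" using s at by auto
  have num: "?i t \<otimes>\<^bsub>frac_field R\<^esub> c n = ?i a"
  proof -
    have c: "a \<in> carrier R" "t \<in> carrier R - {\<zero>}" using at(1,2) AR by auto
    have "?i t \<otimes>\<^bsub>frac_field R\<^esub> c n = frac R (carrier R - {\<zero>}) (t \<otimes> a) t"
      unfolding at(3) to_loc_def using c by (simp add: F.frac_mult)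
    also have "\<dots> = ?i a"
      unfolding to_loc_def by (rule F.frac_eqI) (use c in \<open>simp_all add: m_comm\<close>)
    finally show ?thesis .
  qed
  show ?case
  proof (rule bexI[of _ "t \<otimes> s"], intro allI impI)
    show "t \<otimes> s \<in> A - {\<zero>}"
      using s at(2) AR subringE(6)[OF A *(2,1)] integral_iff[of t s] by auto
    fix i assume "i < Suc n"
    then consider "i < n" | "i = n" by linarith
    then show "\<exists>a\<in>A. ?i (t \<otimes> s) \<otimes>\<^bsub>frac_field R\<^esub> c i = ?i a"
    proof cases
      case 1
      then obtain d where d: "d \<in> A" "?i s \<otimes>\<^bsub>frac_field R\<^esub> c i = ?i d" using IH by blast
      have "?i (t \<otimes> s) \<otimes>\<^bsub>frac_field R\<^esub> c i = ?i t \<otimes>\<^bsub>frac_field R\<^esub> (?i s \<otimes>\<^bsub>frac_field R\<^esub> c i)"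
        using im[OF *(2,1)] ic[OF *(1)] ic[OF *(2)] cc by (simp add: L.m_assoc)
      then show ?thesis
        using d im[OF *(2) d(1)] subringE(6)[OF A *(2) d(1)] by auto
    next
      case 2
      have "?i (t \<otimes> s) \<otimes>\<^bsub>frac_field R\<^esub> c i = ?i s \<otimes>\<^bsub>frac_field R\<^esub> (?i t \<otimes>\<^bsub>frac_field R\<^esub> c n)"
        unfolding 2 using im[OF *(2,1)] ic[OF *(1)] ic[OF *(2)] cc by (simp add: L.m_ac)
      then show ?thesis
        using num im[OF *(1) at(1)] subringE(6)[OF A *(1) at(1)] by auto
    qed
  qed
qed

text \<open>\<open>c\<close> is the minimal polynomial times a common denominator \<open>s\<close>.
  Since the minimal polynomial is monic, the leading coefficient of \<open>c\<close> is
  \<open>s\<close> itself. The last clause is what remains of minimality over the subring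
  \<open>A\<close>, where division with remainder is lost: a bound on degrees, which is just what
  pseudo-division uses.\<close>

lemma separable_polynomial:
  assumes A: "subring A R" and b: "b \<in> carrier R"
    and sep: "separably_algebraic (frac_field R) (frac_subfield R A) (to_loc R (carrier R - {\<zero>}) b)"
  obtains c n where "\<And>i. c i \<in> A" "c n \<noteq> \<zero>" "psum R c b (Suc n) = \<zero>" "pderiv_sum R c b n \<noteq> \<zero>"
    "\<And>d m. (\<And>i. d i \<in> A) \<Longrightarrow> d m \<noteq> \<zero> \<Longrightarrow> psum R d b (Suc m) = \<zero> \<Longrightarrow> n \<le> m"
proof -
  define L where "L = frac_field R"
  define K where "K = frac_subfield R A"
  define \<iota> where "\<iota> = to_loc R (carrier R - {\<zero>})"
  define x where "x = \<iota> b"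
  interpret L: field L unfolding L_def by (rule frac_field_field)
  have \<iota>: "\<iota> \<in> ring_hom R L" unfolding \<iota>_def L_def by (rule F.to_loc_hom)
  interpret i: ring_hom_cring R L \<iota>
    by (rule UnivPoly.ring_hom_cringI[OF is_cring L.is_cring \<iota>])
  have inj: "r = \<zero>" if "\<iota> r = \<zero>\<^bsub>L\<^esub>" "r \<in> carrier R" for r
    using that frac_eq_zero_iff[of r \<one>] unfolding \<iota>_def to_loc_def L_def by simp
  have K: "subfield K L" unfolding K_def L_def by (rule frac_subfield_subfield[OF A])
  have Ksub: "subring K L" by (rule subfieldE(1)[OF K])
  have KL: "K \<subseteq> carrier L" by (rule subringE(1)[OF Ksub])
  have AR: "a \<in> carrier R" if "a \<in> A" for a using subringE(1)[OF A] that by blast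
  have AK: "\<iota> a \<in> K" if "a \<in> A" for a
    unfolding \<iota>_def to_loc_def K_def frac_subfield_def
    by (intro CollectI exI[of _ a] exI[of _ \<one>]) (use that subringE(3)[OF A] in simp)
  have x: "x \<in> carrier L" unfolding x_def using b by simp
  have alg: "(L.algebraic over K) x" and sepp: "separable_poly L K (L.Irr K x)"
    using sep unfolding separably_algebraic_def L_def K_def x_def \<iota>_def by auto
  define p where "p = L.Irr K x"
  define n where "n = length p - 1"
  note Irr = L.IrrE[OF K x alg, folded p_def]
  interpret KX: domain "K[X]\<^bsub>L\<^esub>" by (rule L.univ_poly_is_domain[OF Ksub])
  have "p \<noteq> []"
    using KX.ring_irreducibleE(1)[OF Irr(1,2)] by (simp add: univ_poly_zero)
  then have len: "length p = Suc n" unfolding n_def by (cases p) simp_all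
  define q where "q = L.coeff p"
  have setp: "set p \<subseteq> K" using Irr(1) L.polynomial_incl univ_poly_carrier by blast
  have qK: "q i \<in> K" for i
  proof -
    have "q i \<in> set p \<union> {\<zero>\<^bsub>L\<^esub>}" unfolding q_def L.coeff_img(3)[symmetric] by simp
    then show ?thesis using setp subringE(2)[OF Ksub] by (elim UnE) auto
  qed
  then have qL: "q i \<in> carrier L" for i using KL by blast
  have "p = map q (rev [0..<Suc n])" using L.coeff_list[of p] len unfolding q_def by simp
  then have pq: "psum L q x (Suc n) = \<zero>\<^bsub>L\<^esub>"
    using L.eval_map_rev_upt[of q x "Suc n", OF qL x] Irr(4) by simp
  obtain s where s: "s \<in> A - {\<zero>}" and "\<forall>i<Suc n. \<exists>a\<in>A. \<iota> s \<otimes>\<^bsub>L\<^esub> q i = \<iota> a"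
    using common_denominator[OF A, of q "Suc n"] qK unfolding K_def L_def \<iota>_def by blast
  then obtain a where a: "\<And>i. i < Suc n \<Longrightarrow> a i \<in> A \<and> \<iota> s \<otimes>\<^bsub>L\<^esub> q i = \<iota> (a i)" by metis
  \<comment> \<open>\<open>a\<close> is specified only up to index \<open>n\<close>. The default
    zero keeps all values in \<open>A\<close> and agrees with the vanishing coefficients of
    \<open>p\<close> beyond its degree.\<close>
  define c where "c i = (if i < Suc n then a i else \<zero>)" for i
  have cA: "c i \<in> A" for i using a subringE(2)[OF A] by (simp add: c_def)
  have sR: "s \<in> carrier R" "\<iota> s \<noteq> \<zero>\<^bsub>L\<^esub>" using s AR inj by blast+
  have q0: "q i = \<zero>\<^bsub>L\<^esub>" if "\<not> i < Suc n" for i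
    using L.coeff_length[of p i] that len unfolding q_def by simp
  have \<iota>c: "\<iota> (c i) = \<iota> s \<otimes>\<^bsub>L\<^esub> q i" for i
    using a[of i] q0[of i] sR(1) by (cases "i < Suc n") (simp_all add: c_def)
  show thesis
  proof
    show "c i \<in> A" for i by (rule cA)
    have "q n = \<one>\<^bsub>L\<^esub>"
      using L.lead_coeff_simp[OF \<open>p \<noteq> []\<close>] Irr(3) unfolding q_def n_def by simp
    then have "\<iota> (c n) \<noteq> \<zero>\<^bsub>L\<^esub>" using \<iota>c[of n] sR by simp
    then show "c n \<noteq> \<zero>" by auto
    have "\<iota> (psum R c b (Suc n)) = psum L (\<lambda>i. \<iota> s \<otimes>\<^bsub>L\<^esub> q i) x (Suc n)"
      using i.psum_hom[of c b "Suc n", OF AR[OF cA] b] unfolding x_def[symmetric] \<iota>c .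
    also have "\<dots> = \<zero>\<^bsub>L\<^esub>"
      using L.psum_smult[of q x "\<iota> s" "Suc n", OF qL x] sR(1) unfolding pq by simp
    finally show "psum R c b (Suc n) = \<zero>"
      by (rule inj) (rule psum_closed[OF AR[OF cA] b])
    show "pderiv_sum R c b n \<noteq> \<zero>"
    proof
      \<comment> \<open>If the derivative vanished at \<open>b\<close> too, then \<open>p\<close>
        would divide its own derivative. As a common divisor of \<open>p\<close> and its derivative
        it would be a unit by separability, contrary to irreducibility.\<close>
      assume 0: "pderiv_sum R c b n = \<zero>"
      have "\<iota> s \<otimes>\<^bsub>L\<^esub> pderiv_sum L q x n = \<iota> (pderiv_sum R c b n)"
        using i.pderiv_sum_hom[of c b n, OF AR[OF cA] b] L.pderiv_sum_smult[of q x "\<iota> s" n, OF qL x] sR(1)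
        unfolding x_def[symmetric] \<iota>c by simp
      then have "pderiv_sum L q x n = \<zero>\<^bsub>L\<^esub>"
        unfolding 0 i.hom_zero using L.integral_iff[OF i.hom_closed[OF sR(1)] L.pderiv_sum_closed[of q x n, OF qL x]] sR(2) by blast
      \<comment> \<open>The coefficients of the derivative before normalisation. In positive
        characteristic the leading ones may vanish, so \<open>l\<close> need not be a polynomial in
        normal form; its value at \<open>x\<close> is the same.\<close>
      define l where "l = map (\<lambda>i. add_pow L (Suc i) (q (Suc i))) (rev [0..<n])"
      have lL: "add_pow L (Suc i) (q (Suc i)) \<in> carrier L" for i using qL by simp
      have "add_pow L k y \<in> K" if "y \<in> K" for k :: nat and y
        by (induction k) (use that subringE(2,7)[OF Ksub] in simp_all)
      then have setl: "set l \<subseteq> K" using qK by (auto simp: l_def subringE(7)[OF Ksub])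
      have "[1..<length p] = map Suc [0..<n]" using len by (simp add: map_Suc_upt)
      then have "map (\<lambda>i. add_pow L i (L.coeff p i)) (rev [1..<length p]) = l"
        unfolding l_def q_def rev_map by (simp add: rev_map)
      then have der: "pderivative L p = L.normalize l"
        unfolding pderivative_def by simp
      have "L.eval (pderivative L p) x = L.eval l x"
        unfolding der by (rule L.eval_normalize) (use setl KL x in auto)
      also have "\<dots> = \<zero>\<^bsub>L\<^esub>"
        unfolding l_def L.eval_map_rev_upt[OF lL x] using \<open>pderiv_sum L q x n = \<zero>\<^bsub>L\<^esub>\<close> unfolding pderiv_sum_def .
      finally have ev: "L.eval (pderivative L p) x = \<zero>\<^bsub>L\<^esub>" .
      have car: "pderivative L p \<in> carrier (K[X]\<^bsub>L\<^esub>)"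
        unfolding der using L.normalize_gives_polynomial[OF setl] univ_poly_carrier by blast
      have "p pdivides\<^bsub>L\<^esub> pderivative L p"
        unfolding p_def by (rule L.Irr_minimal[OF K x alg car[unfolded p_def] ev[unfolded p_def]])
      then have "p divides\<^bsub>K[X]\<^bsub>L\<^esub>\<^esub> pderivative L p"
        using L.pdivides_iff_shell[OF K Irr(1) car] by blast
      moreover have "p divides\<^bsub>K[X]\<^bsub>L\<^esub>\<^esub> p" by (rule KX.divides_refl[OF Irr(1)])
      ultimately have "p \<in> Units (K[X]\<^bsub>L\<^esub>)"
        using sepp Irr(1) unfolding separable_poly_def p_def[symmetric] by blast
      then show False using KX.ring_irreducibleE(4)[OF Irr(1,2)] by blast
    qed
  next
    fix d m assume d: "\<And>i. d i \<in> A" and dm: "d m \<noteq> \<zero>" and root: "psum R d b (Suc m) = \<zero>"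
    \<comment> \<open>Because \<open>d m\<close> is nonzero, this list is a polynomial of degree
      exactly \<open>m\<close>. It vanishes at \<open>x\<close>, so \<open>p\<close> divides it and
      degrees can be compared.\<close>
    define l where "l = map (\<lambda>i. \<iota> (d i)) (rev [0..<Suc m])"
    have dL: "\<iota> (d i) \<in> carrier L" for i using AR[OF d] by simp
    have "L.eval l x = psum L (\<lambda>i. \<iota> (d i)) x (Suc m)"
      unfolding l_def by (rule L.eval_map_rev_upt[OF dL x])
    also have "\<dots> = \<zero>\<^bsub>L\<^esub>"
      using i.psum_hom[of d b "Suc m", OF AR[OF d] b] unfolding x_def root by simp
    finally have ev: "L.eval l x = \<zero>\<^bsub>L\<^esub>" .
    have "polynomial\<^bsub>L\<^esub> K l"
      unfolding polynomial_def l_def using AK[OF d] inj[OF _ AR[OF d]] dm by auto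
    then have car: "l \<in> carrier (K[X]\<^bsub>L\<^esub>)" using univ_poly_carrier by blast
    have "p pdivides\<^bsub>L\<^esub> l"
      unfolding p_def by (rule L.Irr_minimal[OF K x alg car ev])
    moreover have "l \<noteq> []" by (simp add: l_def)
    ultimately have "length p - 1 \<le> length l - 1"
      using L.pdivides_imp_degree_le[OF Ksub Irr(1) car] by blast
    then show "n \<le> m" by (simp add: n_def l_def)
  qed
qed

text \<open>Pseudo-division: the polynomial \<open>c\<close> is not monic, so \<open>d\<close> is multiplied by its leading
  coefficient before a multiple of \<open>c\<close> is subtracted; that coefficient can be cancelled in \<open>S\<close>.\<close>

lemma psum_root_transfer:
  assumes A: "subring A R" and b: "b \<in> carrier R"
    and c: "\<And>i. c i \<in> A" and root: "psum R c b (Suc n) = \<zero>"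
    and min: "\<And>d m. (\<And>i. d i \<in> A) \<Longrightarrow> d m \<noteq> \<zero> \<Longrightarrow> psum R d b (Suc m) = \<zero> \<Longrightarrow> n \<le> m"
    and S: "cring S" and h: "h \<in> ring_hom (R\<lparr>carrier := A\<rparr>) S" and s: "s \<in> carrier S"
    and u: "h (c n) \<in> Units S" and root': "psum S (\<lambda>i. h (c i)) s (Suc n) = \<zero>\<^bsub>S\<^esub>"
    and d: "\<And>i. d i \<in> A" and 0: "psum R d b m = \<zero>"
  shows "psum S (\<lambda>i. h (d i)) s m = \<zero>\<^bsub>S\<^esub>"
  using d 0
proof (induction m arbitrary: d)
  case 0
  then show ?case by simp
next
  case (Suc k)
  interpret S: cring S by fact
  note AE = subringE[OF A]
  have AR: "a \<in> carrier R" if "a \<in> A" for a using AE(1) that by blast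
  have hc: "h a \<in> carrier S" if "a \<in> A" for a using ring_hom_closed[OF h] that by simp
  have hm: "h (a \<otimes> a') = h a \<otimes>\<^bsub>S\<^esub> h a'" "h (a \<oplus> a') = h a \<oplus>\<^bsub>S\<^esub> h a'" if "a \<in> A" "a' \<in> A" for a a'
    using ring_hom_mult[OF h] ring_hom_add[OF h] that by simp_all
  have h0: "h \<zero> = \<zero>\<^bsub>S\<^esub>"
    using hm(2)[OF AE(2,2)] hc[OF AE(2)] S.add.l_cancel_one'[of "h \<zero>" "h \<zero>"] by simp
  show ?case
  proof (cases "d k = \<zero>")
    case True
    then have "psum R d b k = \<zero>" using Suc.prems AR b by simp
    then have "psum S (\<lambda>i. h (d i)) s k = \<zero>\<^bsub>S\<^esub>" using Suc.IH Suc.prems(1) by blast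
    then show ?thesis using True h0 s by simp
  next
    case False
    \<comment> \<open>A relation with nonzero top coefficient \<open>d k\<close> has
      \<open>k\<close> at least \<open>n\<close>. Hence the leading term of \<open>c\<close> can be
      moved up to degree \<open>k\<close>, and the subtraction \<open>k - n\<close> of naturals is a
      true one.\<close>
    then have nk: "n \<le> k" using min[of d k] Suc.prems by blast
    define e where "e i = (if i < k - n then \<zero> else c (i - (k - n)))" for i
    have eA: "e i \<in> A" for i using c AE(2) by (simp add: e_def)
    define f where "f i = c n \<otimes> d i \<oplus> (\<ominus> d k) \<otimes> e i" for i
    have dk: "\<ominus> d k \<in> A" using AE(5) Suc.prems(1) by blast
    have fA: "f i \<in> A" for i unfolding f_def by (intro AE(6,7) c dk eA Suc.prems(1))
    have Suc_k: "Suc k = (k - n) + Suc n" using nk by simp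
    have "\<not> k < k - n" "k - (k - n) = n" using nk by linarith+
    then have "e k = c n" by (simp add: e_def)
    then have fk: "f k = \<zero>"
      unfolding f_def using AR[OF c] AR[OF Suc.prems(1)] by (simp add: l_minus r_minus m_comm r_neg)
    have "psum R e b (Suc k) = b [^] (k - n) \<otimes> psum R c b (Suc n)"
      unfolding Suc_k e_def by (rule psum_shift[OF AR[OF c] b])
    then have "psum R e b (Suc k) = b [^] (k - n) \<otimes> \<zero>"
      unfolding root .
    then have "psum R f b (Suc k) = \<zero>"
      unfolding f_def psum_lincomb[OF AR[OF Suc.prems(1)] AR[OF eA] b AR[OF c] AR[OF dk]] Suc.prems(2)
      using AR[OF c] AR[OF dk] b by simp
    then have "psum R f b k = \<zero>" using fk AR[OF fA] b by simp
    then have fS: "psum S (\<lambda>i. h (f i)) s (Suc k) = \<zero>\<^bsub>S\<^esub>"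
      using Suc.IH[of f] fA fk h0 s by simp
    have he: "h (e i) = (if i < k - n then \<zero>\<^bsub>S\<^esub> else h (c (i - (k - n))))" for i
      by (simp add: e_def h0)
    have "psum S (\<lambda>i. h (e i)) s (Suc k) = s [^]\<^bsub>S\<^esub> (k - n) \<otimes>\<^bsub>S\<^esub> psum S (\<lambda>i. h (c i)) s (Suc n)"
      unfolding Suc_k he by (rule S.psum_shift[OF hc[OF c] s])
    then have e0: "psum S (\<lambda>i. h (e i)) s (Suc k) = \<zero>\<^bsub>S\<^esub>" unfolding root' using s by simp
    have hf: "h (f i) = h (c n) \<otimes>\<^bsub>S\<^esub> h (d i) \<oplus>\<^bsub>S\<^esub> h (\<ominus> d k) \<otimes>\<^bsub>S\<^esub> h (e i)" for i
      unfolding f_def using hm AE(6) c dk eA Suc.prems(1) by simp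
    \<comment> \<open>The shifted copy of \<open>c\<close> vanishes at \<open>s\<close> as well,
      since \<open>s\<close> is a root. Only the multiple of \<open>d\<close> is left, and the unit
      \<open>h (c n)\<close> can be removed from it.\<close>
    have "h (c n) \<otimes>\<^bsub>S\<^esub> psum S (\<lambda>i. h (d i)) s (Suc k) = \<zero>\<^bsub>S\<^esub>"
      using fS unfolding hf S.psum_lincomb[OF hc[OF Suc.prems(1)] hc[OF eA] s hc[OF c] hc[OF dk]] e0
      using hc[OF dk] hc[OF c] S.psum_closed[of "\<lambda>i. h (d i)" s "Suc k", OF hc[OF Suc.prems(1)] s]
      by (simp del: psum.simps)
    then have "h (c n) \<otimes>\<^bsub>S\<^esub> psum S (\<lambda>i. h (d i)) s (Suc k) = h (c n) \<otimes>\<^bsub>S\<^esub> \<zero>\<^bsub>S\<^esub>"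
      using hc[OF c] by (simp del: psum.simps)
    then show ?thesis
      using S.Units_l_cancel[OF u] S.psum_closed[of "\<lambda>i. h (d i)" s "Suc k", OF hc[OF Suc.prems(1)] s]
      by (simp del: psum.simps)
  qed
qed

section \<open>Homomorphisms out of \<open>A[b]\<close>\<close>

lemma simple_extension_psum:
  assumes A: "subring A R" and b: "b \<in> carrier R" and y: "y \<in> simple_extension A b"
  obtains d m where "\<And>i. d i \<in> A" "y = psum R d b m"
proof -
  have AR: "a \<in> carrier R" if "a \<in> A" for a using subringE(1)[OF A] that by blast
  have "\<exists>d m. (\<forall>i. d i \<in> A) \<and> y = psum R d b m"
    using y
  proof induction
    case zero
    have "\<zero> = psum R (\<lambda>_. \<zero>) b 0" by simp
    then show ?case using subringE(2)[OF A] by (intro exI[of _ "\<lambda>_. \<zero>"] exI[of _ 0]) simp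
  next
    case (lin k1 k2)
    then obtain d m where d: "\<And>i. d i \<in> A" "k1 = psum R d b m" by blast
    have "k1 \<otimes> b \<oplus> k2 = psum R (\<lambda>i. if i = 0 then k2 else d (i - 1)) b (Suc m)"
      unfolding d(2) by (rule psum_Cons[symmetric]) (use AR d(1) lin b in auto)
    moreover have "\<forall>i. (if i = 0 then k2 else d (i - 1)) \<in> A" using d(1) lin by simp
    ultimately show ?case by (intro exI[of _ "\<lambda>i. if i = 0 then k2 else d (i - 1)"] exI[of _ "Suc m"]) simp
  qed
  then show thesis using that by blast
qed

text \<open>An element of \<open>A[b]\<close> is the value at \<open>b\<close> of many polynomials
  over \<open>A\<close>, and its image is the value at \<open>s\<close> of the transported
  polynomial. By \<open>psum_root_transfer\<close> every relation satisfied by \<open>b\<close> is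
  satisfied by \<open>s\<close>, which makes the image independent of the polynomial chosen.\<close>

lemma simple_extension_universal:
  assumes A: "subring A R" and b: "b \<in> carrier R"
    and c: "\<And>i. c i \<in> A" and root: "psum R c b (Suc n) = \<zero>"
    and min: "\<And>d m. (\<And>i. d i \<in> A) \<Longrightarrow> d m \<noteq> \<zero> \<Longrightarrow> psum R d b (Suc m) = \<zero> \<Longrightarrow> n \<le> m"
    and S: "cring S" and h: "h \<in> ring_hom (R\<lparr>carrier := A\<rparr>) S" and s: "s \<in> carrier S"
    and u: "h (c n) \<in> Units S" and root': "psum S (\<lambda>i. h (c i)) s (Suc n) = \<zero>\<^bsub>S\<^esub>"
  obtains g where "g \<in> ring_hom (R\<lparr>carrier := simple_extension A b\<rparr>) S"
    "\<And>a. a \<in> A \<Longrightarrow> g a = h a" "g b = s"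
proof -
  interpret S: cring S by fact
  let ?E = "simple_extension A b"
  note AE = subringE[OF A]
  note EE = subringE[OF simple_extension_is_subring[OF A b]]
  have AR: "a \<in> carrier R" if "a \<in> A" for a using AE(1) that by blast
  have ER: "y \<in> carrier R" if "y \<in> ?E" for y using EE(1) that by blast
  have hc: "h a \<in> carrier S" if "a \<in> A" for a using ring_hom_closed[OF h] that by simp
  have hm: "h (a \<otimes> a') = h a \<otimes>\<^bsub>S\<^esub> h a'" "h (a \<oplus> a') = h a \<oplus>\<^bsub>S\<^esub> h a'" if "a \<in> A" "a' \<in> A" for a a'
    using ring_hom_mult[OF h] ring_hom_add[OF h] that by simp_all
  have h1: "h \<one> = \<one>\<^bsub>S\<^esub>" using ring_hom_one[OF h] by simp
  have h0: "h \<zero> = \<zero>\<^bsub>S\<^esub>"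
    using hm(2)[OF AE(2,2)] hc[OF AE(2)] S.add.l_cancel_one'[of "h \<zero>" "h \<zero>"] by simp
  let ?P = "\<lambda>d m. psum S (\<lambda>i. h (d i)) s m"
  have Pc: "?P d m \<in> carrier S" if "\<And>i. d i \<in> A" for d m
    by (rule S.psum_closed[OF hc[OF that] s])
  have pad: "psum R (\<lambda>i. if i < m then d i else \<zero>) b (m + k) = psum R d b m"
    "?P (\<lambda>i. if i < m then d i else \<zero>) (m + k) = ?P d m" if "\<And>i. d i \<in> A" for d m k
  proof -
    show "psum R (\<lambda>i. if i < m then d i else \<zero>) b (m + k) = psum R d b m"
      by (rule psum_pad[OF AR[OF that] b])
    have "(\<lambda>i. h (if i < m then d i else \<zero>)) = (\<lambda>i. if i < m then h (d i) else \<zero>\<^bsub>S\<^esub>)"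
      by (auto simp: h0)
    then show "?P (\<lambda>i. if i < m then d i else \<zero>) (m + k) = ?P d m"
      using S.psum_pad[of "\<lambda>i. h (d i)" s m k, OF hc[OF that] s] by simp
  qed
  have same_length: "\<exists>d d' N. (\<forall>i. d i \<in> A) \<and> (\<forall>i. d' i \<in> A) \<and> psum R e b m = psum R d b N \<and> ?P e m = ?P d N
      \<and> psum R e' b m' = psum R d' b N \<and> ?P e' m' = ?P d' N"
    if e: "\<And>i. e i \<in> A" and e': "\<And>i. e' i \<in> A" for e e' m m'
  proof (intro exI conjI allI)
    let ?d = "\<lambda>i. if i < m then e i else \<zero>" and ?d' = "\<lambda>i. if i < m' then e' i else \<zero>"
    show "?d i \<in> A" "?d' i \<in> A" for i using e e' AE(2) by simp_all
    show "psum R e b m = psum R ?d b (m + m')" "?P e m = ?P ?d (m + m')"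
      "psum R e' b m' = psum R ?d' b (m + m')" "?P e' m' = ?P ?d' (m + m')"
      using pad[of e m m', OF e] pad[of e' m' m, OF e'] by (simp_all add: add.commute)
  qed
  \<comment> \<open>Two expressions for the same element differ by a relation of \<open>b\<close>.
    The difference is written as a combination with coefficients 1 and -1, so that
    \<open>psum_lincomb\<close> applies both in the domain and in \<open>S\<close>.\<close>
  have wd: "?P e m = ?P e' m'"
    if e: "\<And>i. e i \<in> A" and e': "\<And>i. e' i \<in> A" and eq: "psum R e b m = psum R e' b m'" for e e' m m'
  proof -
    obtain d d' N where d: "\<And>i. d i \<in> A" and d': "\<And>i. d' i \<in> A"
      and *: "psum R e b m = psum R d b N" "?P e m = ?P d N" "psum R e' b m' = psum R d' b N" "?P e' m' = ?P d' N"
      using same_length[of e e' m m', OF e e'] by blast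
    define f where "f i = \<one> \<otimes> d i \<oplus> (\<ominus> \<one>) \<otimes> d' i" for i
    have m1: "\<ominus> \<one> \<in> A" using AE(3,5) by blast
    have fA: "f i \<in> A" for i unfolding f_def by (intro AE(3,6,7) d d' m1)
    have "psum R f b N = \<zero>"
      unfolding f_def psum_lincomb[OF AR[OF d] AR[OF d'] b AR[OF AE(3)] AR[OF m1]]
      using eq * psum_closed[of d' b N, OF AR[OF d'] b] by (simp add: l_minus r_neg)
    then have "?P f N = \<zero>\<^bsub>S\<^esub>"
      by (intro psum_root_transfer[OF A b c root min S h s u root' fA])
    moreover have "h (\<ominus> \<one>) = \<ominus>\<^bsub>S\<^esub> \<one>\<^bsub>S\<^esub>"
    proof -
      have "h (\<ominus> \<one>) \<oplus>\<^bsub>S\<^esub> \<one>\<^bsub>S\<^esub> = \<zero>\<^bsub>S\<^esub>"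
        using hm(2)[OF m1 AE(3)] h0 h1 by (simp add: l_neg)
      then show ?thesis using S.minus_equality hc[OF m1] by simp
    qed
    then have "h (f i) = \<one>\<^bsub>S\<^esub> \<otimes>\<^bsub>S\<^esub> h (d i) \<oplus>\<^bsub>S\<^esub> (\<ominus>\<^bsub>S\<^esub> \<one>\<^bsub>S\<^esub>) \<otimes>\<^bsub>S\<^esub> h (d' i)" for i
      unfolding f_def using hm AE(3,6) d d' m1 h1 by simp
    then have "?P f N = \<one>\<^bsub>S\<^esub> \<otimes>\<^bsub>S\<^esub> ?P d N \<oplus>\<^bsub>S\<^esub> (\<ominus>\<^bsub>S\<^esub> \<one>\<^bsub>S\<^esub>) \<otimes>\<^bsub>S\<^esub> ?P d' N"
      using S.psum_lincomb[of "\<lambda>i. h (d i)" "\<lambda>i. h (d' i)" s "\<one>\<^bsub>S\<^esub>" "\<ominus>\<^bsub>S\<^esub> \<one>\<^bsub>S\<^esub>" N, OF hc[OF d] hc[OF d'] s] by simp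
    ultimately have "?P d N \<ominus>\<^bsub>S\<^esub> ?P d' N = \<zero>\<^bsub>S\<^esub>"
      using Pc[of d, OF d] Pc[of d', OF d'] by (simp add: S.l_minus a_minus_def)
    then have "?P d N = ?P d' N"
      using S.r_right_minus_eq[OF Pc[of d, OF d] Pc[of d', OF d']] by blast
    then show ?thesis using * by simp
  qed
  define g where "g y = (SOME z. \<exists>d m. (\<forall>i. d i \<in> A) \<and> y = psum R d b m \<and> z = ?P d m)" for y
  have g: "g (psum R d b m) = ?P d m" if d: "\<And>i. d i \<in> A" for d m
  proof -
    have "\<exists>d' m'. (\<forall>i. d' i \<in> A) \<and> psum R d b m = psum R d' b m' \<and> g (psum R d b m) = ?P d' m'"
      unfolding g_def by (rule someI_ex) (use d in blast)
    then obtain d' m' where d': "\<And>i. d' i \<in> A" "psum R d b m = psum R d' b m'" "g (psum R d b m) = ?P d' m'"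
      by blast
    show ?thesis unfolding d'(3) by (rule wd[OF d d'(1) d'(2), symmetric])
  qed
  have gc: "g y \<in> carrier S" if y: "y \<in> ?E" for y
  proof -
    obtain d m where d: "\<And>i. d i \<in> A" "y = psum R d b m" using simple_extension_psum[OF A b y] by blast
    show ?thesis unfolding d(2) g[of d, OF d(1)] by (rule Pc[of d, OF d(1)])
  qed
  \<comment> \<open>Compatibility with one Horner step. Taking \<open>y = 0\<close> or
    \<open>a = 0\<close> gives the values on \<open>A\<close> and multiplication by
    \<open>b\<close>.\<close>
  have glin: "g (y \<otimes> b \<oplus> a) = g y \<otimes>\<^bsub>S\<^esub> s \<oplus>\<^bsub>S\<^esub> h a" if y: "y \<in> ?E" and a: "a \<in> A" for y a
  proof -
    obtain d m where d: "\<And>i. d i \<in> A" "y = psum R d b m" using simple_extension_psum[OF A b y] by blast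
    let ?d = "\<lambda>i. if i = 0 then a else d (i - 1)"
    have dA: "?d i \<in> A" for i using d a by simp
    have "g (y \<otimes> b \<oplus> a) = ?P ?d (Suc m)"
      unfolding d(2) psum_Cons[of d, OF AR[OF d(1)] b AR[OF a], symmetric] by (rule g[of ?d, OF dA])
    also have "(\<lambda>i. h (?d i)) = (\<lambda>i. if i = 0 then h a else h (d (i - 1)))" by auto
    also have "psum S \<dots> s (Suc m) = ?P d m \<otimes>\<^bsub>S\<^esub> s \<oplus>\<^bsub>S\<^esub> h a"
      by (rule S.psum_Cons[OF hc[OF d(1)] s hc[OF a]])
    also have "?P d m = g y" unfolding d(2) by (rule g[of d, OF d(1), symmetric])
    finally show ?thesis .
  qed
  have g0: "g \<zero> = \<zero>\<^bsub>S\<^esub>" using g[of "\<lambda>_. \<zero>" 0] AE(2) by simp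
  have ga: "g a = h a" if "a \<in> A" for a
    using glin[OF EE(2) that] AR[OF that] hc[OF that] b s by (simp add: g0)
  have gmulb: "g (y \<otimes> b) = g y \<otimes>\<^bsub>S\<^esub> s" if "y \<in> ?E" for y
    using glin[OF that AE(2)] ER[OF that] gc[OF that] b s by (simp add: h0)
  have gb: "g b = s"
    using gmulb[OF EE(3)] ga[OF AE(3)] b s by (simp add: h1)
  have gadd: "g (y \<oplus> z) = g y \<oplus>\<^bsub>S\<^esub> g z" if y: "y \<in> ?E" and z: "z \<in> ?E" for y z
  proof -
    obtain e m where e: "\<And>i. e i \<in> A" "y = psum R e b m" using simple_extension_psum[OF A b y] by blast
    obtain e' m' where e': "\<And>i. e' i \<in> A" "z = psum R e' b m'" using simple_extension_psum[OF A b z] by blast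
    obtain d d' N where d: "\<And>i. d i \<in> A" and d': "\<And>i. d' i \<in> A"
      and *: "y = psum R d b N" "z = psum R d' b N"
      using same_length[of e e' m m', OF e(1) e'(1)] unfolding e(2) e'(2) by blast
    let ?f = "\<lambda>i. \<one> \<otimes> d i \<oplus> \<one> \<otimes> d' i"
    have fA: "?f i \<in> A" for i by (intro AE(3,6,7) d d')
    have "y \<oplus> z = psum R ?f b N"
      unfolding * psum_lincomb[OF AR[OF d] AR[OF d'] b one_closed one_closed]
      using psum_closed[of d b N, OF AR[OF d] b] psum_closed[of d' b N, OF AR[OF d'] b] by simp
    then have "g (y \<oplus> z) = ?P ?f N" using g[of ?f, OF fA] by simp
    also have "(\<lambda>i. h (?f i)) = (\<lambda>i. \<one>\<^bsub>S\<^esub> \<otimes>\<^bsub>S\<^esub> h (d i) \<oplus>\<^bsub>S\<^esub> \<one>\<^bsub>S\<^esub> \<otimes>\<^bsub>S\<^esub> h (d' i))"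
      using hm AE(3,6) d d' h1 by simp
    also have "psum S \<dots> s N = ?P d N \<oplus>\<^bsub>S\<^esub> ?P d' N"
      unfolding S.psum_lincomb[OF hc[OF d] hc[OF d'] s S.one_closed S.one_closed]
      using Pc[of d, OF d] Pc[of d', OF d'] by simp
    finally show ?thesis unfolding * g[of d, OF d] g[of d', OF d'] .
  qed
  have gsmult: "g (a \<otimes> z) = h a \<otimes>\<^bsub>S\<^esub> g z" if a: "a \<in> A" and z: "z \<in> ?E" for a z
  proof -
    obtain d m where d: "\<And>i. d i \<in> A" "z = psum R d b m" using simple_extension_psum[OF A b z] by blast
    have dA: "a \<otimes> d i \<in> A" for i by (intro AE(6) a d(1))
    have "g (a \<otimes> z) = ?P (\<lambda>i. a \<otimes> d i) m"
      unfolding d(2) psum_smult[of d, OF AR[OF d(1)] b AR[OF a], symmetric] by (rule g[of "\<lambda>i. a \<otimes> d i", OF dA])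
    also have "(\<lambda>i. h (a \<otimes> d i)) = (\<lambda>i. h a \<otimes>\<^bsub>S\<^esub> h (d i))" using hm a d(1) by simp
    also have "psum S \<dots> s m = h a \<otimes>\<^bsub>S\<^esub> ?P d m" by (rule S.psum_smult[OF hc[OF d(1)] s hc[OF a]])
    finally show ?thesis unfolding d(2) g[of d, OF d(1)] .
  qed
  \<comment> \<open>Products are not computed from coefficients. Induction on the Horner form of
    \<open>y\<close> reduces multiplicativity to factors \<open>b\<close> and factors from
    \<open>A\<close>, both already settled.\<close>
  have gmult: "g (y \<otimes> z) = g y \<otimes>\<^bsub>S\<^esub> g z" if y: "y \<in> ?E" and z: "z \<in> ?E" for y z
    using y
  proof induction
    case zero
    show ?case using ER[OF z] gc[OF z] by (simp add: g0)
  next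
    case (lin k1 k2)
    have k2E: "k2 \<in> ?E" using simple_extension_incl[OF AE(1) b] lin(2) by blast
    have bE: "b \<in> ?E" by (rule simple_extension_mem[OF A b])
    note E = lin(1) k2E z EE(6)[OF lin(1) z] EE(6)[OF k2E z]
    have "(k1 \<otimes> b \<oplus> k2) \<otimes> z = (k1 \<otimes> z) \<otimes> b \<oplus> k2 \<otimes> z"
      using ER[OF lin(1)] ER[OF k2E] ER[OF z] b by (simp add: l_distr r_distr m_ac)
    then have "g ((k1 \<otimes> b \<oplus> k2) \<otimes> z) = g k1 \<otimes>\<^bsub>S\<^esub> g z \<otimes>\<^bsub>S\<^esub> s \<oplus>\<^bsub>S\<^esub> h k2 \<otimes>\<^bsub>S\<^esub> g z"
      using gadd[OF EE(6)[OF E(4) bE] E(5)] gmulb[OF E(4)] gsmult[OF lin(2) z] lin(3) by simp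
    also have "\<dots> = (g k1 \<otimes>\<^bsub>S\<^esub> s \<oplus>\<^bsub>S\<^esub> h k2) \<otimes>\<^bsub>S\<^esub> g z"
      using gc[OF lin(1)] gc[OF z] hc[OF lin(2)] s by (simp add: S.l_distr S.r_distr S.m_ac)
    finally show ?case unfolding glin[OF lin(1,2)] .
  qed
  have "g \<in> ring_hom (R\<lparr>carrier := ?E\<rparr>) S"
    by (rule ring_hom_memI) (simp_all add: gc gmult gadd ga[OF AE(3)] h1)
  with ga gb show thesis using that by blast
qed

end

section \<open>Dual numbers and derivations\<close>

definition dual_numbers :: "('a, 'm) ring_scheme \<Rightarrow> ('a \<times> 'a) ring" where
  "dual_numbers R =
    \<lparr>carrier = carrier R \<times> carrier R,
     monoid.mult = (\<lambda>(a, x) (b, y). (a \<otimes>\<^bsub>R\<^esub> b, a \<otimes>\<^bsub>R\<^esub> y \<oplus>\<^bsub>R\<^esub> b \<otimes>\<^bsub>R\<^esub> x)),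
     one = (\<one>\<^bsub>R\<^esub>, \<zero>\<^bsub>R\<^esub>), ring.zero = (\<zero>\<^bsub>R\<^esub>, \<zero>\<^bsub>R\<^esub>),
     ring.add = (\<lambda>(a, x) (b, y). (a \<oplus>\<^bsub>R\<^esub> b, x \<oplus>\<^bsub>R\<^esub> y))\<rparr>"

lemma dual_numbers_simps [simp]:
  "carrier (dual_numbers R) = carrier R \<times> carrier R"
  "(a, x) \<otimes>\<^bsub>dual_numbers R\<^esub> (b, y) = (a \<otimes>\<^bsub>R\<^esub> b, a \<otimes>\<^bsub>R\<^esub> y \<oplus>\<^bsub>R\<^esub> b \<otimes>\<^bsub>R\<^esub> x)"
  "\<one>\<^bsub>dual_numbers R\<^esub> = (\<one>\<^bsub>R\<^esub>, \<zero>\<^bsub>R\<^esub>)" "\<zero>\<^bsub>dual_numbers R\<^esub> = (\<zero>\<^bsub>R\<^esub>, \<zero>\<^bsub>R\<^esub>)"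
  "(a, x) \<oplus>\<^bsub>dual_numbers R\<^esub> (b, y) = (a \<oplus>\<^bsub>R\<^esub> b, x \<oplus>\<^bsub>R\<^esub> y)"
  by (simp_all add: dual_numbers_def)

lemma dual_numbers_fst_snd:
  "fst (p \<otimes>\<^bsub>dual_numbers R\<^esub> q) = fst p \<otimes>\<^bsub>R\<^esub> fst q"
  "snd (p \<otimes>\<^bsub>dual_numbers R\<^esub> q) = fst p \<otimes>\<^bsub>R\<^esub> snd q \<oplus>\<^bsub>R\<^esub> fst q \<otimes>\<^bsub>R\<^esub> snd p"
  "fst (p \<oplus>\<^bsub>dual_numbers R\<^esub> q) = fst p \<oplus>\<^bsub>R\<^esub> fst q"
  "snd (p \<oplus>\<^bsub>dual_numbers R\<^esub> q) = snd p \<oplus>\<^bsub>R\<^esub> snd q"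
  by (cases p; cases q; simp)+

lemma cring_dual_numbers:
  assumes "cring R" shows "cring (dual_numbers R)"
proof -
  interpret cring R by fact
  show ?thesis
  proof (rule cringI)
    show "abelian_group (dual_numbers R)"
    proof (rule abelian_groupI)
      fix p assume "p \<in> carrier (dual_numbers R)"
      then show "\<exists>q\<in>carrier (dual_numbers R). q \<oplus>\<^bsub>dual_numbers R\<^esub> p = \<zero>\<^bsub>dual_numbers R\<^esub>"
        by (intro bexI[of _ "(\<ominus>\<^bsub>R\<^esub> fst p, \<ominus>\<^bsub>R\<^esub> snd p)"]) (auto simp: l_neg)
    qed (auto simp: a_ac)
    show "comm_monoid (dual_numbers R)"
      by (rule comm_monoidI) (auto simp: m_ac l_distr r_distr a_ac)
  qed (auto simp: l_distr r_distr a_ac)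
qed

lemma fst_dual_numbers_hom: "fst \<in> ring_hom (dual_numbers R) R"
  by (rule ring_hom_memI) (auto simp: dual_numbers_fst_snd)

text \<open>Since \<epsilon> squares to zero, the inverse of a + x\<epsilon> is 1/a -
  (x/a^2)\<epsilon>. Invertibility in the dual numbers can thus be tested modulo \<epsilon>.\<close>

lemma (in cring) dual_numbers_Units:
  assumes "p \<in> carrier (dual_numbers R)" "fst p \<in> Units R"
  shows "p \<in> Units (dual_numbers R)"
proof -
  interpret D: cring "dual_numbers R" by (rule cring_dual_numbers) (rule is_cring)
  obtain a x where p: "p = (a, x)" "a \<in> carrier R" "x \<in> carrier R" using assms(1) by auto
  have a: "inv a \<in> carrier R" "a \<otimes> inv a = \<one>" using assms(2) p(1) by simp_all
  let ?q = "(inv a, \<ominus> (inv a \<otimes> (inv a \<otimes> x)))"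
  have "a \<otimes> (inv a \<otimes> (inv a \<otimes> x)) = inv a \<otimes> x"
    using a p(2,3) by (simp add: m_assoc[symmetric])
  then have "p \<otimes>\<^bsub>dual_numbers R\<^esub> ?q = \<one>\<^bsub>dual_numbers R\<^esub>"
    using a p by (simp add: r_minus l_neg)
  moreover have q: "?q \<in> carrier (dual_numbers R)" using a p by simp
  ultimately show ?thesis
    using D.m_comm[OF assms(1) q] assms(1) unfolding Units_def by auto
qed

lemma derivation_imp_dual_hom:
  assumes P: "ring P" and Q: "cring Q" and h: "h \<in> ring_hom P Q" and d: "derivation P (along h Q) d"
  shows "(\<lambda>x. (h x, d x)) \<in> ring_hom P (dual_numbers Q)"
proof -
  interpret P: ring P by fact
  interpret Q: cring Q by fact
  have dc: "d x \<in> carrier Q" if "x \<in> carrier P" for x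
    using d that unfolding derivation_def by auto
  \<comment> \<open>Preservation of the unit is not part of the definition of a derivation. It comes
    from the Leibniz rule at 1 = 1 * 1, which reads d 1 = d 1 + d 1.\<close>
  have d1: "d (\<one>\<^bsub>P\<^esub> \<otimes>\<^bsub>P\<^esub> \<one>\<^bsub>P\<^esub>) = h \<one>\<^bsub>P\<^esub> \<otimes>\<^bsub>Q\<^esub> d \<one>\<^bsub>P\<^esub> \<oplus>\<^bsub>Q\<^esub> h \<one>\<^bsub>P\<^esub> \<otimes>\<^bsub>Q\<^esub> d \<one>\<^bsub>P\<^esub>"
    using d P.one_closed unfolding derivation_def along_simps by blast
  have "d \<one>\<^bsub>P\<^esub> = \<zero>\<^bsub>Q\<^esub>"
    using d1 dc[OF P.one_closed] Q.add.l_cancel_one'[of "d \<one>\<^bsub>P\<^esub>" "d \<one>\<^bsub>P\<^esub>"]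
    by (simp add: ring_hom_one[OF h])
  then show ?thesis
    using d unfolding derivation_def
    by (intro ring_hom_memI) (auto simp: ring_hom_closed[OF h] ring_hom_mult[OF h] ring_hom_add[OF h] ring_hom_one[OF h])
qed

lemma dual_hom_imp_derivation:
  assumes H: "H \<in> ring_hom P (dual_numbers Q)" and h: "\<And>x. x \<in> carrier P \<Longrightarrow> fst (H x) = h x"
  shows "derivation P (along h Q) (\<lambda>x. snd (H x))"
  unfolding derivation_def
  using ring_hom_closed[OF H] ring_hom_mult[OF H] ring_hom_add[OF H]
  by (auto simp: dual_numbers_fst_snd h mem_Times_iff)

section \<open>Taylor expansion and Newton step\<close>

text \<open>The binomial formula stops after the linear term. Stating it for exponent
  \<open>Suc i\<close> avoids a predecessor in the exponent of the derivative.\<close>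

lemma (in cring) power_add_square_zero:
  assumes x: "x \<in> carrier R" and e: "e \<in> carrier R" "e \<otimes> e = \<zero>"
  shows "(x \<oplus> e) [^] Suc i = x [^] Suc i \<oplus> add_pow R (Suc i) (x [^] i) \<otimes> e"
proof (induction i)
  case 0
  then show ?case using x e by simp
next
  case (Suc i)
  define y where "y = add_pow R (Suc i) (x [^] i)"
  have y: "y \<in> carrier R" "y \<otimes> x = add_pow R (Suc i) (x [^] Suc i)"
    unfolding y_def using x by (simp_all only: add.nat_pow_closed nat_pow_closed add_pow_ldistr nat_pow_Suc)
  have "(x \<oplus> e) [^] Suc (Suc i) = (x [^] Suc i \<oplus> y \<otimes> e) \<otimes> (x \<oplus> e)"
    using Suc unfolding y_def by simp
  also have "\<dots> = x [^] Suc i \<otimes> x \<oplus> (y \<otimes> x \<otimes> e \<oplus> x [^] Suc i \<otimes> e) \<oplus> y \<otimes> (e \<otimes> e)"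
    using x e(1) y(1) by (simp add: l_distr r_distr m_ac a_ac del: nat_pow_Suc)
  also have "\<dots> = x [^] Suc (Suc i) \<oplus> add_pow R (Suc (Suc i)) (x [^] Suc i) \<otimes> e"
    unfolding e(2) y(2) using x e(1) y(1) by (simp add: l_distr del: add.nat_pow_Suc) (simp add: l_distr)
  finally show ?case .
qed

text \<open>The first-order Taylor formula, exact because \<open>e\<close> squares to zero. It
  serves twice: with a known root it yields an equation for a derivation, and in
  \<open>newton_root\<close> it produces a root.\<close>

lemma (in cring) psum_add_square_zero:
  assumes c: "\<And>i. c i \<in> carrier R" and x: "x \<in> carrier R" and e: "e \<in> carrier R" "e \<otimes> e = \<zero>"
  shows "psum R c (x \<oplus> e) (Suc n) = psum R c x (Suc n) \<oplus> pderiv_sum R c x n \<otimes> e"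
proof (induction n)
  case 0
  then show ?case using c x e by (simp add: pderiv_sum_def)
next
  case (Suc n)
  let ?k = "c (Suc n)" and ?y = "x [^] n"
  have y: "add_pow R (Suc n) ?y \<in> carrier R" "add_pow R (Suc n) ?k \<in> carrier R"
    using x c by (simp_all only: add.nat_pow_closed nat_pow_closed)
  have "?k \<otimes> add_pow R (Suc n) ?y = add_pow R (Suc n) ?k \<otimes> ?y"
    using x c by (simp only: add_pow_rdistr add_pow_ldistr nat_pow_closed)
  then have *: "?k \<otimes> (add_pow R (Suc n) ?y \<otimes> e) = add_pow R (Suc n) ?k \<otimes> ?y \<otimes> e"
    using x c e(1) y by (simp only: m_assoc[symmetric])
  have "psum R c (x \<oplus> e) (Suc (Suc n)) = psum R c (x \<oplus> e) (Suc n) \<oplus> ?k \<otimes> (x \<oplus> e) [^] Suc n"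
    by simp
  also have "\<dots> = psum R c x (Suc n) \<oplus> pderiv_sum R c x n \<otimes> e \<oplus> ?k \<otimes> (x [^] Suc n \<oplus> add_pow R (Suc n) ?y \<otimes> e)"
    unfolding Suc power_add_square_zero[OF x e] ..
  also have "\<dots> = psum R c x (Suc n) \<oplus> pderiv_sum R c x n \<otimes> e \<oplus> (?k \<otimes> x [^] Suc n \<oplus> add_pow R (Suc n) ?k \<otimes> ?y \<otimes> e)"
    using r_distr[OF nat_pow_closed[OF x] m_closed[OF y(1) e(1)] c, of "Suc n" "Suc n"] unfolding * by simp
  also have "\<dots> = psum R c x (Suc (Suc n)) \<oplus> pderiv_sum R c x (Suc n) \<otimes> e"
  proof -
    have s: "psum R c x (Suc n) \<in> carrier R" "pderiv_sum R c x n \<in> carrier R" "?k \<otimes> x [^] Suc n \<in> carrier R"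
      "add_pow R (Suc n) ?k \<otimes> ?y \<in> carrier R"
      using c x y psum_closed[of c x "Suc n", OF c x] by (simp_all del: add.nat_pow_Suc psum.simps)
    have t: "psum R c x (Suc (Suc n)) = psum R c x (Suc n) \<oplus> ?k \<otimes> x [^] Suc n"
      "pderiv_sum R c x (Suc n) = pderiv_sum R c x n \<oplus> add_pow R (Suc n) ?k \<otimes> ?y"
      by (simp_all add: pderiv_sum_def)
    show ?thesis
      unfolding t l_distr[OF s(2,4) e(1)]
      using s e(1) by (simp only: a_ac a_closed m_closed)
  qed
  finally show ?case .
qed

text \<open>The correction is minus the value at \<open>x\<close> divided by the derivative there;
  it squares to zero because the value does. It is returned as a multiple of the value so that
  whatever kills the value at \<open>x\<close> also fixes \<open>x\<close> under the step. For dual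
  numbers this keeps the first component.\<close>

lemma (in cring) newton_root:
  assumes c: "\<And>i. c i \<in> carrier R" and x: "x \<in> carrier R"
    and v: "psum R c x (Suc n) \<otimes> psum R c x (Suc n) = \<zero>" and u: "pderiv_sum R c x n \<in> Units R"
  obtains w where "w \<in> carrier R" "psum R c (x \<oplus> psum R c x (Suc n) \<otimes> w) (Suc n) = \<zero>"
proof -
  define p where "p = psum R c x (Suc n)"
  define q where "q = pderiv_sum R c x n"
  have p: "p \<in> carrier R" "p \<otimes> p = \<zero>" unfolding p_def using psum_closed[of c x "Suc n", OF c x] v by simp_all
  have q: "q \<in> carrier R" "inv q \<in> carrier R" "q \<otimes> inv q = \<one>"
    using u unfolding q_def by (simp_all only: Units_closed Units_inv_closed Units_r_inv)
  define w where "w = \<ominus> (inv q)"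
  have w: "w \<in> carrier R" "q \<otimes> w = \<ominus> \<one>" unfolding w_def using q by (simp_all add: r_minus)
  have "(p \<otimes> w) \<otimes> (p \<otimes> w) = (p \<otimes> p) \<otimes> (w \<otimes> w)" using p(1) w(1) by (simp add: m_ac)
  then have e: "p \<otimes> w \<in> carrier R" "(p \<otimes> w) \<otimes> (p \<otimes> w) = \<zero>" using p w(1) by simp_all
  have "q \<otimes> (p \<otimes> w) = p \<otimes> (q \<otimes> w)" using p(1) q(1) w(1) by (simp add: m_ac)
  then have "p \<oplus> q \<otimes> (p \<otimes> w) = \<zero>" using p(1) w(2) by (simp add: r_minus r_neg)
  then have "psum R c (x \<oplus> p \<otimes> w) (Suc n) = \<zero>"
    unfolding psum_add_square_zero[OF c x e] p_def[symmetric] q_def[symmetric] .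
  with w(1) show thesis unfolding p_def by (rule that)
qed

lemma (in ring) psum_in_subring:
  assumes V: "subring V R" and "\<And>i. c i \<in> V" "x \<in> V"
  shows "psum R c x n \<in> V"
proof (induction n)
  case (Suc n)
  have "x [^] n \<in> V" for n :: nat
    by (induction n) (use assms subringE(3,6)[OF V] in simp_all)
  then show ?case using Suc assms(2) subringE(6,7)[OF V] by simp
qed (simp add: subringE(2)[OF V])

lemma psum_carrier_update [simp]: "psum (R\<lparr>carrier := C\<rparr>) c x n = psum R c x n"
  by (induction n) (simp_all add: nat_pow_def)

lemma add_pow_carrier_update [simp]: "add_pow (R\<lparr>carrier := C\<rparr>) (k::nat) x = add_pow R k x"
  by (simp add: add_pow_def nat_pow_def)

lemma pderiv_sum_carrier_update [simp]: "pderiv_sum (R\<lparr>carrier := C\<rparr>) c x n = pderiv_sum R c x n"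
  by (simp only: pderiv_sum_def add_pow_carrier_update psum_carrier_update)

lemma derivation_closed: "derivation P M d \<Longrightarrow> x \<in> carrier P \<Longrightarrow> d x \<in> carrier M"
  unfolding derivation_def by blast

lemma derivation_add: "derivation P M d \<Longrightarrow> x \<in> carrier P \<Longrightarrow> y \<in> carrier P \<Longrightarrow>
    d (x \<oplus>\<^bsub>P\<^esub> y) = d x \<oplus>\<^bsub>M\<^esub> d y"
  unfolding derivation_def by blast

lemma derivation_mult: "derivation P M d \<Longrightarrow> x \<in> carrier P \<Longrightarrow> y \<in> carrier P \<Longrightarrow>
    d (x \<otimes>\<^bsub>P\<^esub> y) = (x \<odot>\<^bsub>M\<^esub> d y) \<oplus>\<^bsub>M\<^esub> (y \<odot>\<^bsub>M\<^esub> d x)"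
  unfolding derivation_def by blast

text \<open>Derivations along \<open>h\<close> form a module over \<open>Q\<close>. This turns both
  sides of an additivity or Leibniz identity in one variable into derivations in the other variable,
  so that uniqueness can compare them.\<close>

lemma derivation_lincomb:
  assumes Q: "cring Q" and h: "h \<in> ring_hom P Q" and d: "derivation P (along h Q) d" and d': "derivation P (along h Q) d'"
    and u: "u \<in> carrier Q" and v: "v \<in> carrier Q"
  shows "derivation P (along h Q) (\<lambda>x. u \<otimes>\<^bsub>Q\<^esub> d x \<oplus>\<^bsub>Q\<^esub> v \<otimes>\<^bsub>Q\<^esub> d' x)"
proof -
  interpret Q: cring Q by fact
  note c = derivation_closed[OF d, simplified] derivation_closed[OF d', simplified] ring_hom_closed[OF h]
  show ?thesis
    unfolding derivation_def
  proof (intro conjI ballI)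
    show "(\<lambda>x. u \<otimes>\<^bsub>Q\<^esub> d x \<oplus>\<^bsub>Q\<^esub> v \<otimes>\<^bsub>Q\<^esub> d' x) \<in> carrier P \<rightarrow> carrier (along h Q)"
      using c u v by auto
    fix x y assume xy: "x \<in> carrier P" "y \<in> carrier P"
    note c' = c(1)[OF xy(1)] c(1)[OF xy(2)] c(2)[OF xy(1)] c(2)[OF xy(2)] c(3)[OF xy(1)] c(3)[OF xy(2)]
    show "u \<otimes>\<^bsub>Q\<^esub> d (x \<oplus>\<^bsub>P\<^esub> y) \<oplus>\<^bsub>Q\<^esub> v \<otimes>\<^bsub>Q\<^esub> d' (x \<oplus>\<^bsub>P\<^esub> y)
      = (u \<otimes>\<^bsub>Q\<^esub> d x \<oplus>\<^bsub>Q\<^esub> v \<otimes>\<^bsub>Q\<^esub> d' x) \<oplus>\<^bsub>along h Q\<^esub> (u \<otimes>\<^bsub>Q\<^esub> d y \<oplus>\<^bsub>Q\<^esub> v \<otimes>\<^bsub>Q\<^esub> d' y)"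
      unfolding derivation_add[OF d xy] derivation_add[OF d' xy] using c' u v by (simp add: Q.r_distr Q.a_ac)
    show "u \<otimes>\<^bsub>Q\<^esub> d (x \<otimes>\<^bsub>P\<^esub> y) \<oplus>\<^bsub>Q\<^esub> v \<otimes>\<^bsub>Q\<^esub> d' (x \<otimes>\<^bsub>P\<^esub> y)
      = x \<odot>\<^bsub>along h Q\<^esub> (u \<otimes>\<^bsub>Q\<^esub> d y \<oplus>\<^bsub>Q\<^esub> v \<otimes>\<^bsub>Q\<^esub> d' y) \<oplus>\<^bsub>along h Q\<^esub> y \<odot>\<^bsub>along h Q\<^esub> (u \<otimes>\<^bsub>Q\<^esub> d x \<oplus>\<^bsub>Q\<^esub> v \<otimes>\<^bsub>Q\<^esub> d' x)"
      unfolding derivation_mult[OF d xy] derivation_mult[OF d' xy] using c' u v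
      by (simp add: Q.r_distr Q.a_ac Q.m_ac)
  qed
qed

section \<open>Localisation at powers and comparison of localisations\<close>

lemma (in cring) powers_localised:
  assumes "f \<in> carrier R" shows "localised_cring R (powers R f)"
proof (rule localised_cring.intro[OF is_cring], unfold_locales)
  show "powers R f \<subseteq> carrier R" using assms by (auto simp: powers_def)
  show "\<one> \<in> powers R f" unfolding powers_def by (rule range_eqI[of _ _ 0]) simp
  fix x y assume "x \<in> powers R f" "y \<in> powers R f"
  then obtain m n :: nat where "x = f [^] m" "y = f [^] n" by (auto simp: powers_def)
  then have "x \<otimes> y = f [^] (m + n)" using assms by (simp add: nat_pow_mult)
  then show "x \<otimes> y \<in> powers R f" unfolding powers_def by blast
qed

lemma powers_carrier_update: "powers (R\<lparr>carrier := C\<rparr>) f = powers R f"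
  by (simp add: powers_def nat_pow_def)

text \<open>Both localisations invert the same set \<open>S\<close>. An equality of fractions over
  \<open>C\<close> comes with a multiplier in \<open>S\<close>, and this multiplier proves the
  equality over the larger ring.\<close>

lemma loc_incl_hom:
  assumes C: "localised_cring (R\<lparr>carrier := C\<rparr>) S" and R: "localised_cring R S" and CR: "C \<subseteq> carrier R"
  shows "loc_incl R S \<in> ring_hom (localisation (R\<lparr>carrier := C\<rparr>) S) (localisation R S)" (is ?hom)
    and "\<And>r s. r \<in> C \<Longrightarrow> s \<in> S \<Longrightarrow> loc_incl R S (frac (R\<lparr>carrier := C\<rparr>) S r s) = frac R S r s"
proof -
  interpret C: localised_cring "R\<lparr>carrier := C\<rparr>" S by fact
  interpret R: localised_cring R S by fact
  have eq: "loc_incl R S (frac (R\<lparr>carrier := C\<rparr>) S r s) = frac R S r s" if rs: "r \<in> C" "s \<in> S" for r s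
    unfolding loc_incl_def
  proof (rule C.UN_frac)
    fix r' s' assume r': "r' \<in> carrier (R\<lparr>carrier := C\<rparr>)" "s' \<in> S"
      and *: "frac (R\<lparr>carrier := C\<rparr>) S r' s' = frac (R\<lparr>carrier := C\<rparr>) S r s"
    obtain t where "t \<in> S" "t \<otimes>\<^bsub>R\<^esub> (r' \<otimes>\<^bsub>R\<^esub> s) = t \<otimes>\<^bsub>R\<^esub> (r \<otimes>\<^bsub>R\<^esub> s')"
      using C.frac_eq_iff[OF r', of r s] rs * by auto
    then show "frac R S r' s' = frac R S r s"
      using R.frac_eq_iff[of r' s' r s] r' rs CR by auto
  qed (use rs in simp_all)
  show "loc_incl R S (frac (R\<lparr>carrier := C\<rparr>) S r s) = frac R S r s" if "r \<in> C" "s \<in> S" for r s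
    by (rule eq[OF that])
  show ?hom
  proof (rule ring_hom_memI)
    fix x y assume "x \<in> carrier C.L" "y \<in> carrier C.L"
    then obtain r s r' s' where rs: "r \<in> C" "s \<in> S" and x: "x = frac (R\<lparr>carrier := C\<rparr>) S r s"
      and rs': "r' \<in> C" "s' \<in> S" and y: "y = frac (R\<lparr>carrier := C\<rparr>) S r' s'"
      by (elim C.locE) auto
    have c: "r \<in> carrier R" "r' \<in> carrier R" using rs(1) rs'(1) CR by auto
    have SC: "s \<in> C" "s' \<in> C" using C.S_closed rs(2) rs'(2) by simp_all
    have ss: "s \<otimes>\<^bsub>R\<^esub> s' \<in> S" using C.S_mult[OF rs(2) rs'(2)] by simp
    have m: "r \<otimes>\<^bsub>R\<^esub> r' \<in> C" "r \<otimes>\<^bsub>R\<^esub> s' \<oplus>\<^bsub>R\<^esub> r' \<otimes>\<^bsub>R\<^esub> s \<in> C"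
      using C.m_closed[of r r'] C.a_closed C.m_closed[of r s'] C.m_closed[of r' s] rs(1) rs'(1) SC by simp_all
    show "loc_incl R S x \<in> carrier R.L"
      unfolding x eq[OF rs] by (rule R.frac_closed[OF c(1) rs(2)])
    show "loc_incl R S (x \<otimes>\<^bsub>C.L\<^esub> y) = loc_incl R S x \<otimes>\<^bsub>R.L\<^esub> loc_incl R S y"
      unfolding x y eq[OF rs] eq[OF rs'] R.frac_mult[OF c(1) rs(2) c(2) rs'(2)]
      using C.frac_mult[of r s r' s'] rs rs' eq[OF m(1) ss] by simp
    show "loc_incl R S (x \<oplus>\<^bsub>C.L\<^esub> y) = loc_incl R S x \<oplus>\<^bsub>R.L\<^esub> loc_incl R S y"
      unfolding x y eq[OF rs] eq[OF rs'] R.frac_add[OF c(1) rs(2) c(2) rs'(2)]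
      using C.frac_add[of r s r' s'] rs rs' eq[OF m(2) ss] by simp
  next
    show "loc_incl R S \<one>\<^bsub>C.L\<^esub> = \<one>\<^bsub>R.L\<^esub>"
      unfolding C.loc_one R.loc_one using eq[of "\<one>\<^bsub>R\<^esub>" "\<one>\<^bsub>R\<^esub>"] C.one_closed R.S_one by simp
  qed
qed

section \<open>Extension of biderivations\<close>

lemma ring_hom_carrier_mono:
  assumes h: "h \<in> ring_hom R S" and A: "A \<subseteq> carrier R"
  shows "h \<in> ring_hom (R\<lparr>carrier := A\<rparr>) S"
proof (rule ring_hom_memI)
  fix x y assume "x \<in> carrier (R\<lparr>carrier := A\<rparr>)" "y \<in> carrier (R\<lparr>carrier := A\<rparr>)"
  then have xy: "x \<in> carrier R" "y \<in> carrier R" using A by auto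
  show "h x \<in> carrier S" by (rule ring_hom_closed[OF h xy(1)])
  show "h (x \<otimes>\<^bsub>R\<lparr>carrier := A\<rparr>\<^esub> y) = h x \<otimes>\<^bsub>S\<^esub> h y" "h (x \<oplus>\<^bsub>R\<lparr>carrier := A\<rparr>\<^esub> y) = h x \<oplus>\<^bsub>S\<^esub> h y"
    using ring_hom_mult[OF h xy] ring_hom_add[OF h xy] by simp_all
qed (simp add: ring_hom_one[OF h])

lemma ring_hom_Units:
  assumes h: "h \<in> ring_hom R S" and x: "x \<in> Units R"
  shows "h x \<in> Units S"
proof -
  obtain y where y: "y \<in> carrier R" "y \<otimes>\<^bsub>R\<^esub> x = \<one>\<^bsub>R\<^esub>" "x \<otimes>\<^bsub>R\<^esub> y = \<one>\<^bsub>R\<^esub>" and xR: "x \<in> carrier R"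
    using x unfolding Units_def by blast
  have "h y \<otimes>\<^bsub>S\<^esub> h x = \<one>\<^bsub>S\<^esub>" "h x \<otimes>\<^bsub>S\<^esub> h y = \<one>\<^bsub>S\<^esub>"
    using ring_hom_mult[OF h y(1) xR] ring_hom_mult[OF h xR y(1)] y(2,3) ring_hom_one[OF h] by simp_all
  with ring_hom_closed[OF h xR] ring_hom_closed[OF h y(1)] show ?thesis
    unfolding Units_def by blast
qed

lemma (in algebra) structure_hom: "(\<lambda>a. a \<odot>\<^bsub>M\<^esub> \<one>\<^bsub>M\<^esub>) \<in> ring_hom R M"
proof (rule ring_hom_memI)
  fix a a' assume a: "a \<in> carrier R" "a' \<in> carrier R"
  have "(a \<otimes> a') \<odot>\<^bsub>M\<^esub> \<one>\<^bsub>M\<^esub> = a \<odot>\<^bsub>M\<^esub> (\<one>\<^bsub>M\<^esub> \<otimes>\<^bsub>M\<^esub> (a' \<odot>\<^bsub>M\<^esub> \<one>\<^bsub>M\<^esub>))"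
    using a by (simp add: smult_assoc1)
  also have "\<dots> = (a \<odot>\<^bsub>M\<^esub> \<one>\<^bsub>M\<^esub>) \<otimes>\<^bsub>M\<^esub> (a' \<odot>\<^bsub>M\<^esub> \<one>\<^bsub>M\<^esub>)"
    using a by (intro smult_assoc2[symmetric]) simp_all
  finally show "(a \<otimes> a') \<odot>\<^bsub>M\<^esub> \<one>\<^bsub>M\<^esub> = (a \<odot>\<^bsub>M\<^esub> \<one>\<^bsub>M\<^esub>) \<otimes>\<^bsub>M\<^esub> (a' \<odot>\<^bsub>M\<^esub> \<one>\<^bsub>M\<^esub>)" .
qed (simp_all add: smult_l_distr)

text \<open>Separability enters only through the elementary data delivered by
  \<open>separable_polynomial\<close>, all of which live in \<open>B\<close>; the fraction field
  does not occur below.\<close>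

locale separable_simple_extension = domain B + R: algebra "B\<lparr>carrier := A\<rparr>" R
  for B :: "('b, 'm) ring_scheme" (structure) and A and R :: "('b, 'r, 'n) module_scheme" +
  fixes b :: 'b and c :: "nat \<Rightarrow> 'b" and n :: nat
  assumes A: "subring A B" and b: "b \<in> carrier B"
    and cA: "c i \<in> A" and cn: "c n \<noteq> \<zero>" and root: "psum B c b (Suc n) = \<zero>"
    and simple_root: "pderiv_sum B c b n \<noteq> \<zero>"
    and minimal: "(\<And>i. d i \<in> A) \<Longrightarrow> d m \<noteq> \<zero> \<Longrightarrow> psum B d b (Suc m) = \<zero> \<Longrightarrow> n \<le> m"
begin

abbreviation "A' \<equiv> B\<lparr>carrier := A\<rparr>"
abbreviation "C \<equiv> simple_extension A b"
abbreviation "C' \<equiv> B\<lparr>carrier := C\<rparr>"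

text \<open>Away from \<open>f\<close> the extension \<open>C\<close> of \<open>A\<close> is standard etale: the leading coefficient and the
  derivative of the polynomial are invertible.\<close>

definition "f = c n \<otimes> pderiv_sum B c b n"

abbreviation "Cf \<equiv> loc_at C' f"
abbreviation "Bf \<equiv> loc_at B f"
abbreviation "\<iota> \<equiv> to_loc C' (powers C' f)"

lemma C: "subring C B" by (rule simple_extension_is_subring[OF A b])

lemma AC: "A \<subseteq> C" by (rule simple_extension_incl[OF subringE(1)[OF A] b])

lemma bC: "b \<in> C" by (rule simple_extension_mem[OF A b])

sublocale C: cring C'
  by (rule domain.axioms(1)[OF subring_is_domain[OF C]])

lemma deriv_C: "pderiv_sum B c b n \<in> C"
  using C.pderiv_sum_closed[of c b n] cA AC bC by auto

lemma f_C: "f \<in> C"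
  unfolding f_def using subringE(6)[OF C _ deriv_C] cA AC by blast

lemma C_B: "C \<subseteq> carrier B" by (rule subringE(1)[OF C])

lemma f_nonzero: "f \<noteq> \<zero>"
  unfolding f_def using cn simple_root integral_iff[of "c n" "pderiv_sum B c b n"] cA[of n] deriv_C AC C_B by auto

sublocale CL: localised_cring C' "powers C' f"
  by (rule C.powers_localised) (simp add: f_C)

sublocale BL: localised_cring B "powers B f"
  by (rule powers_localised) (use f_C C_B in auto)

lemma f_powers: "f \<in> powers C' f"
  unfolding powers_def by (rule range_eqI[of _ _ 1]) (use f_C C.l_one[of f] in simp)

lemma cring_A': "cring A'"
  by (rule domain.axioms(1)[OF subring_is_domain[OF A]])

abbreviation "SA \<equiv> loc_alg C' f"
abbreviation "SB \<equiv> loc_alg B f"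
abbreviation "S0 \<equiv> along (\<lambda>x. x) B"

lemma algebra_SA: "algebra A' SA"
  using algebra_along[OF cring_A' CL.cring_loc, of \<iota>] ring_hom_carrier_mono[OF CL.to_loc_hom, of A] AC
  by simp

lemma algebra_SB: "algebra A' SB"
  by (rule algebra_along[OF cring_A' BL.cring_loc ring_hom_carrier_mono[OF BL.to_loc_hom subringE(1)[OF A]]])

lemma algebra_S0: "algebra A' S0"
  by (rule algebra_along[OF cring_A' is_cring ring_hom_carrier_mono[OF _ subringE(1)[OF A]]])
    (rule ring_hom_memI, simp_all)

lemma TP: "tensor_product A' R SA"
  by (rule tensor_product.intro[OF R.algebra_axioms algebra_SA])

lemma TQ: "tensor_product A' R SB"
  by (rule tensor_product.intro[OF R.algebra_axioms algebra_SB])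

lemma TT: "tensor_product A' R S0"
  by (rule tensor_product.intro[OF R.algebra_axioms algebra_S0])

sublocale P: tensor_product A' R SA by (rule TP)
sublocale Q: tensor_product A' R SB by (rule TQ)
sublocale T: tensor_product A' R S0 by (rule TT)

abbreviation "P \<equiv> tensor A' R SA"
abbreviation "Q \<equiv> tensor A' R SB"
abbreviation "T \<equiv> tensor A' R S0"
abbreviation "\<phi> \<equiv> tensor_left A' R SA"
abbreviation "j \<equiv> tensor_map A' R SB (loc_incl B (powers B f))"
abbreviation "\<psi> \<equiv> tensor_map A' R SB (to_loc B (powers B f))"

lemma loc_incl:
  shows "loc_incl B (powers B f) \<in> ring_hom Cf Bf"
    and "r \<in> C \<Longrightarrow> loc_incl B (powers B f) (\<iota> r) = to_loc B (powers B f) r"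
  using loc_incl_hom[OF CL.localised_cring_axioms[unfolded powers_carrier_update] BL.localised_cring_axioms C_B]
    BL.S_one
  by (simp_all add: powers_carrier_update to_loc_def)

lemma j_hom: "j \<in> ring_hom P Q"
  and j_pure: "r \<in> carrier R \<Longrightarrow> y \<in> carrier Cf \<Longrightarrow> j (P.pt r y) = Q.pt r (loc_incl B (powers B f) y)"
proof -
  have "loc_incl B (powers B f) (a \<odot>\<^bsub>SA\<^esub> \<one>\<^bsub>SA\<^esub>) = a \<odot>\<^bsub>SB\<^esub> \<one>\<^bsub>SB\<^esub>" if "a \<in> carrier A'" for a
  proof -
    have a: "a \<in> C" "a \<in> carrier B" using that AC C_B by auto
    have "a \<odot>\<^bsub>SA\<^esub> \<one>\<^bsub>SA\<^esub> = \<iota> a"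
      using cring.cring_simprules(12)[OF CL.cring_loc] ring_hom_closed[OF CL.to_loc_hom, of a] a
        monoid.r_one[OF ring.axioms(2)[OF cring.axioms(1)[OF CL.cring_loc]]] by simp
    moreover have "a \<odot>\<^bsub>SB\<^esub> \<one>\<^bsub>SB\<^esub> = to_loc B (powers B f) a"
      using ring_hom_closed[OF BL.to_loc_hom a(2)]
        monoid.r_one[OF ring.axioms(2)[OF cring.axioms(1)[OF BL.cring_loc]]] by simp
    ultimately show ?thesis using loc_incl(2)[OF a(1)] by simp
  qed
  moreover have "loc_incl B (powers B f) \<in> ring_hom SA SB"
    using loc_incl(1) by simp
  ultimately show "j \<in> ring_hom P Q" "r \<in> carrier R \<Longrightarrow> y \<in> carrier Cf \<Longrightarrow> j (P.pt r y) = Q.pt r (loc_incl B (powers B f) y)"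
    using tensor_map_hom[OF TP TQ] by simp_all
qed

lemma \<psi>_hom: "\<psi> \<in> ring_hom T Q"
  and \<psi>_pure: "r \<in> carrier R \<Longrightarrow> y \<in> carrier B \<Longrightarrow> \<psi> (T.pt r y) = Q.pt r (to_loc B (powers B f) y)"
proof -
  have "to_loc B (powers B f) (a \<odot>\<^bsub>S0\<^esub> \<one>\<^bsub>S0\<^esub>) = a \<odot>\<^bsub>SB\<^esub> \<one>\<^bsub>SB\<^esub>" if "a \<in> carrier A'" for a
  proof -
    have a: "a \<in> carrier B" using that AC C_B by auto
    have "a \<odot>\<^bsub>SB\<^esub> \<one>\<^bsub>SB\<^esub> = to_loc B (powers B f) a"
      using ring_hom_closed[OF BL.to_loc_hom a]
        monoid.r_one[OF ring.axioms(2)[OF cring.axioms(1)[OF BL.cring_loc]]] by simp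
    then show ?thesis using a by simp
  qed
  moreover have "to_loc B (powers B f) \<in> ring_hom S0 SB"
    using BL.to_loc_hom by simp
  ultimately show "\<psi> \<in> ring_hom T Q" "r \<in> carrier R \<Longrightarrow> y \<in> carrier B \<Longrightarrow> \<psi> (T.pt r y) = Q.pt r (to_loc B (powers B f) y)"
    using tensor_map_hom[OF TT TQ] by simp_all
qed

text \<open>The two ways from \<open>R\<close> to \<open>Q\<close>, through \<open>P\<close> and
  through \<open>T\<close>, agree. This makes \<open>\<psi>\<close> semilinear over
  \<open>\<phi>\<close>, and lets derivations with values in \<open>T\<close> be pushed to
  \<open>Q\<close>.\<close>

lemma j_\<phi>: "r \<in> carrier R \<Longrightarrow> j (\<phi> r) = \<psi> (tensor_left A' R S0 r)"
  unfolding tensor_left_def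
  using j_pure[of r "\<one>\<^bsub>Cf\<^esub>"] \<psi>_pure[of r \<one>] ring_hom_one[OF loc_incl(1)] ring_hom_one[OF BL.to_loc_hom]
    P.S.one_closed by simp

lemma \<phi>_closed: "r \<in> carrier R \<Longrightarrow> \<phi> r \<in> carrier P"
  by (rule ring_hom_closed[OF P.tensor_left_hom])

text \<open>The composite of \<open>A[b]\<close> into its localisation and on into \<open>P\<close>.
  Through it \<open>b\<close>, the coefficients \<open>c i\<close> and the derivative become
  elements of \<open>P\<close>.\<close>

definition \<theta> where "\<theta> r = P.pt \<one>\<^bsub>R\<^esub> (\<iota> r)"

lemma \<theta>_hom: "\<theta> \<in> ring_hom C' P"
  using ring_hom_trans[OF CL.to_loc_hom P.pure_right_hom[simplified]] by (simp add: \<theta>_def[abs_def] comp_def)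

lemma \<theta>_A:
  assumes "a \<in> A"
  shows "\<theta> a = \<phi> (a \<odot>\<^bsub>R\<^esub> \<one>\<^bsub>R\<^esub>)"
proof -
  have a: "\<iota> a \<in> carrier Cf" using ring_hom_closed[OF CL.to_loc_hom, of a] assms AC by auto
  have "\<phi> (a \<odot>\<^bsub>R\<^esub> \<one>\<^bsub>R\<^esub>) = P.pt \<one>\<^bsub>R\<^esub> (a \<odot>\<^bsub>SA\<^esub> \<one>\<^bsub>SA\<^esub>)"
    unfolding tensor_left_def by (rule P.pure_smult) (use assms P.S.one_closed in simp_all)
  also have "a \<odot>\<^bsub>SA\<^esub> \<one>\<^bsub>SA\<^esub> = \<iota> a"
    using P.S.r_one[of "\<iota> a"] a by simp
  finally show ?thesis by (simp add: \<theta>_def)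
qed

lemma \<theta>_f_Units: "\<theta> f \<in> Units P"
  unfolding \<theta>_def by (rule ring_hom_Units[OF P.pure_right_hom[simplified] CL.to_loc_Units[OF f_powers]])

text \<open>The reason for taking \<open>f\<close> to be a product: in a commutative ring each
  factor of a unit is a unit, so inverting \<open>f\<close> inverts both.\<close>

lemma \<theta>_coeff_Units: "\<theta> (c n) \<in> Units P" and \<theta>_deriv_Units: "\<theta> (pderiv_sum B c b n) \<in> Units P"
proof -
  have cC: "c n \<in> carrier C'" "pderiv_sum B c b n \<in> carrier C'" using cA AC deriv_C by auto
  note cl = ring_hom_closed[OF \<theta>_hom cC(1)] ring_hom_closed[OF \<theta>_hom cC(2)]
  have "\<theta> (c n) \<otimes>\<^bsub>P\<^esub> \<theta> (pderiv_sum B c b n) \<in> Units P"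
    using \<theta>_f_Units ring_hom_mult[OF \<theta>_hom cC] unfolding f_def by simp
  then show "\<theta> (c n) \<in> Units P" "\<theta> (pderiv_sum B c b n) \<in> Units P"
    using P.T.unit_factor[OF _ cl] P.T.unit_factor[OF _ cl(2,1)] P.T.m_comm[OF cl] by auto
qed

text \<open>As a ring with inverses adjoined, \<open>P\<close> is generated by the image of
  \<open>R\<close> and the single element \<open>\<theta> b\<close>. The image of \<open>A\<close>
  comes from \<open>R\<close>, Horner steps reach \<open>A[b]\<close>, inverses reach its
  localisation, and products and differences reach all tensors.\<close>

lemma P_induct:
  assumes x: "x \<in> carrier P"
    and R: "\<And>r. r \<in> carrier R \<Longrightarrow> W (\<phi> r)"
    and b: "W (\<theta> b)"
    and mult: "\<And>x y. x \<in> carrier P \<Longrightarrow> y \<in> carrier P \<Longrightarrow> W x \<Longrightarrow> W y \<Longrightarrow> W (x \<otimes>\<^bsub>P\<^esub> y)"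
    and diff: "\<And>x y. x \<in> carrier P \<Longrightarrow> y \<in> carrier P \<Longrightarrow> W x \<Longrightarrow> W y \<Longrightarrow> W (x \<ominus>\<^bsub>P\<^esub> y)"
    and inv: "\<And>x y. x \<in> carrier P \<Longrightarrow> y \<in> carrier P \<Longrightarrow> y \<otimes>\<^bsub>P\<^esub> x = \<one>\<^bsub>P\<^esub> \<Longrightarrow> W x \<Longrightarrow> W y"
  shows "W x"
proof -
  have \<theta>c: "\<theta> y \<in> carrier P" if "y \<in> C" for y using ring_hom_closed[OF \<theta>_hom] that by simp
  have WA: "W (\<theta> a)" if "a \<in> A" for a
    unfolding \<theta>_A[OF that] using that by (intro R R.smult_closed) auto
  have W0: "W \<zero>\<^bsub>P\<^esub>"
    using diff[OF \<theta>c[OF bC] \<theta>c[OF bC] b b] P.T.r_right_minus_eq[OF \<theta>c[OF bC] \<theta>c[OF bC]] by simp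
  have add: "W (x \<oplus>\<^bsub>P\<^esub> y)" if "x \<in> carrier P" "y \<in> carrier P" "W x" "W y" for x y
  proof -
    have "W (\<zero>\<^bsub>P\<^esub> \<ominus>\<^bsub>P\<^esub> y)" using diff[OF P.T.zero_closed that(2) W0 that(4)] .
    then have "W (x \<ominus>\<^bsub>P\<^esub> (\<zero>\<^bsub>P\<^esub> \<ominus>\<^bsub>P\<^esub> y))"
      using that W0 by (intro diff P.T.minus_closed P.T.zero_closed)
    moreover have "x \<ominus>\<^bsub>P\<^esub> (\<zero>\<^bsub>P\<^esub> \<ominus>\<^bsub>P\<^esub> y) = x \<oplus>\<^bsub>P\<^esub> y"
      using that by (simp add: a_minus_def)
    ultimately show ?thesis by simp
  qed
  have WC: "W (\<theta> y)" if "y \<in> C" for y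
    using that
  proof induction
    case zero
    show ?case using WA[OF subringE(2)[OF A]] .
  next
    case (lin k1 k2)
    have C: "k1 \<in> C" "k2 \<in> C" "k1 \<otimes> b \<in> C" using lin AC bC subringE(6)[OF C] by auto
    have "\<theta> (k1 \<otimes> b \<oplus> k2) = \<theta> k1 \<otimes>\<^bsub>P\<^esub> \<theta> b \<oplus>\<^bsub>P\<^esub> \<theta> k2"
      using ring_hom_add[OF \<theta>_hom, of "k1 \<otimes> b" k2] ring_hom_mult[OF \<theta>_hom, of k1 b] C bC by simp
    moreover have "W (\<theta> k1 \<otimes>\<^bsub>P\<^esub> \<theta> b \<oplus>\<^bsub>P\<^esub> \<theta> k2)"
      by (intro add mult P.T.m_closed \<theta>c C bC lin(3) b WA lin(2))
    ultimately show ?case by simp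
  qed
  note ph = P.pure_right_hom[simplified]
  have WL: "W (P.pt \<one>\<^bsub>R\<^esub> y)" if "y \<in> carrier Cf" for y
    using that
  proof (rule CL.loc_generated)
    show "W (P.pt \<one>\<^bsub>R\<^esub> (\<iota> r))" if "r \<in> carrier C'" for r
      using WC[of r] that by (simp add: \<theta>_def)
    show "W (P.pt \<one>\<^bsub>R\<^esub> (x \<otimes>\<^bsub>Cf\<^esub> y))"
      if "x \<in> carrier Cf" "y \<in> carrier Cf" "W (P.pt \<one>\<^bsub>R\<^esub> x)" "W (P.pt \<one>\<^bsub>R\<^esub> y)" for x y
      unfolding ring_hom_mult[OF ph that(1,2)]
      by (rule mult[OF ring_hom_closed[OF ph that(1)] ring_hom_closed[OF ph that(2)] that(3,4)])
    show "W (P.pt \<one>\<^bsub>R\<^esub> y)"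
      if "x \<in> carrier Cf" "y \<in> carrier Cf" "y \<otimes>\<^bsub>Cf\<^esub> x = \<one>\<^bsub>Cf\<^esub>" "W (P.pt \<one>\<^bsub>R\<^esub> x)" for x y
    proof (rule inv[OF ring_hom_closed[OF ph that(1)] ring_hom_closed[OF ph that(2)] _ that(4)])
      show "P.pt \<one>\<^bsub>R\<^esub> y \<otimes>\<^bsub>P\<^esub> P.pt \<one>\<^bsub>R\<^esub> x = \<one>\<^bsub>P\<^esub>"
        unfolding ring_hom_mult[OF ph that(2,1), symmetric] that(3) by (rule ring_hom_one[OF ph])
    qed
  qed
  show ?thesis
    using x
  proof (rule P.tensor_induct)
    fix r y assume r: "r \<in> carrier R" and y: "y \<in> carrier SA"
    then have y': "y \<in> carrier Cf" by simp
    show "W (P.pt r y)"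
      unfolding P.pure_eq_mult[OF r y] using r y' WL[OF y'] R[OF r] ring_hom_closed[OF ph y']
      by (intro mult \<phi>_closed)
  qed (rule diff)
qed

section \<open>Derivations controlled by their values on \<open>R\<close>\<close>

text \<open>Along the generation of \<open>P\<close> from \<open>R\<close> and \<open>b\<close>, the
  Leibniz rule never leaves \<open>N\<close>, and units of \<open>P\<close> can be divided out
  because \<open>N\<close> absorbs \<open>j\<close> of \<open>P\<close>. Separability acts in the
  case of the generator \<open>b\<close>, where the invertible derivative allows the equation for
  \<open>d (\<theta> b)\<close> to be solved.\<close>

lemma derivation_in_submodule:
  assumes d: "derivation P (along j Q) d" and N: "subgroup N (add_monoid Q)"
    and absorb: "\<And>x y. x \<in> carrier P \<Longrightarrow> y \<in> N \<Longrightarrow> j x \<otimes>\<^bsub>Q\<^esub> y \<in> N"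
    and base: "\<And>r. r \<in> carrier R \<Longrightarrow> d (\<phi> r) \<in> N"
    and x: "x \<in> carrier P"
  shows "d x \<in> N"
proof -
  let ?S = "dual_numbers Q"
  define H where "H x = (j x, d x)" for x
  have H: "H \<in> ring_hom P ?S"
    unfolding H_def by (rule derivation_imp_dual_hom[OF P.T.ring_axioms Q.T.is_cring j_hom d])
  interpret S: cring ?S by (rule cring_dual_numbers[OF Q.T.is_cring])
  note dm = derivation_mult[OF d, simplified] and da = derivation_add[OF d, simplified]
    and dc = derivation_closed[OF d, simplified]
  have jc: "j x \<in> carrier Q" if "x \<in> carrier P" for x using ring_hom_closed[OF j_hom that] .
  have NQ: "y \<in> carrier Q" if "y \<in> N" for y using subgroup.mem_carrier[OF N that] by simp
  have N0: "\<zero>\<^bsub>Q\<^esub> \<in> N" using subgroup.one_closed[OF N] by simp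
  have Nadd: "y \<oplus>\<^bsub>Q\<^esub> z \<in> N" if "y \<in> N" "z \<in> N" for y z using subgroup.m_closed[OF N that] by simp
  have Nneg: "\<ominus>\<^bsub>Q\<^esub> y \<in> N" if "y \<in> N" for y using subgroup.m_inv_closed[OF N that] by (simp add: a_inv_def)
  have d1: "d \<one>\<^bsub>P\<^esub> = \<zero>\<^bsub>Q\<^esub>" using ring_hom_one[OF H] by (simp add: H_def)
  \<comment> \<open>If \<open>w\<close> is inverse to \<open>y\<close> in \<open>P\<close>,
    multiplying \<open>j y\<close> times \<open>d z\<close> by \<open>j w\<close> recovers
    \<open>d z\<close>, and \<open>N\<close> is stable under this.\<close>
  have cancel: "d z \<in> N" if "y \<in> carrier P" "z \<in> carrier P" "w \<in> carrier P" "w \<otimes>\<^bsub>P\<^esub> y = \<one>\<^bsub>P\<^esub>" "j y \<otimes>\<^bsub>Q\<^esub> d z \<in> N" for y z w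
  proof -
    have "j w \<otimes>\<^bsub>Q\<^esub> (j y \<otimes>\<^bsub>Q\<^esub> d z) = j (w \<otimes>\<^bsub>P\<^esub> y) \<otimes>\<^bsub>Q\<^esub> d z"
      using ring_hom_mult[OF j_hom that(3,1)] jc[OF that(1)] jc[OF that(3)] dc[OF that(2)] by (simp add: Q.T.m_assoc)
    also have "\<dots> = d z" unfolding that(4) ring_hom_one[OF j_hom] using dc[OF that(2)] by simp
    finally show ?thesis using absorb[OF that(3,5)] by simp
  qed
  show ?thesis
    using x
  proof (rule P_induct)
    show "d (\<phi> r) \<in> N" if "r \<in> carrier R" for r by (rule base[OF that])
  next
    fix x y assume xy: "x \<in> carrier P" "y \<in> carrier P" and N': "d x \<in> N" "d y \<in> N"
    show "d (x \<otimes>\<^bsub>P\<^esub> y) \<in> N" unfolding dm[OF xy] by (intro Nadd absorb xy N')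
    have xy': "x \<ominus>\<^bsub>P\<^esub> y \<in> carrier P" using xy by simp
    have "(x \<ominus>\<^bsub>P\<^esub> y) \<oplus>\<^bsub>P\<^esub> y = x" using xy by (simp add: a_minus_def P.T.a_assoc P.T.l_neg)
    then have "d x = d (x \<ominus>\<^bsub>P\<^esub> y) \<oplus>\<^bsub>Q\<^esub> d y" using da[OF xy' xy(2)] by simp
    then have "d (x \<ominus>\<^bsub>P\<^esub> y) = d x \<oplus>\<^bsub>Q\<^esub> (\<ominus>\<^bsub>Q\<^esub> d y)"
      using dc[OF xy'] dc[OF xy(2)] by (simp add: Q.T.a_assoc Q.T.r_neg)
    then show "d (x \<ominus>\<^bsub>P\<^esub> y) \<in> N" using Nadd[OF N'(1) Nneg[OF N'(2)]] by simp
  next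
    fix x y assume xy: "x \<in> carrier P" "y \<in> carrier P" and yx: "y \<otimes>\<^bsub>P\<^esub> x = \<one>\<^bsub>P\<^esub>" and N': "d x \<in> N"
    \<comment> \<open>The Leibniz rule for \<open>y x = 1\<close> expresses \<open>j x\<close> times
      \<open>d y\<close> as minus \<open>j y\<close> times \<open>d x\<close>, which is in
      \<open>N\<close>; then the unit \<open>x\<close> is divided out.\<close>
    have "j y \<otimes>\<^bsub>Q\<^esub> d x \<oplus>\<^bsub>Q\<^esub> j x \<otimes>\<^bsub>Q\<^esub> d y = \<zero>\<^bsub>Q\<^esub>" using dm[OF xy(2,1)] unfolding yx d1 by simp
    then have "j x \<otimes>\<^bsub>Q\<^esub> d y = \<ominus>\<^bsub>Q\<^esub> (j y \<otimes>\<^bsub>Q\<^esub> d x)"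
      using jc[OF xy(1)] jc[OF xy(2)] dc[OF xy(1)] dc[OF xy(2)]
      by (intro Q.T.minus_equality[symmetric]) (simp_all add: Q.T.a_comm)
    then have "j x \<otimes>\<^bsub>Q\<^esub> d y \<in> N" using Nneg[OF absorb[OF xy(2) N']] by simp
    then show "d y \<in> N" by (rule cancel[OF xy(1,2,2) yx])
  next
    interpret \<theta>: ring_hom_cring C' P \<theta> by (rule UnivPoly.ring_hom_cringI[OF C.is_cring P.T.is_cring \<theta>_hom])
    interpret j: ring_hom_cring P Q j by (rule UnivPoly.ring_hom_cringI[OF P.T.is_cring Q.T.is_cring j_hom])
    interpret H: ring_hom_cring P ?S H by (rule UnivPoly.ring_hom_cringI[OF P.T.is_cring S.is_cring H])
    interpret fst: ring_hom_cring ?S Q fst by (rule UnivPoly.ring_hom_cringI[OF S.is_cring Q.T.is_cring fst_dual_numbers_hom])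
    have bC': "b \<in> carrier C'" and cC': "c i \<in> carrier C'" for i using bC cA AC by auto
    have \<theta>bP: "\<theta> b \<in> carrier P" by (rule \<theta>.hom_closed[OF bC'])
    have \<theta>cP: "\<theta> (c i) \<in> carrier P" for i by (rule \<theta>.hom_closed[OF cC'])
    \<comment> \<open>The subring \<open>j(P) + N\<close> \<epsilon>. It is closed under products
      because \<epsilon> squares to zero and \<open>N\<close> is stable under \<open>j\<close> of
      \<open>P\<close>. Coefficients \<open>g i\<close> and the point \<open>y0\<close> lie in it,
      so the value of the polynomial does too.\<close>
    define V where "V = {(j p, y) | p y. p \<in> carrier P \<and> y \<in> N}"
    have V: "subring V ?S"
    proof (rule S.subringI)
      show "V \<subseteq> carrier ?S" using jc NQ by (auto simp: V_def)
      show "\<one>\<^bsub>?S\<^esub> \<in> V" using ring_hom_one[OF j_hom] N0 by (auto simp: V_def intro!: exI[of _ "\<one>\<^bsub>P\<^esub>"])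
    next
      fix v assume "v \<in> V"
      then obtain p y where v: "v = (j p, y)" "p \<in> carrier P" "y \<in> N" by (auto simp: V_def)
      have "\<ominus>\<^bsub>?S\<^esub> v = (j (\<ominus>\<^bsub>P\<^esub> p), \<ominus>\<^bsub>Q\<^esub> y)"
        using v jc[OF v(2)] NQ[OF v(3)] by (intro S.minus_equality) (simp_all add: Q.T.l_neg)
      then show "\<ominus>\<^bsub>?S\<^esub> v \<in> V" using P.T.a_inv_closed[OF v(2)] Nneg[OF v(3)] unfolding V_def by blast
    next
      fix v w assume "v \<in> V" "w \<in> V"
      then obtain p y q z where v: "v = (j p, y)" "p \<in> carrier P" "y \<in> N" and w: "w = (j q, z)" "q \<in> carrier P" "z \<in> N"
        by (auto simp: V_def)
      have "v \<otimes>\<^bsub>?S\<^esub> w = (j (p \<otimes>\<^bsub>P\<^esub> q), j p \<otimes>\<^bsub>Q\<^esub> z \<oplus>\<^bsub>Q\<^esub> j q \<otimes>\<^bsub>Q\<^esub> y)" using v w by simp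
      moreover have "j p \<otimes>\<^bsub>Q\<^esub> z \<oplus>\<^bsub>Q\<^esub> j q \<otimes>\<^bsub>Q\<^esub> y \<in> N" by (intro Nadd absorb v w)
      ultimately show "v \<otimes>\<^bsub>?S\<^esub> w \<in> V" using P.T.m_closed[OF v(2) w(2)] unfolding V_def by blast
      have "v \<oplus>\<^bsub>?S\<^esub> w = (j (p \<oplus>\<^bsub>P\<^esub> q), y \<oplus>\<^bsub>Q\<^esub> z)" using v w by simp
      then show "v \<oplus>\<^bsub>?S\<^esub> w \<in> V" using P.T.a_closed[OF v(2) w(2)] Nadd[OF v(3) w(3)] unfolding V_def by blast
    qed
    \<comment> \<open>\<open>(b, d b)\<close> is a root in the dual numbers of the image of the polynomial under \<open>H\<close>. By
      Taylor expansion at \<open>(b, 0)\<close> the derivative at \<open>b\<close> times \<open>d b\<close> is a combination of values \<open>d (c i)\<close>.\<close>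
    define g where "g i = H (\<theta> (c i))" for i
    define y0 where "y0 = (j (\<theta> b), \<zero>\<^bsub>Q\<^esub>)"
    define e where "e = (\<zero>\<^bsub>Q\<^esub>, d (\<theta> b))"
    have g: "g i \<in> carrier ?S" for i unfolding g_def by (rule H.hom_closed[OF \<theta>cP])
    have y0: "y0 \<in> carrier ?S" using jc[OF \<theta>bP] by (simp add: y0_def)
    have e: "e \<in> carrier ?S" "e \<otimes>\<^bsub>?S\<^esub> e = \<zero>\<^bsub>?S\<^esub>" using dc[OF \<theta>bP] by (simp_all add: e_def)
    have "y0 \<oplus>\<^bsub>?S\<^esub> e = H (\<theta> b)" using jc[OF \<theta>bP] dc[OF \<theta>bP] by (simp add: y0_def e_def H_def)
    then have "psum ?S g (y0 \<oplus>\<^bsub>?S\<^esub> e) (Suc n) = H (psum P (\<lambda>i. \<theta> (c i)) (\<theta> b) (Suc n))"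
      unfolding g_def using H.psum_hom[of "\<lambda>i. \<theta> (c i)" "\<theta> b" "Suc n", OF \<theta>cP \<theta>bP] by simp
    also have "psum P (\<lambda>i. \<theta> (c i)) (\<theta> b) (Suc n) = \<theta> (psum C' c b (Suc n))"
      using \<theta>.psum_hom[of c b "Suc n", OF cC' bC'] by simp
    also have "\<dots> = \<zero>\<^bsub>P\<^esub>" using root \<theta>.hom_zero by (simp del: psum.simps)
    finally have "psum ?S g (y0 \<oplus>\<^bsub>?S\<^esub> e) (Suc n) = \<zero>\<^bsub>?S\<^esub>" using H.hom_zero by simp
    then have taylor: "psum ?S g y0 (Suc n) \<oplus>\<^bsub>?S\<^esub> pderiv_sum ?S g y0 n \<otimes>\<^bsub>?S\<^esub> e = \<zero>\<^bsub>?S\<^esub>"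
      unfolding S.psum_add_square_zero[of g y0 e n, OF g y0 e] .
    have gV: "g i \<in> V" for i
      unfolding g_def H_def V_def using base[of "c i \<odot>\<^bsub>R\<^esub> \<one>\<^bsub>R\<^esub>"] \<theta>_A[OF cA] \<theta>cP cA by auto
    have y0V: "y0 \<in> V" unfolding y0_def V_def using \<theta>bP N0 by blast
    have "psum ?S g y0 (Suc n) \<in> V" by (rule S.psum_in_subring[OF V gV y0V])
    then obtain q m where qm: "psum ?S g y0 (Suc n) = (q, m)" "m \<in> N" unfolding V_def by blast
    have pd: "fst (pderiv_sum ?S g y0 n) = j (\<theta> (pderiv_sum B c b n))"
    proof -
      have "fst (pderiv_sum ?S g y0 n) = pderiv_sum Q (\<lambda>i. j (\<theta> (c i))) (j (\<theta> b)) n"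
        using fst.pderiv_sum_hom[of g y0 n, OF g y0] by (simp add: g_def H_def y0_def)
      also have "\<dots> = j (\<theta> (pderiv_sum C' c b n))"
        using j.pderiv_sum_hom[of "\<lambda>i. \<theta> (c i)" "\<theta> b" n, OF \<theta>cP \<theta>bP] \<theta>.pderiv_sum_hom[of c b n, OF cC' bC'] by simp
      finally show ?thesis by simp
    qed
    have dC': "pderiv_sum B c b n \<in> carrier C'" using deriv_C by simp
    \<comment> \<open>The infinitesimal part of the Taylor identity. As \<open>e\<close> has first
      component zero, the derivative contributes through its first component alone.\<close>
    have "m \<oplus>\<^bsub>Q\<^esub> j (\<theta> (pderiv_sum B c b n)) \<otimes>\<^bsub>Q\<^esub> d (\<theta> b) = \<zero>\<^bsub>Q\<^esub>"
      using arg_cong[OF taylor, of snd] S.pderiv_sum_closed[of g y0 n, OF g y0] pd dc[OF \<theta>bP] jc[OF \<theta>.hom_closed[OF dC']]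
      unfolding qm e_def by (cases "pderiv_sum ?S g y0 n") simp
    then have "j (\<theta> (pderiv_sum B c b n)) \<otimes>\<^bsub>Q\<^esub> d (\<theta> b) = \<ominus>\<^bsub>Q\<^esub> m"
      using NQ[OF qm(2)] dc[OF \<theta>bP] jc[OF \<theta>.hom_closed[OF dC']]
      by (intro Q.T.minus_equality[symmetric]) (simp_all add: Q.T.a_comm)
    then have "j (\<theta> (pderiv_sum B c b n)) \<otimes>\<^bsub>Q\<^esub> d (\<theta> b) \<in> N" using Nneg[OF qm(2)] by simp
    then show "d (\<theta> b) \<in> N"
      using \<theta>_deriv_Units by (intro cancel[of "\<theta> (pderiv_sum B c b n)" _ "inv\<^bsub>P\<^esub> \<theta> (pderiv_sum B c b n)"])
        (simp_all only: P.T.Units_closed P.T.Units_inv_closed P.T.Units_l_inv \<theta>bP)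
  qed
qed

lemma derivation_unique:
  assumes d: "derivation P (along j Q) d" and d': "derivation P (along j Q) d'"
    and eq: "\<And>r. r \<in> carrier R \<Longrightarrow> d (\<phi> r) = d' (\<phi> r)" and x: "x \<in> carrier P"
  shows "d x = d' x"
proof -
  let ?m = "\<ominus>\<^bsub>Q\<^esub> \<one>\<^bsub>Q\<^esub>"
  note dc = derivation_closed[OF d, simplified] derivation_closed[OF d', simplified]
  have *: "\<one>\<^bsub>Q\<^esub> \<otimes>\<^bsub>Q\<^esub> d y \<oplus>\<^bsub>Q\<^esub> ?m \<otimes>\<^bsub>Q\<^esub> d' y = d y \<ominus>\<^bsub>Q\<^esub> d' y" if "y \<in> carrier P" for y
    using dc[OF that] by (simp add: a_minus_def Q.T.l_minus)
  have dd: "derivation P (along j Q) (\<lambda>x. \<one>\<^bsub>Q\<^esub> \<otimes>\<^bsub>Q\<^esub> d x \<oplus>\<^bsub>Q\<^esub> ?m \<otimes>\<^bsub>Q\<^esub> d' x)"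
    by (rule derivation_lincomb[OF Q.T.is_cring j_hom d d']) simp_all
  have "\<one>\<^bsub>Q\<^esub> \<otimes>\<^bsub>Q\<^esub> d x \<oplus>\<^bsub>Q\<^esub> ?m \<otimes>\<^bsub>Q\<^esub> d' x \<in> {\<zero>\<^bsub>Q\<^esub>}"
  proof (rule derivation_in_submodule[OF dd _ _ _ x])
    show "subgroup {\<zero>\<^bsub>Q\<^esub>} (add_monoid Q)"
      using group.triv_subgroup[OF Q.T.a_group] by simp
    show "j x \<otimes>\<^bsub>Q\<^esub> y \<in> {\<zero>\<^bsub>Q\<^esub>}" if "x \<in> carrier P" "y \<in> {\<zero>\<^bsub>Q\<^esub>}" for x y
      using that ring_hom_closed[OF j_hom] by simp
    show "\<one>\<^bsub>Q\<^esub> \<otimes>\<^bsub>Q\<^esub> d (\<phi> r) \<oplus>\<^bsub>Q\<^esub> ?m \<otimes>\<^bsub>Q\<^esub> d' (\<phi> r) \<in> {\<zero>\<^bsub>Q\<^esub>}" if "r \<in> carrier R" for r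
      unfolding *[OF \<phi>_closed[OF that]] unfolding eq[OF that]
      using dc(2)[OF \<phi>_closed[OF that]] Q.T.r_right_minus_eq by simp
  qed
  then show ?thesis
    using Q.T.r_right_minus_eq dc[OF x] unfolding *[OF x] by simp
qed

end

text \<open>The additive monoids of \<open>along h S\<close> and \<open>S\<close> have different types of record extensions,
  so they cannot be identified outright.\<close>

lemma generate_add_monoid_along: "generate (add_monoid (along h S)) U = generate (add_monoid S) U"
proof -
  let ?G = "add_monoid (along h S)" and ?H = "add_monoid S"
  have eqs: "\<one>\<^bsub>?G\<^esub> = \<one>\<^bsub>?H\<^esub>" "x \<otimes>\<^bsub>?G\<^esub> y = x \<otimes>\<^bsub>?H\<^esub> y" "inv\<^bsub>?G\<^esub> x = inv\<^bsub>?H\<^esub> x" for x y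
    by (simp_all add: m_inv_def)
  have "x \<in> generate ?H U" if "x \<in> generate ?G U" for x
    using that by induction (simp_all only: eqs generate.intros)
  moreover have "x \<in> generate ?G U" if "x \<in> generate ?H U" for x
    using that by induction (simp_all only: eqs[symmetric] generate.intros)
  ultimately show ?thesis by blast
qed

lemma ideal_smult_along:
  "ideal_smult (along h S) I = generate (add_monoid S) {h i \<otimes>\<^bsub>S\<^esub> x | i x. i \<in> I \<and> x \<in> carrier S}"
  unfolding ideal_smult_def generate_add_monoid_along unfolding along_simps ..

lemma biderivation_left: "biderivation S N G \<Longrightarrow> r \<in> carrier S \<Longrightarrow> derivation S N (G r)"
  and biderivation_right: "biderivation S N G \<Longrightarrow> r \<in> carrier S \<Longrightarrow> derivation S N (\<lambda>s. G s r)"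
  and biderivation_swap: "biderivation S N G \<Longrightarrow> biderivation S N (\<lambda>x y. G y x)"
  by (simp_all add: biderivation_def)

context separable_simple_extension
begin

section \<open>Existence of extended derivations\<close>

text \<open>A derivation along \<open>j\<close> is the same as a lift of \<open>j\<close> through
  \<open>fst\<close> to the dual numbers. The lift is assembled from the given one on
  \<open>R\<close> and one on the localised \<open>A[b]\<close>, which agree on \<open>A\<close>.
  The universal properties only provide homomorphisms; that they lie over \<open>j\<close> is
  verified afterwards on generators.\<close>

lemma derivation_extends:
  assumes d: "derivation R (along (\<lambda>r. j (\<phi> r)) Q) d"
  obtains d' where "derivation P (along j Q) d'" "\<And>r. r \<in> carrier R \<Longrightarrow> d' (\<phi> r) = d r"
proof -
  let ?S = "dual_numbers Q"
  interpret S: cring ?S by (rule cring_dual_numbers[OF Q.T.is_cring])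
  interpret fst: ring_hom_cring ?S Q fst by (rule UnivPoly.ring_hom_cringI[OF S.is_cring Q.T.is_cring fst_dual_numbers_hom])
  define k where "k y = j (P.pt \<one>\<^bsub>R\<^esub> y)" for y
  define k' where "k' r = j (\<theta> r)" for r
  have k: "k \<in> ring_hom Cf Q"
    using ring_hom_trans[OF P.pure_right_hom[simplified] j_hom] by (simp add: k_def[abs_def] comp_def)
  have k': "k' \<in> ring_hom C' Q"
    using ring_hom_trans[OF \<theta>_hom j_hom] by (simp add: k'_def[abs_def] comp_def)
  interpret k': ring_hom_cring C' Q k' by (rule UnivPoly.ring_hom_cringI[OF C.is_cring Q.T.is_cring k'])
  have kk': "k' r = k (\<iota> r)" for r by (simp add: k'_def k_def \<theta>_def)
  have bC': "b \<in> carrier C'" and cC': "c i \<in> carrier C'" for i using bC cA AC by auto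
  have dC': "pderiv_sum B c b n \<in> carrier C'" using deriv_C by simp
  define H1 where "H1 r = (j (\<phi> r), d r)" for r
  have j\<phi>: "(\<lambda>r. j (\<phi> r)) \<in> ring_hom R Q"
    using ring_hom_trans[OF P.tensor_left_hom j_hom] by (simp add: comp_def)
  have H1: "H1 \<in> ring_hom R ?S"
    unfolding H1_def using derivation_imp_dual_hom[OF _ Q.T.is_cring j\<phi> d] R.M_cring cring.axioms(1) by blast
  \<comment> \<open>\<open>A\<close> maps to the dual numbers through \<open>R\<close>. The
    infinitesimal part is \<open>d\<close> at the image of \<open>a\<close> in \<open>R\<close>,
    which need not vanish, so the coefficients of the polynomial really move.\<close>
  define H0 where "H0 a = H1 (a \<odot>\<^bsub>R\<^esub> \<one>\<^bsub>R\<^esub>)" for a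
  have H0: "H0 \<in> ring_hom A' ?S"
    using ring_hom_trans[OF R.structure_hom H1] by (simp add: H0_def[abs_def] comp_def)
  have fst_H0: "fst (H0 a) = k' a" if "a \<in> A" for a
    using \<theta>_A[OF that] by (simp add: H0_def H1_def k'_def)
  have H0S: "H0 (c i) \<in> carrier ?S" for i using ring_hom_closed[OF H0, of "c i"] cA by simp
  \<comment> \<open>The starting approximation: \<open>b\<close> with infinitesimal part zero.
    Modulo \<epsilon> it is a root, so the value there has first component zero and squares to zero,
    as \<open>newton_root\<close> requires.\<close>
  define x0 where "x0 = (k' b, \<zero>\<^bsub>Q\<^esub>)"
  have x0: "x0 \<in> carrier ?S" using k'.hom_closed[OF bC'] by (simp add: x0_def)
  let ?v = "psum ?S (\<lambda>i. H0 (c i)) x0 (Suc n)"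
  let ?u = "pderiv_sum ?S (\<lambda>i. H0 (c i)) x0 n"
  have "fst ?v = psum Q (\<lambda>i. k' (c i)) (k' b) (Suc n)"
    using fst.psum_hom[of "\<lambda>i. H0 (c i)" x0 "Suc n", OF H0S x0] by (simp only: fst_H0[OF cA] x0_def fst_conv)
  also have "\<dots> = k' (psum C' c b (Suc n))"
    using k'.psum_hom[of c b "Suc n", OF cC' bC'] by simp
  also have "\<dots> = \<zero>\<^bsub>Q\<^esub>"
    using root k'.hom_zero by (simp del: psum.simps)
  finally have fst_v: "fst ?v = \<zero>\<^bsub>Q\<^esub>" .
  have v: "?v \<in> carrier ?S" by (rule S.psum_closed[OF H0S x0])
  then have vv: "?v \<otimes>\<^bsub>?S\<^esub> ?v = \<zero>\<^bsub>?S\<^esub>"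
    using fst_v by (cases ?v) simp
  have "fst ?u = pderiv_sum Q (\<lambda>i. k' (c i)) (k' b) n"
    using fst.pderiv_sum_hom[of "\<lambda>i. H0 (c i)" x0 n, OF H0S x0] by (simp only: fst_H0[OF cA] x0_def fst_conv)
  also have "\<dots> = k' (pderiv_sum B c b n)"
    using k'.pderiv_sum_hom[of c b n, OF cC' bC'] by simp
  also have "\<dots> \<in> Units Q"
    unfolding k'_def by (rule ring_hom_Units[OF j_hom \<theta>_deriv_Units])
  finally have u: "?u \<in> Units ?S"
    by (rule Q.T.dual_numbers_Units[OF S.pderiv_sum_closed[OF H0S x0]])
  obtain w where w: "w \<in> carrier ?S" and root': "psum ?S (\<lambda>i. H0 (c i)) (x0 \<oplus>\<^bsub>?S\<^esub> ?v \<otimes>\<^bsub>?S\<^esub> w) (Suc n) = \<zero>\<^bsub>?S\<^esub>"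
    using S.newton_root[of "\<lambda>i. H0 (c i)" x0 n, OF H0S x0 vv u] by blast
  \<comment> \<open>The Newton correction is a multiple of \<open>?v\<close>, whose first component
    is zero, so \<open>s\<close> still lies over the image of \<open>b\<close>.\<close>
  define s where "s = x0 \<oplus>\<^bsub>?S\<^esub> ?v \<otimes>\<^bsub>?S\<^esub> w"
  have s: "s \<in> carrier ?S" unfolding s_def by (rule S.a_closed[OF x0 S.m_closed[OF v w]])
  have fst_s: "fst s = k' b"
    unfolding s_def dual_numbers_fst_snd fst_v using w k'.hom_closed[OF bC'] by (auto simp: x0_def)
  have "fst (H0 (c n)) \<in> Units Q"
    unfolding fst_H0[OF cA] k'_def by (rule ring_hom_Units[OF j_hom \<theta>_coeff_Units])
  then have lead: "H0 (c n) \<in> Units ?S" by (rule Q.T.dual_numbers_Units[OF H0S])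
  obtain g where g: "g \<in> ring_hom C' ?S" and gA: "\<And>a. a \<in> A \<Longrightarrow> g a = H0 a" and gb: "g b = s"
  proof (rule simple_extension_universal[OF A b, of c n, OF cA root _ S.is_cring H0 s lead root'[folded s_def]])
    show "n \<le> m" if "\<And>i. e i \<in> A" "e m \<noteq> \<zero>" "psum B e b (Suc m) = \<zero>" for e m
      by (rule minimal[of e, OF that])
  qed (use that in blast)
  have fst_g: "fst (g y) = k' y" if "y \<in> C" for y
    using that
  proof induction
    case zero
    show ?case using gA fst_H0 subringE(2)[OF A] by simp
  next
    case (lin k1 k2)
    have m: "k1 \<in> carrier C'" "k2 \<in> carrier C'" "k1 \<otimes> b \<in> carrier C'"
      using lin AC bC subringE(6)[OF C] by auto
    show ?case
      using ring_hom_add[OF g m(3,2)] ring_hom_mult[OF g m(1) bC'] k'.hom_add[OF m(3,2)] k'.hom_mult[OF m(1) bC']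
        lin(3) gA[OF lin(2)] fst_H0[OF lin(2)] gb fst_s
      by (simp add: dual_numbers_fst_snd)
  qed
  \<comment> \<open>Units of the dual numbers are detected by first components, and over those
    \<open>g\<close> is the map from \<open>A[b]\<close> that factors through the
    localisation.\<close>
  have "g t \<in> Units ?S" if t: "t \<in> powers C' f" for t
  proof (rule Q.T.dual_numbers_Units)
    have tC: "t \<in> carrier C'" by (rule CL.S_closed[OF t])
    show "g t \<in> carrier ?S" by (rule ring_hom_closed[OF g tC])
    have "k (\<iota> t) \<in> Units Q" by (rule ring_hom_Units[OF k CL.to_loc_Units[OF t]])
    then show "fst (g t) \<in> Units Q" using fst_g[of t] tC by (simp add: kk')
  qed
  then obtain G where G: "G \<in> ring_hom Cf ?S" and G\<iota>: "\<And>r. r \<in> carrier C' \<Longrightarrow> G (\<iota> r) = g r"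
    using CL.localisation_universal[OF S.is_cring g] by blast
  have fst_G: "fst (G y) = k y" if "y \<in> carrier Cf" for y
    using that
  proof (rule CL.loc_generated)
    show "fst (G (\<iota> r)) = k (\<iota> r)" if "r \<in> carrier C'" for r
      using G\<iota>[OF that] fst_g[of r] that by (simp add: kk')
    show "fst (G (x \<otimes>\<^bsub>Cf\<^esub> y)) = k (x \<otimes>\<^bsub>Cf\<^esub> y)"
      if "x \<in> carrier Cf" "y \<in> carrier Cf" "fst (G x) = k x" "fst (G y) = k y" for x y
      unfolding ring_hom_mult[OF G that(1,2)] ring_hom_mult[OF k that(1,2)] dual_numbers_fst_snd that(3,4) ..
    show "fst (G y) = k y"
      if xy: "x \<in> carrier Cf" "y \<in> carrier Cf" "y \<otimes>\<^bsub>Cf\<^esub> x = \<one>\<^bsub>Cf\<^esub>" "fst (G x) = k x" for x y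
    \<comment> \<open>Agreement passes to inverses: \<open>fst (G y)\<close> and \<open>k y\<close>
      are both inverse to \<open>k x\<close>.\<close>
    proof (rule Q.T.inv_unique)
      show "fst (G y) \<otimes>\<^bsub>Q\<^esub> k x = \<one>\<^bsub>Q\<^esub>"
        using arg_cong[OF xy(3), of "\<lambda>z. fst (G z)"] ring_hom_mult[OF G xy(2,1)] ring_hom_one[OF G] xy(4)
        by (simp add: dual_numbers_fst_snd)
      have "k y \<otimes>\<^bsub>Q\<^esub> k x = \<one>\<^bsub>Q\<^esub>"
        using arg_cong[OF xy(3), of k] ring_hom_mult[OF k xy(2,1)] ring_hom_one[OF k] by simp
      then show "k x \<otimes>\<^bsub>Q\<^esub> k y = \<one>\<^bsub>Q\<^esub>"
        using Q.T.m_comm ring_hom_closed[OF k xy(1)] ring_hom_closed[OF k xy(2)] by simp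
      show "k x \<in> carrier Q" "k y \<in> carrier Q"
        using ring_hom_closed[OF k] xy by simp_all
      show "fst (G y) \<in> carrier Q"
        using ring_hom_closed[OF G xy(2)] by (simp add: mem_Times_iff)
    qed
  qed
  have G': "G \<in> ring_hom SA ?S" using G by simp
  have agree: "H1 (a \<odot>\<^bsub>R\<^esub> \<one>\<^bsub>R\<^esub>) = G (a \<odot>\<^bsub>SA\<^esub> \<one>\<^bsub>SA\<^esub>)" if "a \<in> carrier A'" for a
  proof -
    have a: "a \<in> A" "a \<in> carrier C'" using that AC by auto
    have "a \<odot>\<^bsub>SA\<^esub> \<one>\<^bsub>SA\<^esub> = \<iota> a"
      using P.S.r_one[of "\<iota> a"] ring_hom_closed[OF CL.to_loc_hom a(2)] by simp
    then show ?thesis using G\<iota>[OF a(2)] gA[OF a(1)] by (simp add: H0_def)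
  qed
  obtain H where H: "H \<in> ring_hom P ?S"
    and Hp: "\<And>r y. r \<in> carrier R \<Longrightarrow> y \<in> carrier SA \<Longrightarrow> H (P.pt r y) = H1 r \<otimes>\<^bsub>?S\<^esub> G y"
    using P.tensor_universal[OF S.is_cring H1 G' agree] by blast
  interpret H: ring_hom_cring P ?S H by (rule UnivPoly.ring_hom_cringI[OF P.T.is_cring S.is_cring H])
  interpret j: ring_hom_cring P Q j by (rule UnivPoly.ring_hom_cringI[OF P.T.is_cring Q.T.is_cring j_hom])
  have fst_H: "fst (H x) = j x" if "x \<in> carrier P" for x
    using that
  proof (rule P.tensor_induct)
    fix r y assume ry: "r \<in> carrier R" "y \<in> carrier SA"
    then have y: "y \<in> carrier Cf" by simp
    have pc: "P.pt \<one>\<^bsub>R\<^esub> y \<in> carrier P" using ry(2) by (intro P.pure_closed) simp_all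
    show "fst (H (P.pt r y)) = j (P.pt r y)"
      unfolding Hp[OF ry] dual_numbers_fst_snd fst_G[OF y]
      unfolding P.pure_eq_mult[OF ry] j.hom_mult[OF \<phi>_closed[OF ry(1)] pc]
      by (simp add: H1_def k_def)
  next
    fix x y assume xy: "x \<in> carrier P" "y \<in> carrier P" and eq: "fst (H x) = j x" "fst (H y) = j y"
    have "fst (H (x \<ominus>\<^bsub>P\<^esub> y)) = fst (H x) \<ominus>\<^bsub>Q\<^esub> fst (H y)"
      using xy H.hom_closed[OF xy(1)] H.hom_closed[OF xy(2)] unfolding a_minus_def
      by (simp only: H.hom_add H.hom_a_inv fst.hom_add fst.hom_a_inv P.T.a_inv_closed S.a_inv_closed)
    also have "\<dots> = j (x \<ominus>\<^bsub>P\<^esub> y)"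
      using xy unfolding a_minus_def eq by simp
    finally show "fst (H (x \<ominus>\<^bsub>P\<^esub> y)) = j (x \<ominus>\<^bsub>P\<^esub> y)" .
  qed
  show thesis
  proof (rule that)
    show "derivation P (along j Q) (\<lambda>x. snd (H x))"
      by (rule dual_hom_imp_derivation[OF H fst_H])
    fix r assume r: "r \<in> carrier R"
    have "H (\<phi> r) = H1 r \<otimes>\<^bsub>?S\<^esub> \<one>\<^bsub>?S\<^esub>"
      unfolding tensor_left_def using Hp[OF r P.S.one_closed] ring_hom_one[OF G] by simp
    then have "H (\<phi> r) = H1 r" using S.r_one[OF ring_hom_closed[OF H1 r]] by simp
    then show "snd (H (\<phi> r)) = d r" by (simp add: H1_def)
  qed
qed

abbreviation "\<tau> \<equiv> tensor_left A' R S0"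
abbreviation "M \<equiv> along \<tau> T"
abbreviation "M' \<equiv> along j Q"

lemma \<psi>_semilinear: "semilinear R M M' \<phi> \<psi>"
  unfolding semilinear_def
  using ring_hom_closed[OF \<psi>_hom] ring_hom_add[OF \<psi>_hom] ring_hom_mult[OF \<psi>_hom] ring_hom_closed[OF T.tensor_left_hom]
  by (auto simp: j_\<phi>)

lemma derivation_\<psi>:
  assumes e: "derivation R M e"
  shows "derivation R (along (\<lambda>r. j (\<phi> r)) Q) (\<lambda>s. \<psi> (e s))"
  unfolding derivation_def
proof (intro conjI ballI)
  note ec = derivation_closed[OF e, simplified]
  show "(\<lambda>s. \<psi> (e s)) \<in> carrier R \<rightarrow> carrier (along (\<lambda>r. j (\<phi> r)) Q)"
    using ring_hom_closed[OF \<psi>_hom] ec by auto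
  fix x y assume xy: "x \<in> carrier R" "y \<in> carrier R"
  show "\<psi> (e (x \<oplus>\<^bsub>R\<^esub> y)) = \<psi> (e x) \<oplus>\<^bsub>along (\<lambda>r. j (\<phi> r)) Q\<^esub> \<psi> (e y)"
    unfolding derivation_add[OF e xy] using ring_hom_add[OF \<psi>_hom] ec xy by simp
  note tc = ring_hom_closed[OF T.tensor_left_hom xy(1)] ring_hom_closed[OF T.tensor_left_hom xy(2)]
  have "\<psi> (\<tau> x \<otimes>\<^bsub>T\<^esub> e y \<oplus>\<^bsub>T\<^esub> \<tau> y \<otimes>\<^bsub>T\<^esub> e x) = \<psi> (\<tau> x) \<otimes>\<^bsub>Q\<^esub> \<psi> (e y) \<oplus>\<^bsub>Q\<^esub> \<psi> (\<tau> y) \<otimes>\<^bsub>Q\<^esub> \<psi> (e x)"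
    using ring_hom_add[OF \<psi>_hom] ring_hom_mult[OF \<psi>_hom] ec[OF xy(1)] ec[OF xy(2)] tc by simp
  then show "\<psi> (e (x \<otimes>\<^bsub>R\<^esub> y)) = x \<odot>\<^bsub>along (\<lambda>r. j (\<phi> r)) Q\<^esub> \<psi> (e y) \<oplus>\<^bsub>along (\<lambda>r. j (\<phi> r)) Q\<^esub> y \<odot>\<^bsub>along (\<lambda>r. j (\<phi> r)) Q\<^esub> \<psi> (e x)"
    unfolding derivation_mult[OF e xy] along_simps j_\<phi>[OF xy(1)] j_\<phi>[OF xy(2)] .
qed

section \<open>Submodules generated by ideals\<close>

text \<open>By \<open>j_\<phi>\<close> a generator, \<open>i\<close> acting on \<open>x\<close>,
  goes to the image of \<open>i\<close> in \<open>P\<close> acting on \<open>\<psi> x\<close>, which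
  is again a generator; \<open>\<psi>\<close> is additive.\<close>

lemma ideal_smult_image:
  assumes I: "I \<subseteq> carrier R" and I': "ideal I' P" "\<phi> ` I \<subseteq> I'" and z: "z \<in> ideal_smult M I"
  shows "\<psi> z \<in> ideal_smult M' I'"
proof -
  interpret \<psi>: ring_hom_cring T Q \<psi> by (rule UnivPoly.ring_hom_cringI[OF T.T.is_cring Q.T.is_cring \<psi>_hom])
  interpret I': ideal I' P by fact
  note \<tau>c = ring_hom_closed[OF T.tensor_left_hom] and jc = ring_hom_closed[OF j_hom]
  let ?g = "{\<tau> i \<otimes>\<^bsub>T\<^esub> x | i x. i \<in> I \<and> x \<in> carrier T}" and ?g' = "{j i \<otimes>\<^bsub>Q\<^esub> x | i x. i \<in> I' \<and> x \<in> carrier Q}"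
  have g: "?g \<subseteq> carrier T" using I \<tau>c by auto
  have "?g' \<subseteq> carrier Q" using I'.Icarr jc by auto
  then have sub: "subgroup (generate (add_monoid Q) ?g') (add_monoid Q)"
    using group.generate_is_subgroup[OF Q.T.a_group] by simp
  have gen: "\<psi> h \<in> generate (add_monoid Q) ?g'" if h: "h \<in> ?g" for h
  proof -
    obtain i x where ix: "h = \<tau> i \<otimes>\<^bsub>T\<^esub> x" "i \<in> I" "x \<in> carrier T" using h by auto
    have i: "i \<in> carrier R" using ix(2) I by blast
    have "\<psi> h = j (\<phi> i) \<otimes>\<^bsub>Q\<^esub> \<psi> x" unfolding ix(1) j_\<phi>[OF i] using \<tau>c[OF i] ix(3) by simp
    moreover have "\<phi> i \<in> I'" using I'(2) ix(2) by blast
    ultimately have "\<psi> h \<in> ?g'" using \<psi>.hom_closed[OF ix(3)] by blast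
    then show ?thesis by (rule generate.incl)
  qed
  have "z \<in> generate (add_monoid T) ?g" using z unfolding ideal_smult_along .
  \<comment> \<open>Membership in the carrier is carried along, since additivity of
    \<open>\<psi>\<close> is available only there.\<close>
  then have "z \<in> carrier T \<and> \<psi> z \<in> generate (add_monoid Q) ?g'"
  proof induction
    case one
    show ?case using subgroup.one_closed[OF sub] by simp
  next
    case (incl h)
    then show ?case using g gen by blast
  next
    case (inv h)
    then have "h \<in> carrier T" using g by blast
    moreover have "inv\<^bsub>add_monoid Q\<^esub> (\<psi> h) \<in> generate (add_monoid Q) ?g'"
      by (rule subgroup.m_inv_closed[OF sub gen[OF inv]])
    ultimately show ?case unfolding a_inv_def[symmetric] by simp
  next
    case (eng h1 h2)
    then show ?case using subgroup.m_closed[OF sub, of "\<psi> h1" "\<psi> h2"] by simp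
  qed
  then show ?thesis unfolding ideal_smult_along by blast
qed

text \<open>Supplies the conditions that \<open>derivation_in_submodule\<close> puts on
  \<open>N\<close>. Multiplication by \<open>j x\<close> permutes the shape of the generators, by
  commutativity, and distributes over their sums.\<close>

lemma ideal_smult_submodule:
  assumes I': "ideal I' P"
  shows "subgroup (ideal_smult M' I') (add_monoid Q)"
    and "\<And>x y. x \<in> I' \<Longrightarrow> y \<in> carrier Q \<Longrightarrow> j x \<otimes>\<^bsub>Q\<^esub> y \<in> ideal_smult M' I'"
    and "\<And>x y. x \<in> carrier P \<Longrightarrow> y \<in> ideal_smult M' I' \<Longrightarrow> j x \<otimes>\<^bsub>Q\<^esub> y \<in> ideal_smult M' I'"
proof -
  interpret I': ideal I' P by fact
  note jc = ring_hom_closed[OF j_hom]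
  let ?g = "{j i \<otimes>\<^bsub>Q\<^esub> x | i x. i \<in> I' \<and> x \<in> carrier Q}"
  have g: "?g \<subseteq> carrier Q" using I'.Icarr jc by auto
  show sub: "subgroup (ideal_smult M' I') (add_monoid Q)"
    unfolding ideal_smult_along using group.generate_is_subgroup[OF Q.T.a_group] g by simp
  show incl: "j x \<otimes>\<^bsub>Q\<^esub> y \<in> ideal_smult M' I'" if "x \<in> I'" "y \<in> carrier Q" for x y
    unfolding ideal_smult_along by (rule generate.incl) (use that in blast)
  show "j x \<otimes>\<^bsub>Q\<^esub> y \<in> ideal_smult M' I'" if x: "x \<in> carrier P" and y: "y \<in> ideal_smult M' I'" for x y
  proof -
    have mult: "j x \<otimes>\<^bsub>Q\<^esub> h \<in> ideal_smult M' I'" if h: "h \<in> ?g" for h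
    proof -
      obtain i z where iz: "h = j i \<otimes>\<^bsub>Q\<^esub> z" "i \<in> I'" "z \<in> carrier Q" using h by auto
      have "j x \<otimes>\<^bsub>Q\<^esub> h = j i \<otimes>\<^bsub>Q\<^esub> (j x \<otimes>\<^bsub>Q\<^esub> z)"
        unfolding iz(1) using jc[OF x] jc[OF I'.Icarr[OF iz(2)]] iz(3) by (simp add: Q.T.m_lcomm)
      then show ?thesis using incl[OF iz(2), of "j x \<otimes>\<^bsub>Q\<^esub> z"] jc[OF x] iz(3) by simp
    qed
    have "y \<in> generate (add_monoid Q) ?g" using y unfolding ideal_smult_along .
    then have "y \<in> carrier Q \<and> j x \<otimes>\<^bsub>Q\<^esub> y \<in> ideal_smult M' I'"
    proof induction
      case one
      show ?case using subgroup.one_closed[OF sub] jc[OF x] by simp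
    next
      case (incl h)
      then show ?case using g mult by blast
    next
      case (inv h)
      then have h: "h \<in> carrier Q" using g by blast
      moreover have "j x \<otimes>\<^bsub>Q\<^esub> (\<ominus>\<^bsub>Q\<^esub> h) = \<ominus>\<^bsub>Q\<^esub> (j x \<otimes>\<^bsub>Q\<^esub> h)"
        using jc[OF x] h by (simp add: Q.T.r_minus)
      moreover have "inv\<^bsub>add_monoid Q\<^esub> (j x \<otimes>\<^bsub>Q\<^esub> h) \<in> ideal_smult M' I'"
        by (rule subgroup.m_inv_closed[OF sub mult[OF inv]])
      ultimately show ?case unfolding a_inv_def[symmetric] by simp
    next
      case (eng h1 h2)
      then show ?case
        using subgroup.m_closed[OF sub, of "j x \<otimes>\<^bsub>Q\<^esub> h1" "j x \<otimes>\<^bsub>Q\<^esub> h2"] jc[OF x] by (simp add: Q.T.r_distr)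
    qed
    then show ?thesis ..
  qed
qed

text \<open>The two arguments are treated differently. With the first fixed at
  \<open>\<phi> i\<close>, the second is extended from \<open>R\<close> to \<open>P\<close> by
  \<open>derivation_in_submodule\<close>. The first then runs from the generators of the ideal to
  the whole ideal, by showing that the good elements form an ideal.\<close>

lemma biderivation_ideal_lift:
  assumes I: "ideal I R" and G: "biderivation P M' G"
    and base: "\<And>i r. i \<in> I \<Longrightarrow> r \<in> carrier R \<Longrightarrow> G (\<phi> i) (\<phi> r) \<in> \<psi> ` ideal_smult M I"
    and x: "x \<in> Idl\<^bsub>P\<^esub> (\<phi> ` I)" and y: "y \<in> carrier P"
  shows "G x y \<in> ideal_smult M' (Idl\<^bsub>P\<^esub> (\<phi> ` I))"
proof -
  let ?I = "Idl\<^bsub>P\<^esub> (\<phi> ` I)"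
  have IR: "I \<subseteq> carrier R" using ideal.Icarr[OF I] by blast
  then have \<phi>I: "\<phi> ` I \<subseteq> carrier P" using \<phi>_closed by blast
  have I': "ideal ?I P" by (rule P.T.genideal_ideal[OF \<phi>I])
  have \<phi>I': "\<phi> ` I \<subseteq> ?I" by (rule P.T.genideal_self[OF \<phi>I])
  let ?N = "ideal_smult M' ?I"
  note N = ideal_smult_submodule[OF I']
  have Nadd: "y \<oplus>\<^bsub>Q\<^esub> z \<in> ?N" if "y \<in> ?N" "z \<in> ?N" for y z using subgroup.m_closed[OF N(1) that] by simp
  note G1 = biderivation_left[OF G] and G2 = biderivation_right[OF G]
  have Gc: "G x y \<in> carrier Q" if "x \<in> carrier P" "y \<in> carrier P" for x y
    using derivation_closed[OF G1[OF that(1)] that(2)] by simp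
  have baseN: "G (\<phi> i) (\<phi> r) \<in> ?N" if ir: "i \<in> I" "r \<in> carrier R" for i r
  proof -
    obtain z where z: "z \<in> ideal_smult M I" "G (\<phi> i) (\<phi> r) = \<psi> z" using base[OF ir] by blast
    show ?thesis unfolding z(2) by (rule ideal_smult_image[OF IR I' \<phi>I' z(1)])
  qed
  interpret I': ideal ?I P by fact
  \<comment> \<open>The good elements are sought inside \<open>?I\<close>. In the Leibniz expansion
    of \<open>G\<close> at a product of \<open>z\<close> and \<open>x\<close>, the term
    \<open>j x\<close> times \<open>G z y\<close> has no reason to lie in \<open>?N\<close> unless
    \<open>x\<close> is in \<open>?I\<close>.\<close>
  define J where "J = {x \<in> ?I. \<forall>y\<in>carrier P. G x y \<in> ?N}"
  have JP: "x \<in> carrier P" if "x \<in> J" for x using that I'.Icarr unfolding J_def by blast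
  have Jmult: "z \<otimes>\<^bsub>P\<^esub> x \<in> J" if x: "x \<in> J" and z: "z \<in> carrier P" for x z
  proof -
    have "G (z \<otimes>\<^bsub>P\<^esub> x) y \<in> ?N" if y: "y \<in> carrier P" for y
      unfolding derivation_mult[OF G2[OF y] z JP[OF x], simplified]
      using x y by (intro Nadd N(2,3) z Gc) (auto simp: J_def)
    then show ?thesis using I'.I_l_closed[OF _ z] x unfolding J_def by blast
  qed
  have Jadd: "x \<oplus>\<^bsub>P\<^esub> z \<in> J" if x: "x \<in> J" and z: "z \<in> J" for x z
  proof -
    have "G (x \<oplus>\<^bsub>P\<^esub> z) y \<in> ?N" if y: "y \<in> carrier P" for y
      unfolding derivation_add[OF G2[OF y] JP[OF x] JP[OF z], simplified]
      using x z y by (intro Nadd) (auto simp: J_def)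
    then show ?thesis using I'.a_closed x z unfolding J_def by blast
  qed
  have "ideal J P"
  proof (rule idealI[OF P.T.ring_axioms])
    show "subgroup J (add_monoid P)"
    proof (rule group.subgroupI[OF P.T.a_group])
      show "J \<subseteq> carrier (add_monoid P)" using JP by auto
      have i: "\<zero>\<^bsub>R\<^esub> \<in> I" using additive_subgroup.zero_closed[OF ideal.axioms(1)[OF I]] .
      have "\<phi> \<zero>\<^bsub>R\<^esub> \<in> J"
        unfolding J_def
      proof (intro CollectI conjI ballI)
        show "\<phi> \<zero>\<^bsub>R\<^esub> \<in> ?I" using \<phi>I' i by blast
        fix y assume y: "y \<in> carrier P"
        have c: "\<phi> \<zero>\<^bsub>R\<^esub> \<in> carrier P" using \<phi>I i by blast
        show "G (\<phi> \<zero>\<^bsub>R\<^esub>) y \<in> ?N"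
          by (rule derivation_in_submodule[OF G1[OF c] N(1,3) baseN[OF i] y])
      qed
      then show "J \<noteq> {}" by blast
      fix x assume x: "x \<in> J"
      have "(\<ominus>\<^bsub>P\<^esub> \<one>\<^bsub>P\<^esub>) \<otimes>\<^bsub>P\<^esub> x \<in> J" by (rule Jmult[OF x]) simp
      moreover have "(\<ominus>\<^bsub>P\<^esub> \<one>\<^bsub>P\<^esub>) \<otimes>\<^bsub>P\<^esub> x = \<ominus>\<^bsub>P\<^esub> x" using JP[OF x] by (simp add: P.T.l_minus)
      ultimately show "inv\<^bsub>add_monoid P\<^esub> x \<in> J" by (simp add: a_inv_def)
      fix z assume "z \<in> J"
      then show "x \<otimes>\<^bsub>add_monoid P\<^esub> z \<in> J" using Jadd[OF x] by simp
    qed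
    show "z \<otimes>\<^bsub>P\<^esub> x \<in> J" "x \<otimes>\<^bsub>P\<^esub> z \<in> J" if "x \<in> J" "z \<in> carrier P" for x z
      using Jmult[OF that] P.T.m_comm[OF JP[OF that(1)] that(2)] by simp_all
  qed
  moreover have "\<phi> ` I \<subseteq> J"
  proof
    fix u assume "u \<in> \<phi> ` I"
    then obtain i where i: "i \<in> I" "u = \<phi> i" by blast
    have c: "\<phi> i \<in> carrier P" using \<phi>I i by blast
    have "G (\<phi> i) y \<in> ?N" if y: "y \<in> carrier P" for y
      by (rule derivation_in_submodule[OF G1[OF c] N(1,3) baseN[OF i(1)] y])
    then show "u \<in> J" using \<phi>I' i unfolding J_def by blast
  qed
  ultimately have "?I \<subseteq> J" by (rule P.T.genideal_minimal)
  then show ?thesis using x y unfolding J_def by blast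
qed

section \<open>Extension of both variables\<close>

text \<open>\<open>E r\<close> extends the second variable for each \<open>r\<close> separately, so
  its dependence on \<open>r\<close> is arbitrary at first. Uniqueness forces this dependence to be
  a derivation, which can then be extended itself; the same argument once more restores the
  derivation property in the second variable.\<close>

theorem biderivation_extends:
  assumes D: "biderivation R M D"
  shows "\<exists>D'. biderivation P M' D' \<and> extends_biderivation R M D P M' D' \<phi> \<psi> \<and>
    (\<forall>D''. biderivation P M' D'' \<and> extends_biderivation R M D P M' D'' \<phi> \<psi> \<longrightarrow>
      (\<forall>x \<in> carrier P. \<forall>y \<in> carrier P. D'' x y = D' x y)) \<and>
    lifting_extension R M D P M' D' \<phi> \<psi>"
proof -
  note D1 = biderivation_left[OF D] and D2 = biderivation_right[OF D]
  have "\<exists>e. derivation P M' e \<and> (\<forall>s\<in>carrier R. e (\<phi> s) = \<psi> (D r s))" if r: "r \<in> carrier R" for r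
  proof (rule derivation_extends[OF derivation_\<psi>[OF D1[OF r]]])
    fix e assume "derivation P M' e" "\<And>s. s \<in> carrier R \<Longrightarrow> e (\<phi> s) = \<psi> (D r s)"
    then show ?thesis by (intro exI[of _ e] conjI ballI)
  qed
  from bchoice[OF ballI, OF this] obtain E
    where E': "\<forall>r\<in>carrier R. derivation P M' (E r) \<and> (\<forall>s\<in>carrier R. E r (\<phi> s) = \<psi> (D r s))" ..
  have E: "derivation P M' (E r)" if "r \<in> carrier R" for r using bspec[OF E' that] ..
  have E\<phi>: "E r (\<phi> s) = \<psi> (D r s)" if "r \<in> carrier R" "s \<in> carrier R" for r s
    by (rule bspec[OF conjunct2[OF bspec[OF E' that(1)]] that(2)])
  have Ec: "E r x \<in> carrier Q" if "r \<in> carrier R" "x \<in> carrier P" for r x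
    using derivation_closed[OF E[OF that(1)] that(2)] by simp
  note jc = ring_hom_closed[OF j_hom]
  have lin: "derivation P M' (\<lambda>x. u \<otimes>\<^bsub>Q\<^esub> e x \<oplus>\<^bsub>Q\<^esub> v \<otimes>\<^bsub>Q\<^esub> e' x)"
    if "derivation P M' e" "derivation P M' e'" "u \<in> carrier Q" "v \<in> carrier Q" for e e' u v
    by (rule derivation_lincomb[OF Q.T.is_cring j_hom that])
  \<comment> \<open>Each identity in \<open>r\<close> and \<open>s\<close> is one between
    derivations in \<open>x\<close>. It suffices to check it for \<open>x\<close> in the image of
    \<open>R\<close>, where it is a property of \<open>D\<close>.\<close>
  have E2: "derivation R (along (\<lambda>r. j (\<phi> r)) Q) (\<lambda>r. E r x)" if x: "x \<in> carrier P" for x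
    unfolding derivation_def
  proof (intro conjI ballI)
    show "(\<lambda>r. E r x) \<in> carrier R \<rightarrow> carrier (along (\<lambda>r. j (\<phi> r)) Q)" using Ec x by auto
    fix r s assume rs: "r \<in> carrier R" "s \<in> carrier R"
    note c = Ec[OF rs(1)] Ec[OF rs(2)] jc[OF \<phi>_closed[OF rs(1)]] jc[OF \<phi>_closed[OF rs(2)]]
    have sum: "r \<oplus>\<^bsub>R\<^esub> s \<in> carrier R" "r \<otimes>\<^bsub>R\<^esub> s \<in> carrier R" using rs by simp_all
    have "E (r \<oplus>\<^bsub>R\<^esub> s) x = \<one>\<^bsub>Q\<^esub> \<otimes>\<^bsub>Q\<^esub> E r x \<oplus>\<^bsub>Q\<^esub> \<one>\<^bsub>Q\<^esub> \<otimes>\<^bsub>Q\<^esub> E s x"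
    proof (rule derivation_unique[OF E[OF sum(1)] lin[OF E[OF rs(1)] E[OF rs(2)]] _ x])
      fix t assume t: "t \<in> carrier R"
      show "E (r \<oplus>\<^bsub>R\<^esub> s) (\<phi> t) = \<one>\<^bsub>Q\<^esub> \<otimes>\<^bsub>Q\<^esub> E r (\<phi> t) \<oplus>\<^bsub>Q\<^esub> \<one>\<^bsub>Q\<^esub> \<otimes>\<^bsub>Q\<^esub> E s (\<phi> t)"
        using derivation_add[OF derivation_\<psi>[OF D2[OF t]] rs] Ec[OF rs(1) \<phi>_closed[OF t]] Ec[OF rs(2) \<phi>_closed[OF t]]
        by (simp add: E\<phi> rs t sum)
    qed simp_all
    then show "E (r \<oplus>\<^bsub>R\<^esub> s) x = E r x \<oplus>\<^bsub>along (\<lambda>r. j (\<phi> r)) Q\<^esub> E s x"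
      using c(1,2)[OF x] by simp
    \<comment> \<open>The coefficients \<open>j (\<phi> r)\<close> and \<open>j (\<phi> s)\<close>
      do not depend on \<open>x\<close>, so the right-hand side is a combination of two derivations
      in \<open>x\<close>.\<close>
    have "E (r \<otimes>\<^bsub>R\<^esub> s) x = j (\<phi> r) \<otimes>\<^bsub>Q\<^esub> E s x \<oplus>\<^bsub>Q\<^esub> j (\<phi> s) \<otimes>\<^bsub>Q\<^esub> E r x"
    proof (rule derivation_unique[OF E[OF sum(2)] lin[OF E[OF rs(2)] E[OF rs(1)] c(3,4)] _ x])
      fix t assume t: "t \<in> carrier R"
      show "E (r \<otimes>\<^bsub>R\<^esub> s) (\<phi> t) = j (\<phi> r) \<otimes>\<^bsub>Q\<^esub> E s (\<phi> t) \<oplus>\<^bsub>Q\<^esub> j (\<phi> s) \<otimes>\<^bsub>Q\<^esub> E r (\<phi> t)"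
        using derivation_mult[OF derivation_\<psi>[OF D2[OF t]] rs] by (simp add: E\<phi> rs t sum)
    qed
    then show "E (r \<otimes>\<^bsub>R\<^esub> s) x = r \<odot>\<^bsub>along (\<lambda>r. j (\<phi> r)) Q\<^esub> E s x \<oplus>\<^bsub>along (\<lambda>r. j (\<phi> r)) Q\<^esub> s \<odot>\<^bsub>along (\<lambda>r. j (\<phi> r)) Q\<^esub> E r x"
      by simp
  qed
  have "\<exists>e. derivation P M' e \<and> (\<forall>r\<in>carrier R. e (\<phi> r) = E r x)" if x: "x \<in> carrier P" for x
  proof (rule derivation_extends[OF E2[OF x]])
    fix e assume "derivation P M' e" "\<And>r. r \<in> carrier R \<Longrightarrow> e (\<phi> r) = E r x"
    then show ?thesis by (intro exI[of _ e] conjI ballI)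
  qed
  from bchoice[OF ballI, OF this] obtain F
    where F': "\<forall>x\<in>carrier P. derivation P M' (F x) \<and> (\<forall>r\<in>carrier R. F x (\<phi> r) = E r x)" ..
  have F: "derivation P M' (F x)" if "x \<in> carrier P" for x using bspec[OF F' that] ..
  have F\<phi>: "F x (\<phi> r) = E r x" if "x \<in> carrier P" "r \<in> carrier R" for x r
    by (rule bspec[OF conjunct2[OF bspec[OF F' that(1)]] that(2)])
  have Fc: "F x y \<in> carrier Q" if "x \<in> carrier P" "y \<in> carrier P" for x y
    using derivation_closed[OF F[OF that(1)] that(2)] by simp
  \<comment> \<open>\<open>F x\<close> extends the first variable with the second fixed at
    \<open>x\<close>, hence the exchange of arguments.\<close>
  define D' where "D' y x = F x y" for y x
  have D'1: "derivation P M' (D' y)" if y: "y \<in> carrier P" for y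
    unfolding derivation_def D'_def
  proof (intro conjI ballI)
    show "(\<lambda>x. F x y) \<in> carrier P \<rightarrow> carrier M'" using Fc y by auto
    fix x z assume xz: "x \<in> carrier P" "z \<in> carrier P"
    have sum: "x \<oplus>\<^bsub>P\<^esub> z \<in> carrier P" "x \<otimes>\<^bsub>P\<^esub> z \<in> carrier P" using xz by simp_all
    have "F (x \<oplus>\<^bsub>P\<^esub> z) y = \<one>\<^bsub>Q\<^esub> \<otimes>\<^bsub>Q\<^esub> F x y \<oplus>\<^bsub>Q\<^esub> \<one>\<^bsub>Q\<^esub> \<otimes>\<^bsub>Q\<^esub> F z y"
    proof (rule derivation_unique[OF F[OF sum(1)] lin[OF F[OF xz(1)] F[OF xz(2)]] _ y])
      fix r assume r: "r \<in> carrier R"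
      show "F (x \<oplus>\<^bsub>P\<^esub> z) (\<phi> r) = \<one>\<^bsub>Q\<^esub> \<otimes>\<^bsub>Q\<^esub> F x (\<phi> r) \<oplus>\<^bsub>Q\<^esub> \<one>\<^bsub>Q\<^esub> \<otimes>\<^bsub>Q\<^esub> F z (\<phi> r)"
        using derivation_add[OF E[OF r] xz] Ec[OF r xz(1)] Ec[OF r xz(2)] by (simp add: F\<phi> xz r)
    qed simp_all
    then show "F (x \<oplus>\<^bsub>P\<^esub> z) y = F x y \<oplus>\<^bsub>M'\<^esub> F z y"
      using Fc[OF xz(1) y] Fc[OF xz(2) y] by simp
    have "F (x \<otimes>\<^bsub>P\<^esub> z) y = j x \<otimes>\<^bsub>Q\<^esub> F z y \<oplus>\<^bsub>Q\<^esub> j z \<otimes>\<^bsub>Q\<^esub> F x y"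
    proof (rule derivation_unique[OF F[OF sum(2)] lin[OF F[OF xz(2)] F[OF xz(1)] jc[OF xz(1)] jc[OF xz(2)]] _ y])
      fix r assume r: "r \<in> carrier R"
      show "F (x \<otimes>\<^bsub>P\<^esub> z) (\<phi> r) = j x \<otimes>\<^bsub>Q\<^esub> F z (\<phi> r) \<oplus>\<^bsub>Q\<^esub> j z \<otimes>\<^bsub>Q\<^esub> F x (\<phi> r)"
        using derivation_mult[OF E[OF r] xz] by (simp add: F\<phi> xz r)
    qed
    then show "F (x \<otimes>\<^bsub>P\<^esub> z) y = x \<odot>\<^bsub>M'\<^esub> F z y \<oplus>\<^bsub>M'\<^esub> z \<odot>\<^bsub>M'\<^esub> F x y" by simp
  qed
  have bi: "biderivation P M' D'"
    unfolding biderivation_def using D'1 F by (simp add: D'_def)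
  have D'\<phi>: "D' (\<phi> r) (\<phi> s) = \<psi> (D r s)" if "r \<in> carrier R" "s \<in> carrier R" for r s
    unfolding D'_def using F\<phi>[OF \<phi>_closed[OF that(2)] that(1)] E\<phi>[OF that] by simp
  have ext: "extends_biderivation R M D P M' D' \<phi> \<psi>"
    unfolding extends_biderivation_def using P.tensor_left_hom \<psi>_semilinear D'\<phi> by simp
  \<comment> \<open>Uniqueness of derivations is used twice: in the second variable with the first
    in the image of \<open>R\<close>, then in the first variable with the second arbitrary.\<close>
  have uniq: "D'' x y = D' x y"
    if bi'': "biderivation P M' D''" and ext'': "extends_biderivation R M D P M' D'' \<phi> \<psi>"
      and x: "x \<in> carrier P" and y: "y \<in> carrier P" for D'' x y
  proof -
    have "D'' (\<phi> r) y = D' (\<phi> r) y" if r: "r \<in> carrier R" for r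
    proof (rule derivation_unique[OF biderivation_left[OF bi''] biderivation_left[OF bi] _ y])
      show "\<phi> r \<in> carrier P" "\<phi> r \<in> carrier P" by (fact \<phi>_closed[OF r])+
      show "D'' (\<phi> r) (\<phi> s) = D' (\<phi> r) (\<phi> s)" if "s \<in> carrier R" for s
        using ext'' r that D'\<phi>[OF r that] unfolding extends_biderivation_def by simp
    qed
    then show ?thesis
      by (rule derivation_unique[OF biderivation_right[OF bi'' y] biderivation_right[OF bi y] _ x])
  qed
  have lift: "lifting_extension R M D P M' D' \<phi> \<psi>"
    unfolding lifting_extension_def
  proof (intro conjI allI impI ext)
    fix I J assume IJ: "bidifferential_ideal_pair R M D I J"
    then have I: "ideal I R" and J: "ideal J R"
      and DI: "\<And>i r. i \<in> I \<Longrightarrow> r \<in> carrier R \<Longrightarrow> D i r \<in> ideal_smult M I"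
      and DJ: "\<And>r i. r \<in> carrier R \<Longrightarrow> i \<in> J \<Longrightarrow> D r i \<in> ideal_smult M J"
      unfolding bidifferential_ideal_pair_def by blast+
    have gen: "ideal (Idl\<^bsub>P\<^esub> (\<phi> ` K)) P" if "ideal K R" for K
      using ideal.Icarr[OF that] \<phi>_closed by (intro P.T.genideal_ideal) blast
    have "D' x y \<in> ideal_smult M' (Idl\<^bsub>P\<^esub> (\<phi> ` I))" if "x \<in> Idl\<^bsub>P\<^esub> (\<phi> ` I)" "y \<in> carrier P" for x y
      by (rule biderivation_ideal_lift[OF I bi _ that])
        (use D'\<phi> DI ideal.Icarr[OF I] in \<open>simp add: image_iff, blast\<close>)
    \<comment> \<open>The other ideal of the pair is the same statement for the biderivation with
      its arguments exchanged.\<close>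
    moreover have "D' y x \<in> ideal_smult M' (Idl\<^bsub>P\<^esub> (\<phi> ` J))" if "x \<in> Idl\<^bsub>P\<^esub> (\<phi> ` J)" "y \<in> carrier P" for x y
      by (rule biderivation_ideal_lift[OF J biderivation_swap[OF bi] _ that])
        (use D'\<phi> DJ ideal.Icarr[OF J] in \<open>simp add: image_iff, blast\<close>)
    ultimately show "bidifferential_ideal_pair P M' D' (Idl\<^bsub>P\<^esub> (\<phi> ` I)) (Idl\<^bsub>P\<^esub> (\<phi> ` J))"
      unfolding bidifferential_ideal_pair_def using gen[OF I] gen[OF J] by blast
  qed
  show ?thesis
    by (intro exI[of _ D'] conjI allI impI ballI bi ext lift) (elim conjE, rule uniq)
qed

end

theorem theorem2p10:
  fixes B :: "('b, 'm) ring_scheme" and A :: "'b set" and b :: 'b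
    and R :: "('b, 'r, 'n) module_scheme"
    and D :: "'r \<Rightarrow> 'r \<Rightarrow> (('r \<times> 'b) \<Rightarrow>\<^sub>0 int) set"
  assumes "domain B" and "subring A B"
    and "b \<in> carrier B"
    and "separably_algebraic (frac_field B) (frac_subfield B A)
           (to_loc B (carrier B - {\<zero>\<^bsub>B\<^esub>}) b)"
    and "algebra (subring_of B A) R"
    and "biderivation R (base_module B A R) D"
  shows "\<exists>f \<in> ring.simple_extension B A b. f \<noteq> \<zero>\<^bsub>B\<^esub> \<and>
    (let C = ring.simple_extension B A b;
         M = base_module B A R;
         R' = ext_ring B A R C f;
         M' = ext_module B A R f;
         \<phi> = ext_ring_map B A R C f;
         \<psi> = ext_module_map B A R f
     in \<exists>D'. biderivation R' M' D' \<and> extends_biderivation R M D R' M' D' \<phi> \<psi> \<and>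
          (\<forall>D''. biderivation R' M' D'' \<and> extends_biderivation R M D R' M' D'' \<phi> \<psi> \<longrightarrow>
             (\<forall>x \<in> carrier R'. \<forall>y \<in> carrier R'. D'' x y = D' x y)) \<and>
          lifting_extension R M D R' M' D' \<phi> \<psi>)"
proof -
  interpret B: domain B by fact
  obtain c n where *: "\<And>i. c i \<in> A" "c n \<noteq> \<zero>\<^bsub>B\<^esub>" "psum B c b (Suc n) = \<zero>\<^bsub>B\<^esub>" "pderiv_sum B c b n \<noteq> \<zero>\<^bsub>B\<^esub>"
    "\<And>d m. (\<And>i. d i \<in> A) \<Longrightarrow> d m \<noteq> \<zero>\<^bsub>B\<^esub> \<Longrightarrow> psum B d b (Suc m) = \<zero>\<^bsub>B\<^esub> \<Longrightarrow> n \<le> m"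
    using B.separable_polynomial[OF assms(2-4)] by blast
  interpret E: separable_simple_extension B A R b c n
  proof (rule separable_simple_extension.intro[OF assms(1,5)],
      rule separable_simple_extension_axioms.intro[OF assms(2,3) *(1-4)])
    show "n \<le> m" if "\<And>i. d i \<in> A" "d m \<noteq> \<zero>\<^bsub>B\<^esub>" "psum B d b (Suc m) = \<zero>\<^bsub>B\<^esub>" for d m
      by (rule *(5)[of d, OF that])
  qed
  \<comment> \<open>The witness is \<open>E.f\<close>, the leading coefficient times the derivative
    at \<open>b\<close>; the rings, modules and maps of the statement unfold to those of the
    locale.\<close>
  show ?thesis
    using E.f_C E.f_nonzero E.biderivation_extends[OF assms(6)[unfolded base_module_def]]
    unfolding Let_def base_module_def ext_ring_def ext_module_def ext_ring_map_def ext_module_map_def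
    by blast
qed

end
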